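(* There is no Diophantine quintuple $\{a,b,c,d,e\}$ with $a<b<c<d<e$ such that $d>b^{5}$ (that is, such that $\{a,b,d\}$ is a Diophantine triple with $d>b^5$).
   Context: A Diophantine $m$-tuple is a set of $m$ distinct positive integers $a_1<a_2<\cdots<a_m$ such that $a_ia_j+1$ is a perfect square for all $1\le i<j\le m$. A Diophantine quintuple is the case $m=5$, a triple the case $m=3$. *)

theory Defs
  imports Main
begin

definition is_square :: "nat \<Rightarrow> bool" where
  "is_square n \<longleftrightarrow> (\<exists>k. n = k ^ 2)"

definition diophantine_quintuple :: "nat \<Rightarrow> nat \<Rightarrow> nat \<Rightarrow> nat \<Rightarrow> nat \<Rightarrow> bool" where
  "diophantine_quintuple a b c d e \<longleftrightarrow>
     0 < a \<and> a < b \<and> b < c \<and> c < d \<and> d < e \<and>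
     (\<forall>x\<in>{a,b,c,d,e}. \<forall>y\<in>{a,b,c,d,e}. x < y \<longrightarrow> is_square (x * y + 1))"

end

theory Submission
  imports Defs "HOL-Analysis.Generalised_Binomial_Theorem" "HOL-Computational_Algebra.Formal_Power_Series"
begin

text \<open>
  Let \<open>z^2 = d e + 1\<close>. Dividing by the fundamental solution, \<open>z\<close> and its companions \<open>x^2 = i e + 1\<close> for
  \<open>i = a, b, c\<close> come from the residue \<open>\<rho>\<close> of \<open>z\<close> modulo \<open>2 d\<close> in \<open>(- d, d]\<close> by repeated steps of the Pell
  recurrence, and \<open>E = (\<rho>^2 - 1) / d\<close> satisfies the same conditions as \<open>e\<close>. So either \<open>E = 0\<close>, or
  \<open>{a, b, c, E, d}\<close> is a smaller quintuple. Comparing the recurrences modulo \<open>4 d^2\<close> shows that the numbers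
  of steps are large, hence \<open>z\<close> exceeds a large power of \<open>d\<close>; by induction this also yields that the
  largest element of a quintuple is at least the seventh power of the next one.

  On the other hand \<open>sqrt (1 + a / N)\<close> and \<open>sqrt (1 + b / N)\<close> with \<open>N = a b d\<close> have the common denominator
  \<open>a b z\<close> in unusually good rational approximations. Integer combinations of \<open>1\<close> and these two numbers that are very small,
  obtained as divided differences of \<open>(1 + x w)^(k + 1/2)\<close> with nodes \<open>0, a, b\<close> of multiplicity about \<open>k\<close>,
  bound \<open>z\<close> by a smaller power of \<open>d\<close>. For \<open>d > b^5\<close> the two bounds contradict each other, apart from
  \<open>{1, 3, 1680}\<close>, which is excluded by a congruence.
\<close>

section \<open>Divided differences with multiple nodes\<close>

text \<open>Pell steps use the square of the fundamental solution. They fix z modulo 2 d, so one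
  residue \<rho> and one E serve a, b and c at once. The congruences only force an index n with n^2
  at least of order d / (c |\<rho>|), where |\<rho>| is about sqrt (d E). This says nothing unless c
  and E are small against d. Hence the induction: if E > 0, the smaller quintuple ending in d makes
  d at least the seventh power of a number that bounds c and E. If E = 0, then \<rho> is 1 or -1 and
  the congruence is strong by itself. On the analytic side, one particular form could vanish at the
  integer vector. So three forms are kept for each k, with one extra multiplicity at one of the
  nodes. They are independent because certain moments obey a recurrence whose leading coefficient is
  x times half an odd integer. The gain per unit of k is 8 a d / (85 b^4), which must exceed 1; this
  is what the exponent in d > b^5 pays for. For small b it may not be enough, and the d in the
  remaining range are listed.\<close>

definition pole :: "real \<Rightarrow> real fps" where
  "pole u = inverse (fps_X + fps_const u)"

text \<open>\<open>pole (\<alpha> - \<beta>)\<close> is the expansion of 1 / (w - \<beta>) at w =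
  \<alpha> in the local variable X = w - \<alpha>.\<close>

lemma pole_mult: "u \<noteq> 0 \<Longrightarrow> pole u * (fps_X + fps_const u) = 1"
  unfolding pole_def by (rule inverse_mult_eq_1) simp

lemma pole_expand: "u \<noteq> 0 \<Longrightarrow> F = fps_const u * (pole u * F) + fps_X * (pole u * F)"
proof -
  assume "u \<noteq> 0"
  have "fps_const u * (pole u * F) + fps_X * (pole u * F) = (pole u * (fps_X + fps_const u)) * F"
    by (simp add: algebra_simps)
  then show ?thesis by (simp add: pole_mult[OF \<open>u \<noteq> 0\<close>])
qed

text \<open>The residue at \<open>0\<close> of \<open>F / X^p\<close>.\<close>

definition local_res :: "real fps \<Rightarrow> nat \<Rightarrow> real" where
  "local_res F p = fps_nth (fps_X * F) p"

text \<open>The factor \<open>fps_X\<close> in the definition makes a node of multiplicity 0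
  contribute nothing; indexing by p - 1 would return the constant coefficient instead.\<close>

lemma local_res_0 [simp]: "local_res F 0 = 0"
  by (simp add: local_res_def)

lemma local_res_Suc [simp]: "local_res F (Suc p) = fps_nth F p"
  by (simp add: local_res_def)

lemma local_res_add: "local_res (F + G) p = local_res F p + local_res G p"
  by (simp add: local_res_def algebra_simps)

lemma local_res_diff: "local_res (F - G) p = local_res F p - local_res G p"
  by (simp add: local_res_def algebra_simps)

lemma local_res_const_mult: "local_res (fps_const c * F) p = c * local_res F p"
  by (cases p) auto

lemma local_res_X_mult: "local_res (fps_X * F) (Suc p) = local_res F p"
  by (simp add: local_res_def)

text \<open>The sum of the residues of \<open>\<phi> w / ((w - \<alpha>)^p (w - \<beta>)^q (w - \<gamma>)^r)\<close>, where \<open>f, g, h\<close> are the expansions of \<open>\<phi>\<close> at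
  \<open>\<alpha>, \<beta>, \<gamma>\<close>: a divided difference of \<open>\<phi>\<close>.\<close>

definition dd :: "real \<Rightarrow> real \<Rightarrow> real \<Rightarrow> real fps \<Rightarrow> real fps \<Rightarrow> real fps \<Rightarrow> nat \<Rightarrow> nat \<Rightarrow> nat \<Rightarrow> real" where
  "dd \<alpha> \<beta> \<gamma> f g h p q r =
     local_res (f * pole (\<alpha> - \<beta>) ^ q * pole (\<alpha> - \<gamma>) ^ r) p
   + local_res (g * pole (\<beta> - \<alpha>) ^ p * pole (\<beta> - \<gamma>) ^ r) q
   + local_res (h * pole (\<gamma> - \<alpha>) ^ p * pole (\<gamma> - \<beta>) ^ q) r"

lemma dd_swap12: "dd \<alpha> \<beta> \<gamma> f g h p q r = dd \<beta> \<alpha> \<gamma> g f h q p r"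
  unfolding dd_def by (simp add: mult.assoc mult.commute[of "pole (\<gamma> - \<alpha>) ^ p"])

lemma dd_swap23: "dd \<alpha> \<beta> \<gamma> f g h p q r = dd \<alpha> \<gamma> \<beta> f h g p r q"
  unfolding dd_def by (simp add: mult.assoc mult.commute[of "pole (\<alpha> - \<beta>) ^ q"])

text \<open>Writing u = (X + u) - X lowers either the exponent of the distant pole or the
  multiplicity at the node itself.\<close>

lemma local_res_pole_Suc:
  assumes "u \<noteq> 0"
  shows "u * local_res (K * pole u ^ Suc q) (Suc p)
       = local_res (K * pole u ^ q) (Suc p) - local_res (K * pole u ^ Suc q) p"
proof -
  have "K * pole u ^ q = fps_const u * (K * pole u ^ Suc q) + fps_X * (K * pole u ^ Suc q)"
    using pole_expand[OF assms, of "K * pole u ^ q"] by (simp add: mult_ac)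
  then have "local_res (K * pole u ^ q) (Suc p)
      = u * local_res (K * pole u ^ Suc q) (Suc p) + local_res (K * pole u ^ Suc q) p"
    by (simp only: local_res_add local_res_const_mult local_res_X_mult)
  then show ?thesis by linarith
qed

lemma pole_diff:
  assumes "u \<noteq> 0" "v \<noteq> 0"
  shows "fps_const (v - u) * (pole u * pole v) = pole u - pole v"
proof -
  have "pole u = fps_const v * (pole v * pole u) + fps_X * (pole v * pole u)"
    by (rule pole_expand[OF assms(2)])
  moreover have "pole v = fps_const u * (pole u * pole v) + fps_X * (pole u * pole v)"
    by (rule pole_expand[OF assms(1)])
  ultimately have "pole u - pole v = fps_const v * (pole v * pole u) - fps_const u * (pole u * pole v)"
    by (metis (no_types, lifting) add_diff_cancel_right mult.commute)
  then show ?thesis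
    by (simp add: algebra_simps flip: fps_const_sub)
qed

text \<open>The partial fraction identity (\<alpha> - \<beta>) / ((w - \<alpha>) (w - \<beta>)) = 1
  / (w - \<alpha>) - 1 / (w - \<beta>), taken residue by residue. At \<alpha> and \<beta> one of the
  factors is the local variable; at \<gamma> both are distant poles and \<open>pole_diff\<close>
  applies.\<close>

lemma dd_rec12:
  assumes "\<alpha> \<noteq> \<beta>" "\<alpha> \<noteq> \<gamma>" "\<beta> \<noteq> \<gamma>"
  shows "(\<alpha> - \<beta>) * dd \<alpha> \<beta> \<gamma> f g h (Suc p) (Suc q) r
       = dd \<alpha> \<beta> \<gamma> f g h (Suc p) q r - dd \<alpha> \<beta> \<gamma> f g h p (Suc q) r"
proof -
  have 1: "(\<alpha> - \<beta>) * local_res (f * pole (\<alpha> - \<beta>) ^ Suc q * pole (\<alpha> - \<gamma>) ^ r) (Suc p)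
    = local_res (f * pole (\<alpha> - \<beta>) ^ q * pole (\<alpha> - \<gamma>) ^ r) (Suc p)
    - local_res (f * pole (\<alpha> - \<beta>) ^ Suc q * pole (\<alpha> - \<gamma>) ^ r) p"
    using local_res_pole_Suc[of "\<alpha> - \<beta>" "f * pole (\<alpha> - \<gamma>) ^ r" q p] assms
    by (simp add: mult_ac)
  have 2: "(\<beta> - \<alpha>) * local_res (g * pole (\<beta> - \<alpha>) ^ Suc p * pole (\<beta> - \<gamma>) ^ r) (Suc q)
    = local_res (g * pole (\<beta> - \<alpha>) ^ p * pole (\<beta> - \<gamma>) ^ r) (Suc q)
    - local_res (g * pole (\<beta> - \<alpha>) ^ Suc p * pole (\<beta> - \<gamma>) ^ r) q"
    using local_res_pole_Suc[of "\<beta> - \<alpha>" "g * pole (\<beta> - \<gamma>) ^ r" p q] assms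
    by (simp add: mult_ac)
  have "fps_const (\<alpha> - \<beta>) * (h * pole (\<gamma> - \<alpha>) ^ Suc p * pole (\<gamma> - \<beta>) ^ Suc q)
      = (h * pole (\<gamma> - \<alpha>) ^ p * pole (\<gamma> - \<beta>) ^ q) * (pole (\<gamma> - \<alpha>) - pole (\<gamma> - \<beta>))"
    using pole_diff[of "\<gamma> - \<alpha>" "\<gamma> - \<beta>"] assms by (simp add: mult_ac)
  also have "\<dots> = h * pole (\<gamma> - \<alpha>) ^ Suc p * pole (\<gamma> - \<beta>) ^ q
                - h * pole (\<gamma> - \<alpha>) ^ p * pole (\<gamma> - \<beta>) ^ Suc q"
    by (simp add: algebra_simps)
  finally have 3: "(\<alpha> - \<beta>) * local_res (h * pole (\<gamma> - \<alpha>) ^ Suc p * pole (\<gamma> - \<beta>) ^ Suc q) r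
     = local_res (h * pole (\<gamma> - \<alpha>) ^ Suc p * pole (\<gamma> - \<beta>) ^ q) r
     - local_res (h * pole (\<gamma> - \<alpha>) ^ p * pole (\<gamma> - \<beta>) ^ Suc q) r"
    by (metis local_res_const_mult local_res_diff)
  have "(\<alpha> - \<beta>) * dd \<alpha> \<beta> \<gamma> f g h (Suc p) (Suc q) r
     = (\<alpha> - \<beta>) * local_res (f * pole (\<alpha> - \<beta>) ^ Suc q * pole (\<alpha> - \<gamma>) ^ r) (Suc p)
     - (\<beta> - \<alpha>) * local_res (g * pole (\<beta> - \<alpha>) ^ Suc p * pole (\<beta> - \<gamma>) ^ r) (Suc q)
     + (\<alpha> - \<beta>) * local_res (h * pole (\<gamma> - \<alpha>) ^ Suc p * pole (\<gamma> - \<beta>) ^ Suc q) r"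
    unfolding dd_def by (simp only: algebra_simps)
  then show ?thesis
    unfolding 1 2 3 dd_def by linarith
qed

lemma dd_rec13:
  assumes "\<alpha> \<noteq> \<beta>" "\<alpha> \<noteq> \<gamma>" "\<beta> \<noteq> \<gamma>"
  shows "(\<alpha> - \<gamma>) * dd \<alpha> \<beta> \<gamma> f g h (Suc p) q (Suc r)
       = dd \<alpha> \<beta> \<gamma> f g h (Suc p) q r - dd \<alpha> \<beta> \<gamma> f g h p q (Suc r)"
  using dd_rec12[of \<alpha> \<gamma> \<beta> f h g p r q] assms by (simp add: dd_swap23[of \<alpha> \<beta> \<gamma>])

lemma dd_rec23:
  assumes "\<alpha> \<noteq> \<beta>" "\<alpha> \<noteq> \<gamma>" "\<beta> \<noteq> \<gamma>"
  shows "(\<beta> - \<gamma>) * dd \<alpha> \<beta> \<gamma> f g h p (Suc q) (Suc r)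
       = dd \<alpha> \<beta> \<gamma> f g h p (Suc q) r - dd \<alpha> \<beta> \<gamma> f g h p q (Suc r)"
  using dd_rec13[of \<beta> \<alpha> \<gamma> g f h q p r] assms by (simp add: dd_swap12[of \<alpha> \<beta> \<gamma>])

section \<open>Divided differences of powers of w\<close>

definition lin :: "real \<Rightarrow> real fps" where "lin u = fps_const u + fps_X"

text \<open>\<open>lin u\<close> expands the function w at the node u. The lemma is the splitting w
  = \<alpha> + (w - \<alpha>), whose second part cancels one factor of the denominator.\<close>

lemma dd_lin_mult:
  assumes "\<alpha> \<noteq> \<beta>" "\<alpha> \<noteq> \<gamma>" "\<beta> \<noteq> \<gamma>"
  shows "dd \<alpha> \<beta> \<gamma> (lin \<alpha> * f) (lin \<beta> * g) (lin \<gamma> * h) (Suc p) q r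
       = \<alpha> * dd \<alpha> \<beta> \<gamma> f g h (Suc p) q r + dd \<alpha> \<beta> \<gamma> f g h p q r"
proof -
  have 1: "local_res (lin \<alpha> * f * A * B) (Suc p) = \<alpha> * local_res (f * A * B) (Suc p) + local_res (f * A * B) p"
    for A B
  proof -
    have "lin \<alpha> * f * A * B = fps_const \<alpha> * (f * A * B) + fps_X * (f * A * B)"
      by (simp add: lin_def algebra_simps)
    then show ?thesis by (simp only: local_res_add local_res_const_mult local_res_X_mult)
  qed
  have 2: "local_res (lin u * f * pole (u - \<alpha>) ^ Suc p * B) q
      = \<alpha> * local_res (f * pole (u - \<alpha>) ^ Suc p * B) q + local_res (f * pole (u - \<alpha>) ^ p * B) q"
    if "u \<noteq> \<alpha>" for u f B q
  proof -
    have "lin u = fps_const \<alpha> + (fps_X + fps_const (u - \<alpha>))"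
      by (simp add: lin_def flip: fps_const_sub)
    then have "lin u * f * pole (u - \<alpha>) ^ Suc p * B = fps_const \<alpha> * (f * pole (u - \<alpha>) ^ Suc p * B)
       + (pole (u - \<alpha>) * (fps_X + fps_const (u - \<alpha>))) * (f * pole (u - \<alpha>) ^ p * B)"
      by (simp only: power_Suc distrib_right distrib_left mult_ac)
    then show ?thesis using that
      by (simp only: pole_mult right_minus_eq not_False_eq_True mult_1_left local_res_add local_res_const_mult)
  qed
  show ?thesis
    unfolding dd_def
    using 1[of "pole (\<alpha> - \<beta>) ^ q" "pole (\<alpha> - \<gamma>) ^ r"]
          2[of \<beta> g "pole (\<beta> - \<gamma>) ^ r" q] 2[of \<gamma> h "pole (\<gamma> - \<beta>) ^ q" r] assms
    by (simp add: algebra_simps)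
qed

text \<open>A rational function decaying at least like w^(-2) has residue sum 0. The three
  recursions replace the residue theorem: they lower the total multiplicity until a single node is
  left.\<close>

lemma dd_one:
  assumes "\<alpha> \<noteq> \<beta>" "\<alpha> \<noteq> \<gamma>" "\<beta> \<noteq> \<gamma>"
  shows "dd \<alpha> \<beta> \<gamma> 1 1 1 p q r = (if p + q + r = 1 then 1 else 0)"
proof (induction "p + q + r" arbitrary: p q r rule: less_induct)
  case less
  have single: "local_res 1 m = (if m = 1 then 1 else 0)" for m
    by (cases m) auto
  consider (pq) p' q' where "p = Suc p'" "q = Suc q'" | (pr) p' r' where "p = Suc p'" "r = Suc r'"
    | (qr) q' r' where "q = Suc q'" "r = Suc r'"
    | "p = 0" "q = 0" | "p = 0" "r = 0" | "q = 0" "r = 0"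
    by (metis not0_implies_Suc)
  then show ?case
  proof cases
    case pq
    have "(\<alpha> - \<beta>) * dd \<alpha> \<beta> \<gamma> 1 1 1 p q r = 0"
      unfolding pq dd_rec12[OF assms] using less[of p q' r] less[of p' q r] pq by simp
    then show ?thesis using assms pq by simp
  next
    case pr
    have "(\<alpha> - \<gamma>) * dd \<alpha> \<beta> \<gamma> 1 1 1 p q r = 0"
      unfolding pr dd_rec13[OF assms] using less[of p q r'] less[of p' q r] pr by simp
    then show ?thesis using assms pr by simp
  next
    case qr
    have "(\<beta> - \<gamma>) * dd \<alpha> \<beta> \<gamma> 1 1 1 p q r = 0"
      unfolding qr dd_rec23[OF assms] using less[of p q r'] less[of p q' r] qr by simp
    then show ?thesis using assms qr by simp
  qed (simp_all add: dd_def single)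
qed

definition geo :: "real \<Rightarrow> real fps" where
  "geo u = Abs_fps (\<lambda>n. u ^ n)"

lemma geo_expand: "geo u = 1 + fps_const u * fps_X * geo u"
proof (rule fps_ext)
  fix n
  show "fps_nth (geo u) n = fps_nth (1 + fps_const u * fps_X * geo u) n"
    by (cases n) (auto simp: geo_def mult.assoc)
qed

text \<open>The value is the complete homogeneous symmetric polynomial of degree n + 1 - (p + q + r)
  in p copies of \<alpha>, q of \<beta> and r of \<gamma>, with the product of the
  \<open>geo\<close> series as generating function. In particular it vanishes for n + 1 < p + q +
  r.\<close>

lemma dd_lin_power:
  assumes "\<alpha> \<noteq> \<beta>" "\<alpha> \<noteq> \<gamma>" "\<beta> \<noteq> \<gamma>"
  shows "dd \<alpha> \<beta> \<gamma> (lin \<alpha> ^ n) (lin \<beta> ^ n) (lin \<gamma> ^ n) p q r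
       = fps_nth (fps_X ^ (p + q + r) * (geo \<alpha> ^ p * geo \<beta> ^ q * geo \<gamma> ^ r)) (Suc n)"
proof (induction n arbitrary: p q r)
  case 0
  have "fps_nth (geo u ^ m) 0 = 1" for u m
    by (simp add: geo_def fps_nth_power_0)
  then show ?case
    by (auto simp: dd_one[OF assms] fps_X_power_mult_nth not_less le_Suc_eq)
next
  case (Suc n)
  have expand: "fps_nth (fps_X ^ Suc s * (geo u * A)) (Suc m)
      = u * fps_nth (fps_X ^ Suc s * (geo u * A)) m + fps_nth (fps_X ^ s * A) m" for u A s m
  proof -
    have "fps_X ^ Suc s * (geo u * A) = fps_X * (fps_const u * (fps_X ^ Suc s * (geo u * A)) + fps_X ^ s * A)"
      by (subst geo_expand) (simp add: algebra_simps)
    then show ?thesis by (metis fps_add_nth fps_mult_left_const_nth fps_X_mult_nth nat.simps(3) diff_Suc_1)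
  qed
  consider (p) p' where "p = Suc p'" | (q) q' where "q = Suc q'" | (r) r' where "r = Suc r'"
    | (0) "p = 0" "q = 0" "r = 0" by (metis not0_implies_Suc)
  then show ?case
  proof cases
    case p
    show ?thesis
      using expand[of "p' + q + r" \<alpha> "geo \<alpha> ^ p' * geo \<beta> ^ q * geo \<gamma> ^ r" "Suc n"]
      unfolding p power_Suc dd_lin_mult[OF assms] Suc.IH by (simp add: mult_ac)
  next
    case q
    have "dd \<alpha> \<beta> \<gamma> (lin \<alpha> * lin \<alpha> ^ n) (lin \<beta> * lin \<beta> ^ n) (lin \<gamma> * lin \<gamma> ^ n) p (Suc q') r
       = \<beta> * dd \<alpha> \<beta> \<gamma> (lin \<alpha> ^ n) (lin \<beta> ^ n) (lin \<gamma> ^ n) p (Suc q') r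
         + dd \<alpha> \<beta> \<gamma> (lin \<alpha> ^ n) (lin \<beta> ^ n) (lin \<gamma> ^ n) p q' r"
      unfolding dd_swap12[of \<alpha> \<beta> \<gamma>] using dd_lin_mult[of \<beta> \<alpha> \<gamma>] assms by blast
    then show ?thesis
      using expand[of "p + q' + r" \<beta> "geo \<alpha> ^ p * geo \<beta> ^ q' * geo \<gamma> ^ r" "Suc n"]
      unfolding q power_Suc Suc.IH by (simp add: mult_ac)
  next
    case r
    have "dd \<alpha> \<beta> \<gamma> (lin \<alpha> * lin \<alpha> ^ n) (lin \<beta> * lin \<beta> ^ n) (lin \<gamma> * lin \<gamma> ^ n) p q (Suc r')
       = \<gamma> * dd \<alpha> \<beta> \<gamma> (lin \<alpha> ^ n) (lin \<beta> ^ n) (lin \<gamma> ^ n) p q (Suc r')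
         + dd \<alpha> \<beta> \<gamma> (lin \<alpha> ^ n) (lin \<beta> ^ n) (lin \<gamma> ^ n) p q r'"
      unfolding dd_swap23[of \<alpha> \<beta> \<gamma>] dd_swap12[of \<alpha> \<gamma> \<beta>]
      using dd_lin_mult[of \<gamma> \<alpha> \<beta>] assms by blast
    then show ?thesis
      using expand[of "p + q + r'" \<gamma> "geo \<alpha> ^ p * geo \<beta> ^ q * geo \<gamma> ^ r'" "Suc n"]
      unfolding r power_Suc Suc.IH by (simp add: mult_ac)
  next
    case 0
    then show ?thesis by (simp add: dd_def)
  qed
qed

lemma fps_nth_lin_power: "fps_nth (lin u ^ n) i = real (n choose i) * u ^ (n - i)"
proof (induction n arbitrary: i)
  case (Suc n)
  have "fps_nth (lin u ^ Suc n) i = u * fps_nth (lin u ^ n) i + (if i = 0 then 0 else fps_nth (lin u ^ n) (i - 1))"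
    by (simp add: lin_def algebra_simps)
  also have "\<dots> = real (Suc n choose i) * u ^ (Suc n - i)"
  proof (cases i)
    case (Suc j)
    have "u * (real (n choose Suc j) * u ^ (n - Suc j)) = real (n choose Suc j) * u ^ (n - j)"
      by (cases "Suc j \<le> n") (auto simp: Suc_diff_Suc binomial_eq_0 simp flip: power_Suc)
    with Suc show ?thesis by (simp add: Suc.IH algebra_simps)
  qed (simp add: Suc.IH)
  finally show ?case .
qed (auto simp: lin_def)

section \<open>Local expansions of (1 + x w)^(k + 1/2)\<close>

abbreviation hc :: "nat \<Rightarrow> nat \<Rightarrow> real" where
  "hc k n \<equiv> (of_nat k + 1/2) gchoose n"

text \<open>The expansion of \<open>(1 + x w)^(k + 1/2)\<close> at \<open>w = u\<close>, divided by \<open>sqrt (1 + x u)\<close>.\<close>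

definition jet :: "nat \<Rightarrow> real \<Rightarrow> real \<Rightarrow> real fps" where
  "jet k x u = Abs_fps (\<lambda>i. hc k i * x ^ i * (1 + x * u) ^ k / (1 + x * u) ^ i)"

text \<open>Expanding first in powers of w and then each w^n at u must give the Taylor coefficient
  at u. Trinomial revision turns the double expansion into one binomial series with exponent k + 1/2
  - i. Splitting off the square root leaves \<open>jet\<close>, which is rational for rational x and
  u.\<close>

lemma jet_sums:
  assumes "\<bar>x * u\<bar> < 1"
  shows "(\<lambda>n. hc k n * x ^ n * fps_nth (lin u ^ n) i) sums (sqrt (1 + x * u) * fps_nth (jet k x u) i)"
proof -
  define y where "y = 1 + x * u"
  have y: "y > 0" using assms by (simp add: y_def)
  let ?f = "\<lambda>n. hc k n * x ^ n * fps_nth (lin u ^ n) i"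
  have "(\<lambda>j. ((of_nat k + 1/2 - of_nat i) gchoose j) * (x * u) ^ j) sums y powr (of_nat k + 1/2 - of_nat i)"
    unfolding y_def by (rule gen_binomial_real[OF assms])
  then have "(\<lambda>j. hc k i * x ^ i * (((of_nat k + 1/2 - of_nat i) gchoose j) * (x * u) ^ j))
     sums (hc k i * x ^ i * y powr (of_nat k + 1/2 - of_nat i))"
    by (rule sums_mult)
  moreover have "hc k i * x ^ i * (((of_nat k + 1/2 - of_nat i) gchoose j) * (x * u) ^ j) = ?f (j + i)" for j
  proof -
    have "hc k (j + i) * real (j + i choose i) = hc k i * ((of_nat k + 1/2 - of_nat i) gchoose j)"
      using gbinomial_trinomial_revision[of i "j + i" "of_nat k + 1/2 :: real"]
      by (simp add: binomial_gbinomial)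
    moreover have "?f (j + i) = (hc k (j + i) * real (j + i choose i)) * (x ^ i * x ^ j * u ^ j)"
      unfolding fps_nth_lin_power diff_add_inverse2 by (simp only: power_add mult_ac)
    ultimately show ?thesis
      by (simp only: power_mult_distrib mult_ac)
  qed
  moreover have "y powr (of_nat k + 1/2 - of_nat i) = sqrt y * y ^ k / y ^ i"
    using y by (simp add: powr_diff powr_add powr_realpow powr_half_sqrt)
  ultimately have "(\<lambda>j. ?f (j + i)) sums (sqrt y * fps_nth (jet k x u) i)"
    by (simp add: jet_def y_def mult_ac)
  moreover have "(\<Sum>n<i. ?f n) = 0"
    by (rule sum.neutral) (auto simp: fps_nth_lin_power binomial_eq_0)
  ultimately show ?thesis
    using sums_iff_shift[of ?f i "sqrt y * fps_nth (jet k x u) i"] by (simp add: y_def)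
qed

lemma local_res_sums:
  assumes "\<And>i. (\<lambda>n. w n * fps_nth (F n) i) sums fps_nth f i"
  shows "(\<lambda>n. w n * local_res (F n * A * B) p) sums local_res (f * A * B) p"
proof (cases p)
  case 0
  then show ?thesis by simp
next
  case (Suc m)
  have "(\<lambda>n. \<Sum>i=0..m. (w n * fps_nth (F n) i) * fps_nth (A * B) (m - i))
      sums (\<Sum>i=0..m. fps_nth f i * fps_nth (A * B) (m - i))"
    by (intro sums_sum sums_mult2 assms)
  then show ?thesis
    by (simp add: Suc fps_mult_nth mult.assoc sum_distrib_left)
qed

lemma dd_jet_sums:
  assumes "\<bar>x * \<alpha>\<bar> < 1" "\<bar>x * \<beta>\<bar> < 1" "\<bar>x * \<gamma>\<bar> < 1"
  shows "(\<lambda>n. hc k n * x ^ n * dd \<alpha> \<beta> \<gamma> (lin \<alpha> ^ n) (lin \<beta> ^ n) (lin \<gamma> ^ n) p q r) sums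
     dd \<alpha> \<beta> \<gamma> (fps_const (sqrt (1 + x * \<alpha>)) * jet k x \<alpha>) (fps_const (sqrt (1 + x * \<beta>)) * jet k x \<beta>)
       (fps_const (sqrt (1 + x * \<gamma>)) * jet k x \<gamma>) p q r"
  unfolding dd_def distrib_left
  by (intro sums_add local_res_sums) (use jet_sums assms in auto)

section \<open>Weighted majorants of power series coefficients\<close>

definition abs_bounded :: "real \<Rightarrow> real fps \<Rightarrow> real \<Rightarrow> bool" where
  "abs_bounded \<tau> F S \<longleftrightarrow> (\<forall>n. (\<Sum>j\<le>n. \<bar>fps_nth F j\<bar> * \<tau> ^ j) \<le> S)"

lemma abs_bounded_nth:
  assumes "abs_bounded \<tau> F S" "\<tau> \<ge> 0"
  shows "\<bar>fps_nth F j\<bar> * \<tau> ^ j \<le> S"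
proof -
  have "\<bar>fps_nth F j\<bar> * \<tau> ^ j \<le> (\<Sum>i\<le>j. \<bar>fps_nth F i\<bar> * \<tau> ^ i)"
    by (rule member_le_sum) (use assms in auto)
  also have "\<dots> \<le> S" using assms(1) by (simp add: abs_bounded_def)
  finally show ?thesis .
qed

lemma abs_bounded_mult:
  assumes "abs_bounded \<tau> F S" "abs_bounded \<tau> G T" "\<tau> \<ge> 0"
  shows "abs_bounded \<tau> (F * G) (S * T)"
  unfolding abs_bounded_def
proof
  fix n
  define a where "a i = \<bar>fps_nth F i\<bar> * \<tau> ^ i" for i
  define b where "b i = \<bar>fps_nth G i\<bar> * \<tau> ^ i" for i
  have nn: "a i \<ge> 0" "b i \<ge> 0" for i using assms(3) by (auto simp: a_def b_def)
  have S: "(\<Sum>i\<le>n. a i) \<le> S" "(\<Sum>i\<le>n. b i) \<le> T"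
    using assms by (auto simp: abs_bounded_def a_def b_def)
  have "(\<Sum>j\<le>n. \<bar>fps_nth (F * G) j\<bar> * \<tau> ^ j) \<le> (\<Sum>j\<le>n. \<Sum>i\<le>j. a i * b (j - i))"
  proof (rule sum_mono)
    fix j
    have "\<bar>fps_nth (F * G) j\<bar> * \<tau> ^ j \<le> (\<Sum>i\<le>j. \<bar>fps_nth F i * fps_nth G (j - i)\<bar>) * \<tau> ^ j"
      using assms(3) by (intro mult_right_mono) (auto simp: fps_mult_nth atMost_atLeast0)
    also have "\<dots> = (\<Sum>i\<le>j. a i * b (j - i))"
      unfolding sum_distrib_right
      by (rule sum.cong) (auto simp: a_def b_def abs_mult mult_ac simp flip: power_add)
    finally show "\<bar>fps_nth (F * G) j\<bar> * \<tau> ^ j \<le> (\<Sum>i\<le>j. a i * b (j - i))" .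
  qed
  also have "\<dots> = (\<Sum>(i,j) | i + j \<le> n. a i * b j)"
    by (rule sum.triangle_reindex_eq [symmetric])
  also have "\<dots> \<le> (\<Sum>(i,j) \<in> {..n} \<times> {..n}. a i * b j)"
    by (rule sum_mono2) (auto simp: nn)
  also have "\<dots> = (\<Sum>i\<le>n. a i) * (\<Sum>i\<le>n. b i)"
    by (simp add: sum_product sum.cartesian_product)
  also have "\<dots> \<le> S * T"
    by (rule mult_mono[OF S]) (use S(1) nn sum_nonneg[of "{..n}" a] sum_nonneg[of "{..n}" b] in \<open>auto intro: order_trans\<close>)
  finally show "(\<Sum>j\<le>n. \<bar>fps_nth (F * G) j\<bar> * \<tau> ^ j) \<le> S * T" .
qed

lemma abs_bounded_one: "abs_bounded \<tau> 1 1"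
proof -
  have "(\<Sum>j\<le>n. \<bar>fps_nth (1 :: real fps) j\<bar> * \<tau> ^ j) = (\<Sum>j\<in>{0::nat}. 1)" for n :: nat
    by (rule sum.mono_neutral_cong_right) auto
  then show ?thesis by (simp add: abs_bounded_def)
qed

lemma abs_bounded_power:
  assumes "abs_bounded \<tau> F S" "\<tau> \<ge> 0"
  shows "abs_bounded \<tau> (F ^ m) (S ^ m)"
  by (induction m) (auto simp: abs_bounded_one intro: abs_bounded_mult assms)

lemma geometric_partial_sum_le:
  fixes y :: real
  assumes "0 \<le> y" "y < 1"
  shows "(\<Sum>j\<le>n. y ^ j) \<le> 1 / (1 - y)"
proof -
  have "(1 - y) * (\<Sum>j\<le>n. y ^ j) \<le> 1"
    unfolding sum_gp_basic using assms by simp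
  then show ?thesis using assms by (simp add: pos_le_divide_eq mult.commute)
qed

lemma abs_bounded_geo:
  assumes "0 \<le> u" "0 \<le> \<tau>" "\<tau> * u < 1"
  shows "abs_bounded \<tau> (geo u) (1 / (1 - \<tau> * u))"
proof -
  have "(\<Sum>j\<le>n. \<bar>fps_nth (geo u) j\<bar> * \<tau> ^ j) = (\<Sum>j\<le>n. (\<tau> * u) ^ j)" for n
    by (rule sum.cong) (use assms in \<open>auto simp: geo_def power_mult_distrib\<close>)
  then show ?thesis
    unfolding abs_bounded_def using geometric_partial_sum_le[of "\<tau> * u"] assms by simp
qed

lemma fps_nth_pole:
  assumes "u \<noteq> 0"
  shows "fps_nth (pole u) n = (-1) ^ n / u ^ Suc n"
proof (induction n)
  case 0
  show ?case using arg_cong[OF pole_expand[OF assms, of 1], of "\<lambda>F. fps_nth F 0"] assms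
    by (simp add: field_simps)
next
  case (Suc n)
  have "0 = u * fps_nth (pole u) (Suc n) + fps_nth (pole u) n"
    using arg_cong[OF pole_expand[OF assms, of 1], of "\<lambda>F. fps_nth F (Suc n)"] by simp
  then have "fps_nth (pole u) (Suc n) = - fps_nth (pole u) n / u"
    using assms by (simp add: field_simps)
  then show ?case by (simp add: Suc)
qed

lemma abs_bounded_pole:
  assumes "0 \<le> \<tau>" "\<tau> < \<bar>u\<bar>"
  shows "abs_bounded \<tau> (pole u) (1 / (\<bar>u\<bar> - \<tau>))"
  unfolding abs_bounded_def
proof
  fix n
  have u: "u \<noteq> 0" using assms by auto
  have "(\<Sum>j\<le>n. \<bar>fps_nth (pole u) j\<bar> * \<tau> ^ j) = 1 / \<bar>u\<bar> * (\<Sum>j\<le>n. (\<tau> / \<bar>u\<bar>) ^ j)"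
    unfolding sum_distrib_left
    by (rule sum.cong) (auto simp: fps_nth_pole[OF u] abs_mult power_abs power_divide)
  also have "\<dots> \<le> 1 / \<bar>u\<bar> * (1 / (1 - \<tau> / \<bar>u\<bar>))"
    by (intro mult_left_mono geometric_partial_sum_le) (use assms in auto)
  also have "\<dots> = 1 / (\<bar>u\<bar> - \<tau>)" using u assms by (simp add: field_simps)
  finally show "(\<Sum>j\<le>n. \<bar>fps_nth (pole u) j\<bar> * \<tau> ^ j) \<le> 1 / (\<bar>u\<bar> - \<tau>)" .
qed

section \<open>Size and denominators of the half-integer binomial coefficients\<close>

lemma gbinomial_Suc_right:
  "(a::real) gchoose Suc n = (a gchoose n) * (a - real n) / (real n + 1)"
  using gbinomial_mult_1[of a n] by (simp add: field_simps)

lemma hc_nonneg: "i \<le> Suc k \<Longrightarrow> hc k i \<ge> 0"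
  unfolding gbinomial_prod_rev by (intro divide_nonneg_pos prod_nonneg) auto

lemma hc_le: "i \<le> Suc k \<Longrightarrow> hc k i \<le> real (Suc k choose i)"
  unfolding binomial_gbinomial gbinomial_prod_rev by (intro divide_right_mono prod_mono) auto

lemma abs_hc_decreasing:
  assumes "k \<le> m"
  shows "\<bar>hc k (m + j)\<bar> \<le> \<bar>hc k m\<bar>"
proof (induction j)
  case (Suc j)
  have "\<bar>real k + 1/2 - real (m + j)\<bar> \<le> real (m + j) + 1" using assms by auto
  then have "\<bar>hc k (m + j)\<bar> * (\<bar>real k + 1/2 - real (m + j)\<bar> / (real (m + j) + 1)) \<le> \<bar>hc k (m + j)\<bar> * 1"
    by (intro mult_left_mono) auto
  then have "\<bar>hc k (Suc (m + j))\<bar> \<le> \<bar>hc k (m + j)\<bar>"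
    unfolding gbinomial_Suc_right by (simp add: abs_mult abs_of_nonneg)
  with Suc show ?case by simp
qed simp

text \<open>Passing from k to k + 1 multiplies the absolute value by (k + 3/2) (2 k - 1/2) (2 k +
  1/2) / ((3 k + 1) (3 k + 2) (3 k + 3)), which is at most its limit 4/27. The factor 27/64 gives
  equality at k = 1, where the value is 1/16.\<close>

lemma abs_hc_3k_le:
  assumes "k \<ge> 1"
  shows "\<bar>hc k (3 * k)\<bar> \<le> 27/64 * (4/27) ^ k"
  using assms
proof (induction k rule: nat_induct_at_least)
  case base
  show ?case by (simp add: gbinomial_prod_rev eval_nat_numeral)
next
  case (Suc k)
  define a where "a = real k + 1/2"
  have "3 * Suc k = Suc (Suc (Suc (3 * k)))" by simp
  moreover have "real (Suc k) + 1/2 = a + 1" by (simp add: a_def)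
  ultimately have "hc (Suc k) (3 * Suc k) = (a + 1) gchoose Suc (Suc (Suc (3 * k)))"
    by (simp only:)
  also have "\<dots> = (a + 1) / real (Suc (Suc (Suc (3 * k)))) * (a gchoose (Suc (Suc (3 * k))))"
    by (rule gbinomial_factors)
  also have "\<dots> = hc k (3 * k) * ((a + 1) * (a - 3 * real k) * (a - 3 * real k - 1)
      / ((3 * real k + 1) * (3 * real k + 2) * (3 * real k + 3)))"
  proof -
    have "real (Suc (3 * k)) = 3 * real k + 1" "real (3 * k) = 3 * real k"
      "real (Suc (Suc (Suc (3 * k)))) = 3 * real k + 3" by simp_all
    then show ?thesis
      unfolding gbinomial_Suc_right[of a "Suc (3 * k)"] gbinomial_Suc_right[of a "3 * k"] a_def[symmetric]
      by (simp add: diff_diff_eq add_ac mult_ac)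
  qed
  finally have eq: "\<bar>hc (Suc k) (3 * Suc k)\<bar> = \<bar>hc k (3 * k)\<bar> * \<bar>(a + 1) * (a - 3 * real k) * (a - 3 * real k - 1)
      / ((3 * real k + 1) * (3 * real k + 2) * (3 * real k + 3))\<bar>"
    by (simp only: abs_mult)
  have "(a + 1) * (a - 3 * real k) * (a - 3 * real k - 1) = (real k + 3/2) * (2 * real k - 1/2) * (2 * real k + 1/2)"
    by (simp add: a_def algebra_simps)
  moreover have "\<dots> \<ge> 0" using Suc.hyps by auto
  moreover have "(real k + 3/2) * (2 * real k - 1/2) * (2 * real k + 1/2)
      \<le> 4/27 * ((3 * real k + 1) * (3 * real k + 2) * (3 * real k + 3))"
    by (simp add: algebra_simps)
  ultimately have "\<bar>(a + 1) * (a - 3 * real k) * (a - 3 * real k - 1)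
      / ((3 * real k + 1) * (3 * real k + 2) * (3 * real k + 3))\<bar> \<le> 4/27"
    by (simp add: divide_le_eq abs_mult)
  then have "\<bar>hc (Suc k) (3 * Suc k)\<bar> \<le> (27/64 * (4/27) ^ k) * (4/27)"
    unfolding eq by (intro mult_mono Suc.IH) auto
  then show ?case by simp
qed

text \<open>For upper index -1/2, multiplication by (-4)^i produces a central binomial coefficient;
  Pascal's rule then raises the upper index to k + 1/2.\<close>

lemma hc_4_power_Ints: "hc k i * 4 ^ i \<in> \<int>"
proof -
  have central: "((- 1/2) gchoose i) * (-4) ^ i = real (2 * i choose i)" for i
  proof (induction i)
    case (Suc i)
    have "(2 * i + 2) * (2 * i + 1 choose i) = (2 * i + 2 choose (i + 1)) * (i + 1)"
      using Suc_times_binomial_eq[of "2 * i + 1" i] by simp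
    then have "(i + 1) * (2 * (2 * i + 1 choose i)) = (i + 1) * (2 * i + 2 choose (i + 1))"
      by (simp only: mult_ac distrib_left) simp
    then have 1: "2 * i + 2 choose (i + 1) = 2 * (2 * i + 1 choose i)"
      by (metis mult_cancel1 add_is_0 one_neq_zero)
    have 2: "(2 * i + 1) * (2 * i choose i) = (2 * i + 1 choose i) * (i + 1)"
      using Suc_times_binomial_eq[of "2 * i" i] binomial_symmetric[of i "2 * i + 1"] by simp
    have "(i + 1) * (2 * i + 2 choose (i + 1)) = 2 * ((2 * i + 1 choose i) * (i + 1))"
      unfolding 1 by (simp only: mult_ac)
    also have "\<dots> = (4 * i + 2) * (2 * i choose i)"
      unfolding 2[symmetric] by (simp add: distrib_right)
    finally have "(i + 1) * (2 * i + 2 choose (i + 1)) = (4 * i + 2) * (2 * i choose i)" .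
    then have "real (i + 1) * real (2 * i + 2 choose (i + 1)) = real (4 * i + 2) * real (2 * i choose i)"
      by (simp only: flip: of_nat_mult)
    then show ?case
      using Suc unfolding gbinomial_Suc_right by (simp add: field_simps)
  qed simp
  have minus_half: "((- 1/2 :: real) gchoose i) * 4 ^ i \<in> \<int>" for i
  proof -
    have "((- 1/2 :: real) gchoose i) * 4 ^ i = (-1) ^ i * real (2 * i choose i)"
      unfolding central[symmetric] by (simp add: mult_ac flip: power_mult_distrib)
    then show ?thesis by simp
  qed
  show ?thesis
  proof (induction k arbitrary: i)
    case 0
    show ?case
    proof (cases i)
      case (Suc j)
      have "(1/2 :: real) gchoose Suc j = ((-1/2) gchoose j) + ((-1/2) gchoose Suc j)"
        using gbinomial_Suc_Suc[of "-1/2 :: real" j] by simp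
      then have "hc 0 i * 4 ^ i = 4 * (((- 1/2 :: real) gchoose j) * 4 ^ j) + ((- 1/2 :: real) gchoose Suc j) * 4 ^ Suc j"
        by (simp add: Suc algebra_simps)
      then show ?thesis using minus_half by (metis Ints_add Ints_mult Ints_numeral)
    qed auto
  next
    case (Suc k)
    show ?case
    proof (cases i)
      case (Suc j)
      have "hc (Suc k) (Suc j) = hc k j + hc k (Suc j)"
        using gbinomial_Suc_Suc[of "real k + 1/2 :: real" j] by (simp add: add_ac)
      then have "hc (Suc k) i * 4 ^ i = 4 * (hc k j * 4 ^ j) + hc k (Suc j) * 4 ^ Suc j"
        by (simp add: Suc algebra_simps)
      then show ?thesis using Suc.IH by (metis Ints_add Ints_mult Ints_numeral)
    qed auto
  qed
qed

text \<open>Agrees with \<open>jet\<close> up to degree k, which is all that a node of multiplicity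
  at most k + 1 can see. Cutting there keeps 1 + x u in nonnegative powers, so both the denominators
  and the majorant stay under control.\<close>

definition tjet :: "nat \<Rightarrow> real \<Rightarrow> real \<Rightarrow> real fps" where
  "tjet k x u = Abs_fps (\<lambda>i. if i \<le> k then hc k i * x ^ i * (1 + x * u) ^ (k - i) else 0)"

lemma local_res_tjet:
  assumes "1 + x * u \<noteq> 0" "p \<le> Suc k"
  shows "local_res (jet k x u * A * B) p = local_res (tjet k x u * A * B) p"
proof (cases p)
  case (Suc m)
  have "fps_nth (jet k x u) i = fps_nth (tjet k x u) i" if "i \<le> m" for i
    using that assms Suc by (simp add: jet_def tjet_def power_diff)
  then show ?thesis
    unfolding Suc local_res_Suc mult.assoc fps_mult_nth by (intro sum.cong) auto
qed simp

text \<open>Replacing \<open>hc k j\<close> by the larger \<open>Suc k choose j\<close> completes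
  the sum to the binomial expansion of (1 + x u + x \<tau>)^(k + 1).\<close>

lemma abs_bounded_tjet:
  assumes "x \<ge> 0" "u \<ge> 0" "\<tau> \<ge> 0"
  shows "abs_bounded \<tau> (tjet k x u) ((1 + x * (u + \<tau>)) ^ Suc k)"
  unfolding abs_bounded_def
proof
  fix n
  let ?G = "\<lambda>i. real (Suc k choose i) * (x * \<tau>) ^ i * (1 + x * u) ^ (Suc k - i)"
  have G0: "?G i \<ge> 0" for i using assms by simp
  have "(\<Sum>j\<le>n. \<bar>fps_nth (tjet k x u) j\<bar> * \<tau> ^ j) \<le> (\<Sum>j\<le>n. ?G j)"
  proof (rule sum_mono)
    fix j
    show "\<bar>fps_nth (tjet k x u) j\<bar> * \<tau> ^ j \<le> ?G j"
    proof (cases "j \<le> k")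
      case True
      have "\<bar>fps_nth (tjet k x u) j\<bar> * \<tau> ^ j = hc k j * ((x * \<tau>) ^ j * (1 + x * u) ^ (k - j))"
        using True hc_nonneg[of j k] assms by (simp add: tjet_def abs_mult power_mult_distrib)
      also have "\<dots> \<le> real (Suc k choose j) * ((x * \<tau>) ^ j * (1 + x * u) ^ (Suc k - j))"
        using True assms
        by (intro mult_mono hc_le mult_left_mono power_increasing) (auto intro!: mult_nonneg_nonneg)
      finally show ?thesis by (simp add: mult.assoc)
    next
      case False
      then show ?thesis using G0[of j] by (simp add: tjet_def)
    qed
  qed
  also have "\<dots> \<le> (\<Sum>j\<le>n + Suc k. ?G j)"
    by (rule sum_mono2) (use G0 in auto)
  also have "\<dots> = (\<Sum>j\<le>Suc k. ?G j)"
    by (rule sum.mono_neutral_right) (auto simp: binomial_eq_0)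
  also have "\<dots> = (x * \<tau> + (1 + x * u)) ^ Suc k"
    by (rule binomial_ring[symmetric])
  finally show "(\<Sum>j\<le>n. \<bar>fps_nth (tjet k x u) j\<bar> * \<tau> ^ j) \<le> (1 + x * (u + \<tau>)) ^ Suc k"
    by (simp add: algebra_simps)
qed

text \<open>Denominators are recorded in two parts: w clears what all degrees share, v what each
  further degree adds. With a common v, products only multiply the first part.\<close>

definition ints_scaled :: "real \<Rightarrow> real \<Rightarrow> real fps \<Rightarrow> bool" where
  "ints_scaled w v F \<longleftrightarrow> (\<forall>j. fps_nth F j * w * v ^ j \<in> \<int>)"

lemma ints_scaled_mult:
  assumes "ints_scaled w v F" "ints_scaled w' v G"
  shows "ints_scaled (w * w') v (F * G)"
  unfolding ints_scaled_def
proof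
  fix j
  have "fps_nth (F * G) j * (w * w') * v ^ j
      = (\<Sum>i=0..j. (fps_nth F i * w * v ^ i) * (fps_nth G (j - i) * w' * v ^ (j - i)))"
    unfolding fps_mult_nth sum_distrib_right
  proof (rule sum.cong)
    fix i assume "i \<in> {0..j}"
    then have "v ^ j = v ^ i * v ^ (j - i)" by (simp flip: power_add)
    then show "fps_nth F i * fps_nth G (j - i) * (w * w') * v ^ j
      = fps_nth F i * w * v ^ i * (fps_nth G (j - i) * w' * v ^ (j - i))" by (simp only: mult_ac)
  qed simp
  also have "\<dots> \<in> \<int>"
    by (rule Ints_sum, rule Ints_mult) (use assms in \<open>simp_all add: ints_scaled_def\<close>)
  finally show "fps_nth (F * G) j * (w * w') * v ^ j \<in> \<int>" .
qed

lemma ints_scaled_power: "ints_scaled w v F \<Longrightarrow> ints_scaled (w ^ m) v (F ^ m)"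
proof (induction m)
  case 0
  then show ?case by (auto simp: ints_scaled_def)
qed (auto intro: ints_scaled_mult)

lemma ints_scaled_pole:
  assumes "u \<noteq> 0" "v = u * m" "m \<in> \<int>"
  shows "ints_scaled u v (pole u)"
proof -
  have "fps_nth (pole u) j * u * v ^ j = (-1) ^ j * m ^ j" for j
    using assms by (simp add: fps_nth_pole power_mult_distrib)
  then show ?thesis using assms(3) by (simp add: ints_scaled_def Ints_mult Ints_power)
qed

text \<open>The factor (N / (N + u))^k cancels (1 + u / N)^(k - j) and leaves (N / (N + u))^j, which
  v^j absorbs together with x^j; the 4 in v makes \<open>hc k j\<close> integral.\<close>

lemma ints_scaled_tjet:
  assumes "N > 0" "N + u > 0" "m \<in> \<int>" "v = 4 * (N + u) * m"
  shows "ints_scaled ((N / (N + u)) ^ k) v (tjet k (1 / N) u)"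
  unfolding ints_scaled_def
proof
  fix j
  show "fps_nth (tjet k (1 / N) u) j * (N / (N + u)) ^ k * v ^ j \<in> \<int>"
  proof (cases "j \<le> k")
    case True
    have 1: "1 + u / N = (N + u) / N" using assms by (simp add: field_simps)
    have 2: "(N / (N + u)) ^ k = (N / (N + u)) ^ (k - j) * (N / (N + u)) ^ j"
      using True by (simp flip: power_add)
    have "fps_nth (tjet k (1 / N) u) j * (N / (N + u)) ^ k * v ^ j
      = hc k j * ((1 / N) ^ j * (N / (N + u)) ^ j * v ^ j) * (((N + u) / N) ^ (k - j) * (N / (N + u)) ^ (k - j))"
      using True by (simp add: tjet_def 1 2)
    also have "((N + u) / N) ^ (k - j) * (N / (N + u)) ^ (k - j) = 1"
      using assms by (simp flip: power_mult_distrib)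
    also have "(1 / N) ^ j * (N / (N + u)) ^ j * v ^ j = (1 / N * (N / (N + u)) * v) ^ j"
      by (simp only: power_mult_distrib)
    also have "1 / N * (N / (N + u)) * v = 4 * m" using assms(1,2) unfolding assms(4) by (simp add: divide_simps)
    also have "(4 * m) ^ j = 4 ^ j * m ^ j" by (rule power_mult_distrib)
    finally have "fps_nth (tjet k (1 / N) u) j * (N / (N + u)) ^ k * v ^ j = (hc k j * 4 ^ j) * m ^ j"
      by simp
    then show ?thesis using hc_4_power_Ints assms(3) by (metis Ints_mult Ints_power)
  qed (simp add: tjet_def)
qed

text \<open>Total multiplicity 3 k + 1 kills all terms with n < 3 k, so the form has order x^(3 k).
  In the tail the binomial coefficients do not grow, and the generating function \<open>H\<close>
  majorises the rest at x.\<close>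

lemma dd_jet_bound:
  assumes "\<alpha> \<noteq> \<beta>" "\<alpha> \<noteq> \<gamma>" "\<beta> \<noteq> \<gamma>" "0 \<le> \<alpha>" "0 \<le> \<beta>" "0 \<le> \<gamma>" "0 \<le> x"
    and "x * \<alpha> < 1" "x * \<beta> < 1" "x * \<gamma> < 1" and pqr: "p + q + r = Suc (3 * k)"
  shows "\<bar>dd \<alpha> \<beta> \<gamma> (fps_const (sqrt (1 + x * \<alpha>)) * jet k x \<alpha>) (fps_const (sqrt (1 + x * \<beta>)) * jet k x \<beta>)
       (fps_const (sqrt (1 + x * \<gamma>)) * jet k x \<gamma>) p q r\<bar>
    \<le> \<bar>hc k (3 * k)\<bar> * x ^ (3 * k) * ((1 / (1 - x * \<alpha>)) ^ p * (1 / (1 - x * \<beta>)) ^ q * (1 / (1 - x * \<gamma>)) ^ r)"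
    (is "\<bar>?S\<bar> \<le> ?c * ?B")
proof -
  define H where "H = geo \<alpha> ^ p * geo \<beta> ^ q * geo \<gamma> ^ r"
  define f where "f n = hc k n * x ^ n * dd \<alpha> \<beta> \<gamma> (lin \<alpha> ^ n) (lin \<beta> ^ n) (lin \<gamma> ^ n) p q r" for n
  have dd: "dd \<alpha> \<beta> \<gamma> (lin \<alpha> ^ n) (lin \<beta> ^ n) (lin \<gamma> ^ n) p q r = (if n < 3 * k then 0 else fps_nth H (n - 3 * k))" for n
    unfolding dd_lin_power[OF assms(1-3)] pqr H_def[symmetric] fps_X_power_mult_nth by simp
  have "f sums ?S"
    unfolding f_def by (rule dd_jet_sums) (use assms in \<open>auto simp: abs_mult\<close>)
  moreover have "(\<Sum>n<3 * k. f n) = 0"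
    by (rule sum.neutral) (auto simp: f_def dd)
  ultimately have S: "(\<lambda>j. f (j + 3 * k)) sums ?S"
    using sums_iff_shift[of f "3 * k" ?S] by simp
  have "abs_bounded x H ?B"
    unfolding H_def by (intro abs_bounded_mult abs_bounded_power abs_bounded_geo) (use assms in auto)
  then have H: "(\<Sum>j\<le>n. \<bar>fps_nth H j\<bar> * x ^ j) \<le> ?B" for n by (simp add: abs_bounded_def)
  have "\<bar>\<Sum>j<M. f (j + 3 * k)\<bar> \<le> ?c * ?B" for M
  proof -
    have "\<bar>\<Sum>j<M. f (j + 3 * k)\<bar> \<le> (\<Sum>j<M. \<bar>f (j + 3 * k)\<bar>)" by (rule sum_abs)
    also have "\<dots> \<le> (\<Sum>j<M. ?c * (\<bar>fps_nth H j\<bar> * x ^ j))"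
    proof (rule sum_mono)
      fix j
      have "\<bar>f (j + 3 * k)\<bar> = \<bar>hc k (3 * k + j)\<bar> * (x ^ (3 * k) * (\<bar>fps_nth H j\<bar> * x ^ j))"
        unfolding f_def dd using assms(7) by (simp add: abs_mult power_add add.commute)
      also have "\<dots> \<le> \<bar>hc k (3 * k)\<bar> * (x ^ (3 * k) * (\<bar>fps_nth H j\<bar> * x ^ j))"
        by (intro mult_right_mono abs_hc_decreasing) (use assms in auto)
      finally show "\<bar>f (j + 3 * k)\<bar> \<le> ?c * (\<bar>fps_nth H j\<bar> * x ^ j)" by (simp add: mult.assoc)
    qed
    also have "\<dots> \<le> (\<Sum>j\<le>M. ?c * (\<bar>fps_nth H j\<bar> * x ^ j))"
      by (rule sum_mono2) (use assms in auto)
    also have "\<dots> = ?c * (\<Sum>j\<le>M. \<bar>fps_nth H j\<bar> * x ^ j)" by (simp add: sum_distrib_left)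
    also have "\<dots> \<le> ?c * ?B" by (rule mult_left_mono[OF H]) (use assms in auto)
    finally show ?thesis .
  qed
  moreover have "(\<lambda>M. \<bar>\<Sum>j<M. f (j + 3 * k)\<bar>) \<longlonglongrightarrow> \<bar>?S\<bar>"
    using S unfolding sums_def by (rule tendsto_rabs)
  ultimately show ?thesis by (intro LIMSEQ_le_const2) auto
qed

lemma dd_add:
  "dd \<alpha> \<beta> \<gamma> (f + f') (g + g') (h + h') p q r = dd \<alpha> \<beta> \<gamma> f g h p q r + dd \<alpha> \<beta> \<gamma> f' g' h' p q r"
  by (simp add: dd_def distrib_right local_res_add)

lemma dd_const_mult:
  "dd \<alpha> \<beta> \<gamma> (fps_const c * f) (fps_const c * g) (fps_const c * h) p q r = c * dd \<alpha> \<beta> \<gamma> f g h p q r"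
  by (simp add: dd_def mult.assoc local_res_const_mult distrib_left)

section \<open>Differential equation and independence of the forms\<close>

lemma jet_ode:
  assumes "1 + x * u \<noteq> 0"
  shows "(1 + fps_const x * lin u) * fps_deriv (jet k x u) = fps_const ((real k + 1/2) * x) * jet k x u"
proof (rule fps_ext)
  fix n
  define Y where "Y = 1 + x * u"
  have Y: "Y \<noteq> 0" using assms by (simp add: Y_def)
  have rec: "Y * ((real n + 1) * fps_nth (jet k x u) (Suc n)) + x * (real n * fps_nth (jet k x u) n)
      = (real k + 1/2) * x * fps_nth (jet k x u) n" for n
  proof -
    have "(real n + 1) * hc k (Suc n) = hc k n * (real k + 1/2 - real n)"
      unfolding gbinomial_Suc_right by simp
    moreover define c where "c = x ^ n * Y ^ k / Y ^ n"
    moreover have "Y * ((real n + 1) * fps_nth (jet k x u) (Suc n)) = ((real n + 1) * hc k (Suc n)) * (x * c)"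
      using Y by (simp add: jet_def Y_def[symmetric] c_def)
    moreover have "fps_nth (jet k x u) n = hc k n * c"
      by (simp add: jet_def Y_def[symmetric] c_def)
    moreover have "(hc k n * (real k + 1/2 - real n)) * (x * d) + x * (real n * (hc k n * d)) = (real k + 1/2) * x * (hc k n * d)" for d
      by (simp add: algebra_simps)
    ultimately show ?thesis by (simp only:)
  qed
  have "1 + fps_const x * lin u = fps_const Y + fps_const x * fps_X"
    by (rule fps_ext) (simp add: lin_def Y_def fps_X_def)
  then show "fps_nth ((1 + fps_const x * lin u) * fps_deriv (jet k x u)) n
    = fps_nth (fps_const ((real k + 1/2) * x) * jet k x u) n"
    using rec[of n] by (cases n) (simp_all add: algebra_simps)
qed

lemma deriv_pole: "u \<noteq> 0 \<Longrightarrow> fps_deriv (pole u) = - (pole u * pole u)"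
  unfolding pole_def by (subst fps_inverse_deriv) (auto simp: power2_eq_square)

lemma deriv_pole_power:
  assumes "u \<noteq> 0"
  shows "fps_deriv (pole u ^ k) = - (fps_const (real k) * pole u ^ k * pole u)"
proof (induction k)
  case (Suc k)
  have "- (p * p) * q + p * - (c * q * p) = - ((1 + c) * (p * q) * p)" for p q c :: "real fps"
    by (simp add: algebra_simps)
  moreover have "1 + fps_const (real k) = fps_const (real (Suc k))" by (rule fps_ext) simp
  ultimately show ?case
    unfolding power_Suc fps_deriv_mult deriv_pole[OF assms] Suc by (metis add.commute)
qed simp

lemma fps_nth_X_deriv_diff: "fps_nth (fps_X * fps_deriv F - fps_const (real k) * F) k = (0::real)"
  by (cases k) auto

text \<open>
  Multiplied by \<open>G\<close> and the pole factors, this is \<open>X F' - k F\<close> with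
  \<open>F = W^n (1 + x W) G P\<^sub>1^k P\<^sub>2^k\<close>: a derivative has no residue.
\<close>

lemma residue_derivative_zero:
  assumes u: "1 + x * u \<noteq> 0" and uv: "u \<noteq> v" "u \<noteq> w"
    and G: "(1 + fps_const x * lin u) * fps_deriv G = fps_const ((real k + 1/2) * x) * G"
  defines "W \<equiv> lin u" and "A \<equiv> (lin u - fps_const u) * (lin u - fps_const v) * (lin u - fps_const w)"
    and "A' \<equiv> (lin u - fps_const u) * (lin u - fps_const v) + (lin u - fps_const u) * (lin u - fps_const w)
            + (lin u - fps_const v) * (lin u - fps_const w)"
  shows "local_res (((fps_const (real n) * W ^ (n - 1) * (1 + fps_const x * W) + fps_const (real k + 3/2) * fps_const x * W ^ n) * A
      - fps_const (real k) * (1 + fps_const x * W) * A' * W ^ n) * G * pole (u - v) ^ Suc k * pole (u - w) ^ Suc k) (Suc k) = 0"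
proof -
  define P1 P2 where "P1 = pole (u - v)" and "P2 = pole (u - w)"
  define Y where "Y = 1 + fps_const x * W"
  define Q where "Q = P1 ^ k * P2 ^ k"
  define F where "F = W ^ n * Y * G * Q"
  define S1 S2 where "S1 = lin u - fps_const v" and "S2 = lin u - fps_const w"
  have X: "lin u - fps_const u = fps_X" by (simp add: lin_def)
  have S: "S1 = fps_X + fps_const (u - v)" "S2 = fps_X + fps_const (u - w)"
    by (simp_all add: S1_def S2_def lin_def flip: fps_const_sub)
  have PS: "P1 * S1 = 1" "P2 * S2 = 1"
    using uv by (auto simp: P1_def P2_def S pole_mult)
  have dY: "fps_deriv Y = fps_const x" by (simp add: Y_def W_def lin_def)
  have dW: "fps_deriv (W ^ n) = fps_const (real n) * W ^ (n - 1)"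
    by (simp add: fps_deriv_power W_def lin_def fps_of_nat)
  have dP: "fps_deriv (P1 ^ k) = - (fps_const (real k) * P1 ^ k * P1)"
      "fps_deriv (P2 ^ k) = - (fps_const (real k) * P2 ^ k * P2)"
    using uv by (simp_all add: P1_def P2_def deriv_pole_power)
  have dQ: "fps_deriv Q = - (fps_const (real k) * Q * (P1 + P2))"
  proof -
    have "a * (- (c * b * q)) + (- (c * a * p)) * b = - (c * (a * b) * (p + q))" for a b c p q :: "real fps"
      by (simp add: algebra_simps)
    then show ?thesis unfolding Q_def fps_deriv_mult dP .
  qed
  have GY: "Y * fps_deriv G = fps_const ((real k + 1/2) * x) * G" using G by (simp add: Y_def W_def)
  \<comment> \<open>In the derivative of Y G, the factor Y contributes x and the differential
    equation of G contributes (k + 1/2) x.\<close>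
  have "fps_const (real k + 3/2) * fps_const x = fps_const (x + (real k + 1/2) * x)"
    unfolding fps_const_mult by (simp add: algebra_simps)
  also have "\<dots> = fps_const x + fps_const ((real k + 1/2) * x)" by simp
  finally have \<kappa>: "fps_const (real k + 3/2) * fps_const x = fps_const x + fps_const ((real k + 1/2) * x)" .
  have "fps_deriv F = fps_deriv (W ^ n) * Y * G * Q + W ^ n * fps_deriv Y * G * Q + W ^ n * (Y * fps_deriv G) * Q
       + W ^ n * Y * G * fps_deriv Q"
  proof -
    have "w * y * g * q' + (w * y * g' + (w * y' + w' * y) * g) * q
        = w' * y * g * q + w * y' * g * q + w * (y * g') * q + w * y * g * q'" for w w' y y' g g' q q' :: "real fps"
      by (simp add: algebra_simps)
    then show ?thesis unfolding F_def fps_deriv_mult .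
  qed
  also have "\<dots> = (fps_const (real n) * W ^ (n - 1) * Y + fps_const (real k + 3/2) * fps_const x * W ^ n) * G * Q
       - fps_const (real k) * W ^ n * Y * G * Q * (P1 + P2)"
  proof -
    have "n' * y * g * q + w * x' * g * q + w * (d * g) * q + w * y * g * (- (\<kappa> * q * p))
        = (n' * y + (x' + d) * w) * g * q - \<kappa> * w * y * g * q * p" for n' y g q w x' d \<kappa> p :: "real fps"
      by (simp add: algebra_simps)
    then show ?thesis unfolding dW dY dQ GY \<kappa> .
  qed
  finally have dF: "fps_deriv F = (fps_const (real n) * W ^ (n - 1) * Y + fps_const (real k + 3/2) * fps_const x * W ^ n) * G * Q
       - fps_const (real k) * W ^ n * Y * G * Q * (P1 + P2)" .
  have A: "A * (P1 * P2) = fps_X"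
  proof -
    have "A * (P1 * P2) = fps_X * (P1 * S1) * (P2 * S2)" by (simp add: A_def X S1_def S2_def mult_ac)
    then show ?thesis by (simp add: PS)
  qed
  have A': "A' * (P1 * P2) = 1 + fps_X * (P1 + P2)"
  proof -
    have "A' * (P1 * P2) = fps_X * P2 * (P1 * S1) + fps_X * P1 * (P2 * S2) + (P1 * S1) * (P2 * S2)"
    proof -
      have "(X * s1 + X * s2 + s1 * s2) * (p1 * p2)
         = X * p2 * (p1 * s1) + X * p1 * (p2 * s2) + (p1 * s1) * (p2 * s2)" for X s1 s2 p1 p2 :: "real fps"
        by (simp add: algebra_simps)
      then show ?thesis unfolding A'_def X S1_def[symmetric] S2_def[symmetric] .
    qed
    then show ?thesis unfolding PS by (simp add: distrib_left add_ac)
  qed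
  have "((fps_const (real n) * W ^ (n - 1) * Y + fps_const (real k + 3/2) * fps_const x * W ^ n) * A
      - fps_const (real k) * Y * A' * W ^ n) * G * P1 ^ Suc k * P2 ^ Suc k
    = (fps_const (real n) * W ^ (n - 1) * Y + fps_const (real k + 3/2) * fps_const x * W ^ n) * (A * (P1 * P2)) * G * Q
      - fps_const (real k) * Y * (A' * (P1 * P2)) * W ^ n * G * Q"
  proof -
    have "(m * a - c * y * a' * w) * g * (p1 * q1) * (p2 * q2)
        = m * (a * (p1 * p2)) * g * (q1 * q2) - c * y * (a' * (p1 * p2)) * w * g * (q1 * q2)"
      for m a c y a' w g p1 q1 p2 q2 :: "real fps"
      by (simp add: algebra_simps)
    then show ?thesis unfolding Q_def power_Suc .
  qed
  also have "\<dots> = fps_X * fps_deriv F - fps_const (real k) * F"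
  proof -
    have "m * X * g * q - c * y * (1 + X * p) * w * g * q
        = X * (m * g * q - c * w * y * g * q * p) - c * (w * y * g * q)" for m X g q c y p w :: "real fps"
      by (simp add: algebra_simps)
    then show ?thesis unfolding A A' dF unfolding F_def .
  qed
  finally show ?thesis
    using fps_nth_X_deriv_diff[of F k] unfolding local_res_Suc Y_def P1_def P2_def by simp
qed

text \<open>Orders the numerator of \<open>residue_derivative_zero\<close> by powers of w, with V
  for w^(n - 1) and U for w^n. The premise carries the factor n because n - 1 is truncated at n =
  0.\<close>

lemma residue_polynomial_expand:
  fixes W :: "'r :: comm_ring_1"
  assumes "n * V * W = n * U"
  shows "(n * V * (1 + x * W) + \<kappa> * x * U) * ((W - a) * (W - b) * (W - c))
      - K * (1 + x * W) * ((W - a) * (W - b) + (W - a) * (W - c) + (W - b) * (W - c)) * U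
    = - (n * (a * b * c)) * V
      + (n * (a * b + a * c + b * c) - (n + \<kappa>) * x * (a * b * c) - K * (a * b + a * c + b * c)) * U
      + (- (n * (a + b + c)) + (n + \<kappa>) * x * (a * b + a * c + b * c) - K * (x * (a * b + a * c + b * c) - 2 * (a + b + c))) * (U * W)
      + (n - (n + \<kappa>) * x * (a + b + c) - K * (3 - 2 * x * (a + b + c))) * (U * W ^ 2)
      + ((n + \<kappa>) * x - 3 * K * x) * (U * W ^ 3)"
proof -
  have 1: "n * V * (1 + x * W) * T = n * V * T + n * x * U * T" for T
  proof -
    have "n * V * (1 + x * W) * T = n * V * T + x * (n * V * W) * T" by (simp add: algebra_simps)
    then show ?thesis unfolding assms by (simp add: mult_ac)
  qed
  have 2: "n * V * ((W - a) * (W - b) * (W - c)) = n * U * W ^ 2 - (a + b + c) * (n * U) * W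
      + (a * b + a * c + b * c) * (n * U) - n * V * (a * b * c)"
    unfolding assms[symmetric] by (simp add: algebra_simps power2_eq_square)
  show ?thesis
    unfolding distrib_right[of "n * V * (1 + x * W)"] 1 2
    by (simp add: algebra_simps power2_eq_square power3_eq_cube)
qed

text \<open>The coefficients depend only on the symmetric functions of the nodes, so the relation is
  the same at all three nodes and can be summed to a recurrence for the moments of w^n.\<close>

lemma local_recurrence:
  fixes n k :: nat and \<kappa> :: real
  assumes u: "1 + x * u \<noteq> 0" and uv: "u \<noteq> v" "u \<noteq> w"
    and G: "(1 + fps_const x * lin u) * fps_deriv G = fps_const ((real k + 1/2) * x) * G"
    and e: "e1 = u + v + w" "e2 = u * v + u * w + v * w" "e3 = u * v * w"
  defines "\<kappa> \<equiv> real n + (real k + 3/2)"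
  shows "local_res ((fps_const (- (real n * e3)) * (lin u ^ (n - 1) * G)
      + (fps_const (real n * e2 - \<kappa> * x * e3 - real k * e2) * (lin u ^ n * G)
      + (fps_const (- (real n * e1) + \<kappa> * x * e2 - real k * (x * e2 - 2 * e1)) * (lin u ^ (n + 1) * G)
      + (fps_const (real n - \<kappa> * x * e1 - real k * (3 - 2 * x * e1)) * (lin u ^ (n + 2) * G)
      + fps_const (\<kappa> * x - 3 * real k * x) * (lin u ^ (n + 3) * G)))))
       * pole (u - v) ^ Suc k * pole (u - w) ^ Suc k) (Suc k) = 0"
proof -
  define W where "W = lin u"
  have nU: "fps_const (real n) * W ^ (n - 1) * W = fps_const (real n) * W ^ n"
    by (cases n) (auto simp: mult_ac)
  have num: "(2 :: real fps) = fps_const 2" "(3 :: real fps) = fps_const 3"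
    by (simp_all only: numeral_fps_const)
  have const: "fps_const a + fps_const b = fps_const (a + b)" "fps_const a - fps_const b = fps_const (a - b)"
    "fps_const a * fps_const b = fps_const (a * b)" "- fps_const a = fps_const (- a)" for a b :: real
    by simp_all
  have "(fps_const (real n) * W ^ (n - 1) * (1 + fps_const x * W) + fps_const (real k + 3/2) * fps_const x * W ^ n)
       * ((W - fps_const u) * (W - fps_const v) * (W - fps_const w))
      - fps_const (real k) * (1 + fps_const x * W)
        * ((W - fps_const u) * (W - fps_const v) + (W - fps_const u) * (W - fps_const w) + (W - fps_const v) * (W - fps_const w)) * W ^ n
      = fps_const (- (real n * e3)) * W ^ (n - 1)
      + fps_const (real n * e2 - \<kappa> * x * e3 - real k * e2) * W ^ n
      + fps_const (- (real n * e1) + \<kappa> * x * e2 - real k * (x * e2 - 2 * e1)) * (W ^ n * W)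
      + fps_const (real n - \<kappa> * x * e1 - real k * (3 - 2 * x * e1)) * (W ^ n * W ^ 2)
      + fps_const (\<kappa> * x - 3 * real k * x) * (W ^ n * W ^ 3)"
    unfolding e \<kappa>_def by (rule trans[OF residue_polynomial_expand[OF nU]]) (simp only: num const)
  note R = this
  show ?thesis
    using residue_derivative_zero[OF u uv G, of n] unfolding W_def[symmetric] R
    by (simp only: distrib_right mult.assoc add.assoc power_add power_one_right)
qed

text \<open>As y0, y1, y2 are arbitrary, this is linear independence of the three forms. Their
  vanishing kills the moments of 1, w and w^2 with multiplicity k + 1 at every node; the recurrence
  extends this to all w^n; lowering the multiplicities to one simple node then isolates each
  y.\<close>

lemma dd_nonvanishing:
  fixes y0 y1 y2 :: real and k :: nat
  assumes "\<alpha> \<noteq> \<beta>" "\<alpha> \<noteq> \<gamma>" "\<beta> \<noteq> \<gamma>" "x \<noteq> 0"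
    and "1 + x * \<alpha> \<noteq> 0" "1 + x * \<beta> \<noteq> 0" "1 + x * \<gamma> \<noteq> 0"
  defines "D \<equiv> dd \<alpha> \<beta> \<gamma> (fps_const y0 * jet k x \<alpha>) (fps_const y1 * jet k x \<beta>) (fps_const y2 * jet k x \<gamma>)"
  assumes z: "D (Suc k) k k = 0" "D k (Suc k) k = 0" "D k k (Suc k) = 0"
  shows "y0 = 0 \<and> y1 = 0 \<and> y2 = 0"
proof -
  define G0 G1 G2 where "G0 = fps_const y0 * jet k x \<alpha>" and "G1 = fps_const y1 * jet k x \<beta>"
    and "G2 = fps_const y2 * jet k x \<gamma>"
  define E where "E p q r n = dd \<alpha> \<beta> \<gamma> (lin \<alpha> ^ n * G0) (lin \<beta> ^ n * G1) (lin \<gamma> ^ n * G2) p q r" for p q r n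
  note dist = assms(1-3)
  have z: "E (Suc k) k k 0 = 0" "E k (Suc k) k 0 = 0" "E k k (Suc k) 0 = 0"
    using z by (simp_all add: E_def D_def G0_def G1_def G2_def)
  have s1: "E (Suc p) q r (Suc n) = \<alpha> * E (Suc p) q r n + E p q r n" for p q r n
    unfolding E_def power_Suc mult.assoc by (rule dd_lin_mult[OF dist])
  have s2: "E p (Suc q) r (Suc n) = \<beta> * E p (Suc q) r n + E p q r n" for p q r n
    unfolding E_def power_Suc mult.assoc dd_swap12[of \<alpha> \<beta> \<gamma>]
    by (rule dd_lin_mult) (use dist in auto)
  have s3: "E p q (Suc r) (Suc n) = \<gamma> * E p q (Suc r) n + E p q r n" for p q r n
    unfolding E_def power_Suc mult.assoc dd_swap23[of \<alpha> \<beta> \<gamma>] dd_swap12[of \<alpha> \<gamma> \<beta>]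
    by (rule dd_lin_mult) (use dist in auto)
  have r12: "(\<alpha> - \<beta>) * E (Suc p) (Suc q) r n = E (Suc p) q r n - E p (Suc q) r n" for p q r n
    unfolding E_def by (rule dd_rec12[OF dist])
  have r13: "(\<alpha> - \<gamma>) * E (Suc p) q (Suc r) n = E (Suc p) q r n - E p q (Suc r) n" for p q r n
    unfolding E_def by (rule dd_rec13[OF dist])
  have r23: "(\<beta> - \<gamma>) * E p (Suc q) (Suc r) n = E p (Suc q) r n - E p q (Suc r) n" for p q r n
    unfolding E_def by (rule dd_rec23[OF dist])
  have "E (Suc k) (Suc k) k 0 = 0" using r12[of k k k 0] z dist by simp
  moreover have e23: "E k (Suc k) (Suc k) 0 = 0" using r23[of k k k 0] z dist by simp
  ultimately have e0: "E (Suc k) (Suc k) (Suc k) 0 = 0" using r13[of k "Suc k" k 0] dist by simp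
  then have e1: "E (Suc k) (Suc k) (Suc k) 1 = 0" using s1[of k "Suc k" "Suc k" 0] e23 by simp
  have "E k (Suc k) (Suc k) 1 = 0" using s2[of k k "Suc k" 0] e23 z by simp
  then have e2: "E (Suc k) (Suc k) (Suc k) 2 = 0"
    using s1[of k "Suc k" "Suc k" 1] e1 by (simp add: numeral_2_eq_2)

  have ode: "(1 + fps_const x * lin u) * fps_deriv (fps_const y * jet k x u)
      = fps_const ((real k + 1/2) * x) * (fps_const y * jet k x u)" if "1 + x * u \<noteq> 0" for u y
  proof -
    have "(1 + fps_const x * lin u) * fps_deriv (fps_const y * jet k x u)
        = fps_const y * ((1 + fps_const x * lin u) * fps_deriv (jet k x u))"
      by (simp add: mult_ac)
    then show ?thesis unfolding jet_ode[OF that] by (simp only: mult_ac)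
  qed
  define L where "L n = E (Suc k) (Suc k) (Suc k) n" for n
  have L: "L n = 0" for n
  proof (induction n rule: less_induct)
    case (less m)
    show ?case
    proof (cases "m < 3")
      case True
      then have "m = 0 \<or> m = 1 \<or> m = 2" by auto
      then show ?thesis using e0 e1 e2 by (auto simp: L_def)
    next
      case False
      then obtain n where m: "m = n + 3" by (metis add.commute le_Suc_ex not_less)
      define \<epsilon>1 \<epsilon>2 \<epsilon>3 where "\<epsilon>1 = \<alpha> + \<beta> + \<gamma>" and "\<epsilon>2 = \<alpha> * \<beta> + \<alpha> * \<gamma> + \<beta> * \<gamma>" and "\<epsilon>3 = \<alpha> * \<beta> * \<gamma>"
      define \<kappa> where "\<kappa> = real n + (real k + 3/2)"
      define c0 c1 c2 c3 c4 where "c0 = - (real n * \<epsilon>3)" and "c1 = real n * \<epsilon>2 - \<kappa> * x * \<epsilon>3 - real k * \<epsilon>2"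
        and "c2 = - (real n * \<epsilon>1) + \<kappa> * x * \<epsilon>2 - real k * (x * \<epsilon>2 - 2 * \<epsilon>1)"
        and "c3 = real n - \<kappa> * x * \<epsilon>1 - real k * (3 - 2 * x * \<epsilon>1)" and "c4 = \<kappa> * x - 3 * real k * x"
      note rec = local_recurrence[where n = n and k = k and x = x and ?e1.0 = \<epsilon>1 and ?e2.0 = \<epsilon>2 and ?e3.0 = \<epsilon>3,
          folded \<kappa>_def, folded c0_def c1_def c2_def c3_def c4_def]
      define C where "C W G = fps_const c0 * (W ^ (n - 1) * G) + (fps_const c1 * (W ^ n * G) + (fps_const c2 * (W ^ (n + 1) * G)
         + (fps_const c3 * (W ^ (n + 2) * G) + fps_const c4 * (W ^ (n + 3) * G))))" for W G :: "real fps"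
      have "dd \<alpha> \<beta> \<gamma> (C (lin \<alpha>) G0) (C (lin \<beta>) G1) (C (lin \<gamma>) G2) (Suc k) (Suc k) (Suc k) = 0"
      proof -
        have "local_res (C (lin \<alpha>) G0 * pole (\<alpha> - \<beta>) ^ Suc k * pole (\<alpha> - \<gamma>) ^ Suc k) (Suc k) = 0"
          unfolding C_def G0_def
          by (rule rec) (use assms ode in \<open>simp_all add: \<epsilon>1_def \<epsilon>2_def \<epsilon>3_def\<close>)
        moreover have "local_res (C (lin \<beta>) G1 * pole (\<beta> - \<alpha>) ^ Suc k * pole (\<beta> - \<gamma>) ^ Suc k) (Suc k) = 0"
          unfolding C_def G1_def
          by (rule rec) (use assms ode in \<open>simp_all add: \<epsilon>1_def \<epsilon>2_def \<epsilon>3_def\<close>)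
        moreover have "local_res (C (lin \<gamma>) G2 * pole (\<gamma> - \<alpha>) ^ Suc k * pole (\<gamma> - \<beta>) ^ Suc k) (Suc k) = 0"
          unfolding C_def G2_def
          by (rule rec) (use assms ode in \<open>simp_all add: \<epsilon>1_def \<epsilon>2_def \<epsilon>3_def\<close>)
        ultimately show ?thesis unfolding dd_def by simp
      qed
      then have "c0 * L (n - 1) + (c1 * L n + (c2 * L (n + 1) + (c3 * L (n + 2) + c4 * L (n + 3)))) = 0"
        unfolding C_def dd_add dd_const_mult L_def E_def .
      then have "c4 * L m = 0" using less m by simp
      \<comment> \<open>The coefficient is x (n + 3/2 - 2 k), that is x times half an odd integer;
        the half-integer exponent is essential here.\<close>
      moreover have "c4 \<noteq> 0"
      proof
        assume "c4 = 0"
        then have "x * (2 * real n + 3 - 4 * real k) = 0" by (simp add: c4_def \<kappa>_def algebra_simps)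
        then have "2 * real n + 3 = 4 * real k" using assms(4) by simp
        then have "real (2 * n + 3) = real (4 * k)" by simp
        then show False unfolding of_nat_eq_iff by presburger
      qed
      ultimately show ?thesis by simp
    qed
  qed
  \<comment> \<open>Read backwards, \<open>s1\<close>, \<open>s2\<close>, \<open>s3\<close> express
    a moment by two moments with one multiplicity more, so vanishing for all n passes
    downwards.\<close>
  have down: "(\<forall>n. E p q r n = 0)" if "p \<le> Suc k" "q \<le> Suc k" "r \<le> Suc k" for p q r
  proof -
    have 1: "(\<forall>n. E p q r n = 0)" if "\<forall>n. E (Suc p) q r n = 0" for p q r using s1[of p q r] that by simp
    have 2: "(\<forall>n. E p q r n = 0)" if "\<forall>n. E p (Suc q) r n = 0" for p q r using s2[of p q r] that by simp
    have 3: "(\<forall>n. E p q r n = 0)" if "\<forall>n. E p q (Suc r) n = 0" for p q r using s3[of p q r] that by simp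
    have "\<forall>n. E p (Suc k) (Suc k) n = 0"
      using that(1) by (induction rule: inc_induct) (use L L_def 1 in auto)
    from that(2) this have "\<forall>n. E p q (Suc k) n = 0"
      by (induction rule: inc_induct) (use 2 in auto)
    from that(3) this show ?thesis
      by (induction rule: inc_induct) (use 3 in auto)
  qed
  have "y0 * (1 + x * \<alpha>) ^ k = 0" using down[of 1 0 0]
    by (auto simp: E_def dd_def G0_def jet_def dest: spec[of _ 0])
  moreover have "y1 * (1 + x * \<beta>) ^ k = 0" using down[of 0 1 0]
    by (auto simp: E_def dd_def G1_def jet_def dest: spec[of _ 0])
  moreover have "y2 * (1 + x * \<gamma>) ^ k = 0" using down[of 0 0 1]
    by (auto simp: E_def dd_def G2_def jet_def dest: spec[of _ 0])
  ultimately show ?thesis using assms by simp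
qed

section \<open>Simultaneous approximation of two square roots\<close>

text \<open>The free factor m makes 4 (N + u) m divisible by both node differences, so that the two
  poles share the per-degree denominator of the jet.\<close>

lemma local_res_jet_int:
  fixes u v w m N :: int and k p q r :: nat
  assumes "N > 0" "N + u > 0" "u \<noteq> v" "u \<noteq> w"
    and dvd: "(u - v) dvd 4 * (N + u) * m" "(u - w) dvd 4 * (N + u) * m" and p: "p \<le> Suc k"
  shows "local_res (jet k (1 / of_int N) (of_int u) * pole (of_int u - of_int v) ^ q * pole (of_int u - of_int w) ^ r) p
    * ((of_int N / of_int (N + u)) ^ k * of_int ((u - v) ^ q * (u - w) ^ r * (4 * (N + u) * m) ^ (p - 1))) \<in> \<int>"
proof (cases p)
  case (Suc i)
  define F where "F = tjet k (1 / of_int N) (of_int u) * pole (of_int (u - v)) ^ q * pole (of_int (u - w)) ^ r"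
  obtain c1 where c1: "4 * (N + u) * m = (u - v) * c1" using dvd(1) by (rule dvdE)
  obtain c2 where c2: "4 * (N + u) * m = (u - w) * c2" using dvd(2) by (rule dvdE)
  have "real_of_int (4 * (N + u) * m) = of_int (u - v) * of_int c1" "real_of_int (4 * (N + u) * m) = of_int (u - w) * of_int c2"
    by (simp_all only: c1[symmetric] c2[symmetric] flip: of_int_mult)
  moreover have "ints_scaled ((of_int N / (of_int N + of_int u)) ^ k) (real_of_int (4 * (N + u) * m)) (tjet k (1 / of_int N) (of_int u))"
  proof (rule ints_scaled_tjet[where m = "of_int m"])
    show "real_of_int N > 0" "real_of_int N + of_int u > 0" using assms(1,2) by linarith+
  qed simp_all
  ultimately have "ints_scaled ((of_int N / (of_int N + of_int u)) ^ k * of_int (u - v) ^ q * of_int (u - w) ^ r)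
      (real_of_int (4 * (N + u) * m)) F"
    unfolding F_def using assms by (intro ints_scaled_mult ints_scaled_power ints_scaled_pole[where m = "of_int c1"]
      ints_scaled_pole[where m = "of_int c2"]) auto
  then have "fps_nth F i * ((of_int N / (of_int N + of_int u)) ^ k * of_int (u - v) ^ q * of_int (u - w) ^ r)
      * real_of_int (4 * (N + u) * m) ^ i \<in> \<int>"
    by (simp add: ints_scaled_def)
  moreover have "local_res (jet k (1 / of_int N) (of_int u) * pole (of_int u - of_int v) ^ q * pole (of_int u - of_int w) ^ r) p = fps_nth F i"
  proof -
    have "1 + 1 / of_int N * of_int u \<noteq> (0 :: real)"
      using assms(1,2) by (simp add: field_simps flip: of_int_add)
    then show ?thesis using local_res_tjet[of "1 / of_int N" "of_int u" p k] p by (simp add: F_def Suc)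
  qed
  ultimately show ?thesis by (simp add: Suc mult_ac)
qed simp

text \<open>A Cauchy-type estimate with radius \<tau>, at most half the distance to the other nodes.
  Then 1 / \<tau> dominates the bounds of both poles, so moving one unit of multiplicity to another
  node costs nothing and all three shapes get the same bound.\<close>

lemma local_res_jet_le:
  fixes u v w \<tau> x :: real and k p q r :: nat
  assumes "x \<ge> 0" "u \<ge> 0" "\<tau> > 0" "2 * \<tau> \<le> \<bar>u - v\<bar>" "2 * \<tau> \<le> \<bar>u - w\<bar>"
    and k: "k \<ge> 1" and pqr: "p = Suc k \<and> q = k \<and> r = k \<or> p = k \<and> q = Suc k \<and> r = k \<or> p = k \<and> q = k \<and> r = Suc k"
  shows "\<bar>local_res (jet k x u * pole (u - v) ^ q * pole (u - w) ^ r) p\<bar>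
    \<le> (1 + x * (u + \<tau>)) ^ Suc k * (1 / (\<tau> * (\<bar>u - v\<bar> - \<tau>) * (\<bar>u - w\<bar> - \<tau>))) ^ k"
proof -
  obtain i where p: "p = Suc i" using pqr k by (cases p) auto
  define F where "F = tjet k x u * pole (u - v) ^ q * pole (u - w) ^ r"
  define A where "A = 1 / (\<bar>u - v\<bar> - \<tau>)"
  define B where "B = 1 / (\<bar>u - w\<bar> - \<tau>)"
  define T where "T = 1 / \<tau>"
  define S where "S = (1 + x * (u + \<tau>)) ^ Suc k"
  have T: "0 \<le> T" "0 \<le> A" "0 \<le> B" "A \<le> T" "B \<le> T" "S \<ge> 0"
    using assms by (auto simp: A_def B_def T_def S_def field_simps)
  have "abs_bounded \<tau> F (S * A ^ q * B ^ r)"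
    unfolding F_def A_def B_def S_def using assms
    by (intro abs_bounded_mult abs_bounded_power abs_bounded_tjet abs_bounded_pole) auto
  then have "\<bar>fps_nth F i\<bar> * \<tau> ^ i \<le> S * A ^ q * B ^ r" by (rule abs_bounded_nth) (use assms in simp)
  then have "\<bar>fps_nth F i\<bar> \<le> S * A ^ q * B ^ r * T ^ i"
    using assms by (simp add: T_def field_simps)
  also have "\<dots> = S * (A ^ q * B ^ r * T ^ i)" by simp
  also have "\<dots> \<le> S * (T * A * B) ^ k"
  proof (rule mult_left_mono)
    obtain k' where k': "k = Suc k'" using k by (cases k) auto
    have 2: "A ^ Suc k * B ^ k * T ^ k' \<le> (T * A * B) ^ k"
    proof -
      have "A ^ Suc k * B ^ k * T ^ k' = A * (A ^ k * B ^ k * T ^ k')" by simp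
      also have "\<dots> \<le> T * (A ^ k * B ^ k * T ^ k')" by (rule mult_right_mono) (use T in auto)
      finally show ?thesis by (simp add: k' power_mult_distrib mult_ac)
    qed
    have 3: "A ^ k * B ^ Suc k * T ^ k' \<le> (T * A * B) ^ k"
    proof -
      have "A ^ k * B ^ Suc k * T ^ k' = B * (A ^ k * B ^ k * T ^ k')" by simp
      also have "\<dots> \<le> T * (A ^ k * B ^ k * T ^ k')" by (rule mult_right_mono) (use T in auto)
      finally show ?thesis by (simp add: k' power_mult_distrib mult_ac)
    qed
    have 1: "A ^ k * B ^ k * T ^ k \<le> (T * A * B) ^ k" by (simp add: power_mult_distrib mult_ac)
    show "A ^ q * B ^ r * T ^ i \<le> (T * A * B) ^ k"
      using pqr
    proof (elim disjE conjE)
      assume *: "p = Suc k" "q = k" "r = k"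
      then have "i = k" using p by simp
      with * 1 show ?thesis by simp
    next
      assume *: "p = k" "q = Suc k" "r = k"
      then have "i = k'" using p k' by simp
      with * 2 show ?thesis by simp
    next
      assume *: "p = k" "q = k" "r = Suc k"
      then have "i = k'" using p k' by simp
      with * 3 show ?thesis by simp
    qed
  qed (use T in auto)
  also have "T * A * B = 1 / (\<tau> * (\<bar>u - v\<bar> - \<tau>) * (\<bar>u - w\<bar> - \<tau>))" by (simp add: A_def B_def T_def)
  finally have "\<bar>fps_nth F i\<bar> \<le> S * (1 / (\<tau> * (\<bar>u - v\<bar> - \<tau>) * (\<bar>u - w\<bar> - \<tau>))) ^ k" .
  moreover have "local_res (jet k x u * pole (u - v) ^ q * pole (u - w) ^ r) p = fps_nth F i"
  proof -
    have "1 + x * u \<noteq> 0" using assms(1,2) by (smt (verit) mult_nonneg_nonneg)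
    then have "local_res (jet k x u * pole (u - v) ^ q * pole (u - w) ^ r) p = local_res F p"
      unfolding F_def by (rule local_res_tjet) (use pqr in auto)
    then show ?thesis by (simp add: p)
  qed
  ultimately show ?thesis by (simp add: S_def)
qed

section \<open>Linear forms with nodes 0, a and b\<close>

locale approximants =
  fixes a b d :: int
  assumes a: "0 < a" and ab: "a < b" and d: "100 \<le> d"
begin

text \<open>This choice gives 1 + a / N = (b d + 1) / (b d) and 1 + b / N = (a d + 1) / (a d), with
  squares as numerators. Moreover N + a and N + b are divisible by a and b, which keeps the
  denominators small.\<close>

definition N :: int where "N = a * b * d"

text \<open>\<open>\<Delta> ^ k\<close> is a common denominator of the three coefficients: 4 comes
  from the half-integer binomials, a, b and b - a from the node differences, N from x.\<close>

definition \<Delta> :: int where "\<Delta> = 4 * a * b * (b - a) ^ 2 * N"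

abbreviation x :: real where "x \<equiv> 1 / of_int N"

definition coef :: "nat \<Rightarrow> int \<Rightarrow> int \<Rightarrow> int \<Rightarrow> nat \<Rightarrow> nat \<Rightarrow> nat \<Rightarrow> real" where
  "coef k u v w p q r =
     local_res (jet k x (of_int u) * pole (of_int u - of_int v) ^ q * pole (of_int u - of_int w) ^ r) p"

definition shape :: "nat \<Rightarrow> nat \<Rightarrow> nat \<Rightarrow> nat \<Rightarrow> bool" where
  "shape k p q r \<longleftrightarrow> p = Suc k \<and> q = k \<and> r = k \<or> p = k \<and> q = Suc k \<and> r = k \<or> p = k \<and> q = k \<and> r = Suc k"

lemma N_pos: "N > 0"
  using a ab d by (simp add: N_def)

lemma coef_int_aux:
  assumes "N + u > 0" "u \<noteq> v" "u \<noteq> w" "(u - v) dvd 4 * (N + u) * m" "(u - w) dvd 4 * (N + u) * m" "p \<le> Suc k"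
    and "(4 * a * b * (b - a) ^ 2 * (N + u)) ^ k = c * ((u - v) ^ q * (u - w) ^ r * (4 * (N + u) * m) ^ (p - 1))"
  shows "of_int \<Delta> ^ k * coef k u v w p q r \<in> \<int>"
proof -
  let ?R = "(u - v) ^ q * (u - w) ^ r * (4 * (N + u) * m) ^ (p - 1)"
  have "real_of_int (N + u) > 0" using assms(1) by linarith
  then have "of_int \<Delta> = of_int N / of_int (N + u) * real_of_int (4 * a * b * (b - a) ^ 2 * (N + u))"
    unfolding \<Delta>_def of_int_mult[of _ "N + u"] of_int_mult[of _ N] by simp
  then have "of_int \<Delta> ^ k = (of_int N / of_int (N + u)) ^ k * real_of_int ((4 * a * b * (b - a) ^ 2 * (N + u)) ^ k)"
    by (simp only: of_int_power power_mult_distrib[of "of_int N / of_int (N + u)"])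
  then have "of_int \<Delta> ^ k * coef k u v w p q r
     = real_of_int c * (coef k u v w p q r * ((of_int N / of_int (N + u)) ^ k * of_int ?R))"
    unfolding assms(7) by simp
  moreover have "coef k u v w p q r * ((of_int N / of_int (N + u)) ^ k * of_int ?R) \<in> \<int>"
    unfolding coef_def by (rule local_res_jet_int) (use assms N_pos in auto)
  ultimately show ?thesis by (metis Ints_mult Ints_of_int)
qed

lemma coef_int:
  assumes k: "k \<ge> 1" and pqr: "shape k p q r"
  shows "of_int \<Delta> ^ k * coef k 0 a b p q r \<in> \<int>"
    "of_int \<Delta> ^ k * coef k a 0 b p q r \<in> \<int>"
    "of_int \<Delta> ^ k * coef k b 0 a p q r \<in> \<int>"
proof -
  obtain k' where k': "k = Suc k'" using k by (cases k) auto
  have cases: "p = Suc k \<and> q = k \<and> r = k \<or> p = k \<and> q = Suc k \<and> r = k \<or> p = k \<and> q = k \<and> r = Suc k"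
    using pqr by (simp add: shape_def)
  have dvdN: "- a dvd 4 * (N + 0) * 1" "- b dvd 4 * (N + 0) * 1"
    by (simp_all add: N_def)
  \<comment> \<open>If q or r is k + 1, then p = k and the exponent of V drops to k - 1; the spare V
    pays for the extra e or f, which divides it.\<close>
  have quot: "\<exists>c. B ^ k = c * (e ^ q * f ^ r * V ^ (p - 1))"
    if "B = D * e * f * V" "V = z * e" "V = y * f" for B D e f V z y :: int
    using cases
  proof (elim disjE conjE)
    assume "p = Suc k" "q = k" "r = k"
    then show ?thesis
      unfolding that(1) by (intro exI[of _ "D ^ k"]) (simp add: power_mult_distrib mult_ac)
  next
    assume *: "p = k" "q = Suc k" "r = k"
    have "V ^ k = z * e * V ^ k'" using that(2) by (simp add: k')
    then have "B ^ k = (z * D ^ k) * (e ^ Suc k * f ^ k * V ^ k')"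
      unfolding that(1) power_mult_distrib by (simp only: mult_ac power_Suc)
    then show ?thesis using * k' by auto
  next
    assume *: "p = k" "q = k" "r = Suc k"
    have "V ^ k = y * f * V ^ k'" using that(3) by (simp add: k')
    then have "B ^ k = (y * D ^ k) * (e ^ k * f ^ Suc k * V ^ k')"
      unfolding that(1) power_mult_distrib by (simp only: mult_ac power_Suc)
    then show ?thesis using * k' by auto
  qed
  have "\<exists>c. (4 * a * b * (b - a) ^ 2 * (N + 0)) ^ k = c * ((0 - a) ^ q * (0 - b) ^ r * (4 * (N + 0) * 1) ^ (p - 1))"
    by (rule quot[where D = "(b - a) ^ 2" and z = "- (4 * b * d)" and y = "- (4 * a * d)"]) (simp_all add: N_def mult_ac)
  then obtain c where "(4 * a * b * (b - a) ^ 2 * (N + 0)) ^ k = c * ((0 - a) ^ q * (0 - b) ^ r * (4 * (N + 0) * 1) ^ (p - 1))" ..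
  then show "of_int \<Delta> ^ k * coef k 0 a b p q r \<in> \<int>"
    by (intro coef_int_aux[where m = 1]) (use a ab N_pos dvdN cases in auto)
  have node: "of_int \<Delta> ^ k * coef k u 0 w p q r \<in> \<int>"
    if uw: "u = a \<and> w = b \<or> u = b \<and> w = a" for u w
  proof -
    \<comment> \<open>Since N + u = u t already contains the difference u - 0, the factor m only has
      to supply u - w.\<close>
    define t where "t = w * d + 1"
    have t: "N + u = u * t" using uw by (auto simp: N_def t_def algebra_simps)
    have ab': "a * b = u * w" "(b - a) ^ 2 = (u - w) ^ 2" using uw by (auto simp: power2_commute)
    have "4 * a * b * (b - a) ^ 2 * (N + u) = 4 * (a * b) * (b - a) ^ 2 * (N + u)" by simp
    also have "\<dots> = w * (u - 0) * (u - w) * (4 * (N + u) * (u - w))"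
      unfolding ab' by (simp add: power2_eq_square)
    finally have "\<exists>c. (4 * a * b * (b - a) ^ 2 * (N + u)) ^ k = c * ((u - 0) ^ q * (u - w) ^ r * (4 * (N + u) * (u - w)) ^ (p - 1))"
      by (rule quot[where z = "4 * t * (u - w)" and y = "4 * (N + u)"]) (simp_all add: t)
    then obtain c where "(4 * a * b * (b - a) ^ 2 * (N + u)) ^ k = c * ((u - 0) ^ q * (u - w) ^ r * (4 * (N + u) * (u - w)) ^ (p - 1))" ..
    then show ?thesis
      by (intro coef_int_aux[where m = "u - w"]) (use a ab N_pos uw cases t in auto)
  qed
  show "of_int \<Delta> ^ k * coef k a 0 b p q r \<in> \<int>" "of_int \<Delta> ^ k * coef k b 0 a p q r \<in> \<int>"
    by (rule node; simp)+
qed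

text \<open>The hypothesis \<open>le\<close> bounds \<Delta> by 16 b^3 d times the Cauchy
  denominator. The remaining factor is at most (1 + 1/50)^(2 k), below (17/16)^k, which turns 16
  into 17.\<close>

lemma coef_le_aux:
  fixes u v w :: int and \<tau> :: real
  assumes "k \<ge> 1" "shape k p q r" "0 \<le> u" "u \<le> b"
    and \<tau>: "\<tau> > 0" "\<tau> \<le> of_int b" "2 * \<tau> \<le> \<bar>of_int u - of_int v\<bar>" "2 * \<tau> \<le> \<bar>of_int u - of_int w\<bar>"
    and le: "of_int (a ^ 2 * (b - a) ^ 2) \<le> 4 * of_int b * (\<tau> * (\<bar>of_int u - of_int v\<bar> - \<tau>) * (\<bar>of_int u - of_int w\<bar> - \<tau>))"
  shows "\<bar>of_int \<Delta> ^ k * coef k u v w p q r\<bar> \<le> (17 * of_int b ^ 3 * of_int d) ^ k"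
proof -
  let ?D = "\<tau> * (\<bar>real_of_int u - of_int v\<bar> - \<tau>) * (\<bar>of_int u - of_int w\<bar> - \<tau>)"
  have D: "?D > 0" using \<tau> by (intro mult_pos_pos) auto
  have d0: "real_of_int d \<ge> 100" "real_of_int a \<ge> 1" "real_of_int b > 0" using a ab d by linarith+
  have Delta0: "\<Delta> \<ge> 0" using a ab d N_pos by (simp add: \<Delta>_def)
  have xb: "x * (of_int u + \<tau>) \<le> 1 / 50"
  proof -
    have "of_int u + \<tau> \<le> 2 * of_int b" using \<tau>(2) assms(4) by linarith
    then have "x * (of_int u + \<tau>) \<le> x * (2 * of_int b)"
      using N_pos by (intro mult_left_mono) auto
    also have "\<dots> = 2 / (of_int a * of_int d)" using a ab by (simp add: N_def)
    also have "\<dots> \<le> 2 / (1 * 100)" using d0 by (intro divide_left_mono mult_mono) auto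
    finally show ?thesis by simp
  qed
  have xu: "x * (of_int u + \<tau>) \<ge> 0" using N_pos assms by simp
  have "\<bar>of_int \<Delta> ^ k * coef k u v w p q r\<bar>
      \<le> of_int \<Delta> ^ k * ((1 + x * (of_int u + \<tau>)) ^ Suc k * (1 / ?D) ^ k)"
    unfolding abs_mult coef_def
  proof (rule mult_mono)
    show "\<bar>local_res (jet k x (of_int u) * pole (of_int u - of_int v) ^ q * pole (of_int u - of_int w) ^ r) p\<bar>
       \<le> (1 + x * (of_int u + \<tau>)) ^ Suc k * (1 / ?D) ^ k"
      by (rule local_res_jet_le) (use assms N_pos in \<open>auto simp: shape_def\<close>)
  qed (use Delta0 in auto)
  also have "(1 + x * (of_int u + \<tau>)) ^ Suc k \<le> (17 / 16) ^ k"
  proof -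
    have "(1 + x * (of_int u + \<tau>)) ^ Suc k \<le> (1 + 1 / 50) ^ Suc k"
      using xb xu by (intro power_mono) auto
    also have "\<dots> \<le> (1 + 1 / 50) ^ (2 * k)" using assms(1) by (intro power_increasing) auto
    also have "\<dots> = ((1 + 1 / 50) ^ 2) ^ k" by (simp only: power_mult)
    also have "\<dots> \<le> (17 / 16) ^ k" by (intro power_mono) (auto simp: power2_eq_square)
    finally show ?thesis .
  qed
  also have "of_int \<Delta> ^ k * ((17 / 16) ^ k * (1 / ?D) ^ k) = (of_int \<Delta> * (17 / 16) * (1 / ?D)) ^ k"
    by (simp only: power_mult_distrib mult_ac)
  also have "\<dots> \<le> (17 * of_int b ^ 3 * of_int d) ^ k"
  proof (rule power_mono)
    have "of_int \<Delta> = 4 * of_int b ^ 2 * of_int d * real_of_int (a ^ 2 * (b - a) ^ 2)"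
      by (simp add: \<Delta>_def N_def power2_eq_square mult_ac)
    also have "\<dots> \<le> 4 * of_int b ^ 2 * of_int d * (4 * of_int b * ?D)"
      by (rule mult_left_mono[OF le]) (use d0 in auto)
    also have "4 * of_int b ^ 2 * of_int d * (4 * of_int b * D) = 16 * of_int b ^ 3 * of_int d * D" for D :: real
      by (simp add: power2_eq_square power3_eq_cube)
    finally have le': "of_int \<Delta> \<le> 16 * of_int b ^ 3 * of_int d * ?D" .
    show "of_int \<Delta> * (17 / 16) * (1 / ?D) \<le> 17 * of_int b ^ 3 * of_int d"
    proof -
      have "X * (17 / 16) * (1 / Y) \<le> 17 * B * E" if "X \<le> 16 * B * E * Y" "Y > 0" for X Y B E :: real
        using that by (simp add: pos_divide_le_eq mult_ac)
      then show ?thesis using D le' by blast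
    qed
  qed (use Delta0 D in auto)
  finally show ?thesis using Delta0 D by (simp add: mult_left_mono mult_right_mono)
qed

text \<open>The radius is half the distance to the nearest node: from a this is 0 or b, from b it is
  a. Only these two coefficients are bounded, since the number 1 is approximated without
  error.\<close>

lemma coef_le:
  assumes "k \<ge> 1" "shape k p q r"
  shows "\<bar>of_int \<Delta> ^ k * coef k a 0 b p q r\<bar> \<le> (17 * of_int b ^ 3 * of_int d) ^ k"
    "\<bar>of_int \<Delta> ^ k * coef k b 0 a p q r\<bar> \<le> (17 * of_int b ^ 3 * of_int d) ^ k"
proof -
  define \<alpha> \<beta> where "\<alpha> = real_of_int a" and "\<beta> = real_of_int b"
  have \<alpha>\<beta>: "0 < \<alpha>" "\<alpha> < \<beta>" using a ab by (auto simp: \<alpha>_def \<beta>_def)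
  define y where "y = (\<beta> - \<alpha>) / 2"
  have y: "\<beta> - \<alpha> = 2 * y" "\<bar>\<alpha> - \<beta>\<bar> = 2 * y" "\<bar>\<beta> - \<alpha>\<bar> = 2 * y" "\<bar>\<alpha> - 0\<bar> = \<alpha>" "\<bar>\<beta> - 0\<bar> = \<beta>" "0 < y"
    using \<alpha>\<beta> by (auto simp: y_def)
  show "\<bar>of_int \<Delta> ^ k * coef k a 0 b p q r\<bar> \<le> (17 * of_int b ^ 3 * of_int d) ^ k"
  proof (cases "2 * \<alpha> \<le> \<beta>")
    case True
    have "(\<beta> - \<alpha>) ^ 2 \<le> \<beta> * (\<beta> - 3/2 * \<alpha>)"
      using mult_left_mono[OF True, of \<alpha>] \<alpha>\<beta> by (simp add: power2_eq_square algebra_simps)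
    then have "\<alpha> ^ 2 * (\<beta> - \<alpha>) ^ 2 \<le> \<alpha> ^ 2 * (\<beta> * (\<beta> - 3/2 * \<alpha>))" by (rule mult_left_mono) simp
    also have "\<dots> = 4 * \<beta> * ((\<alpha> / 2) * (\<bar>\<alpha> - 0\<bar> - \<alpha> / 2) * (\<bar>\<alpha> - \<beta>\<bar> - \<alpha> / 2))"
      using \<alpha>\<beta> by (simp add: power2_eq_square algebra_simps)
    finally show ?thesis
      by (intro coef_le_aux[where \<tau> = "\<alpha> / 2"]) (use assms \<alpha>\<beta> True a ab in \<open>auto simp: \<alpha>_def \<beta>_def\<close>)
  next
    case False
    have "0 \<le> (2 * \<alpha> - \<beta>) * (\<beta> - \<alpha>)" using False \<alpha>\<beta> by (intro mult_nonneg_nonneg) auto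
    moreover have "\<beta> * (\<alpha> - y) - \<alpha> ^ 2 = (2 * \<alpha> - \<beta>) * (\<beta> - \<alpha>) / 2"
      by (simp add: y_def power2_eq_square field_simps)
    ultimately have "\<alpha> ^ 2 \<le> \<beta> * (\<alpha> - y)" by linarith
    then have "\<alpha> ^ 2 * (\<beta> - \<alpha>) ^ 2 \<le> (\<beta> * (\<alpha> - y)) * (\<beta> - \<alpha>) ^ 2" by (rule mult_right_mono) simp
    also have "\<dots> = 4 * \<beta> * (y * (\<bar>\<alpha> - 0\<bar> - y) * (\<bar>\<alpha> - \<beta>\<bar> - y))"
      unfolding y using y(6) by (simp add: power2_eq_square)
    finally show ?thesis
      by (intro coef_le_aux[where \<tau> = y]) (use assms \<alpha>\<beta> y False a ab in \<open>auto simp: \<alpha>_def \<beta>_def\<close>)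
  qed
  have "\<alpha> ^ 2 \<le> \<beta> * (\<beta> - y)"
    unfolding power2_eq_square by (rule mult_mono) (use \<alpha>\<beta> y in auto)
  then have "\<alpha> ^ 2 * (\<beta> - \<alpha>) ^ 2 \<le> (\<beta> * (\<beta> - y)) * (\<beta> - \<alpha>) ^ 2" by (rule mult_right_mono) simp
  also have "\<dots> = 4 * \<beta> * (y * (\<bar>\<beta> - 0\<bar> - y) * (\<bar>\<beta> - \<alpha>\<bar> - y))"
    unfolding y using y(6) by (simp add: power2_eq_square)
  finally show "\<bar>of_int \<Delta> ^ k * coef k b 0 a p q r\<bar> \<le> (17 * of_int b ^ 3 * of_int d) ^ k"
    by (intro coef_le_aux[where \<tau> = y]) (use assms \<alpha>\<beta> y a ab in \<open>auto simp: \<alpha>_def \<beta>_def\<close>)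
qed

definition approx_form :: "nat \<Rightarrow> nat \<Rightarrow> nat \<Rightarrow> nat \<Rightarrow> real \<Rightarrow> real \<Rightarrow> real \<Rightarrow> real" where
  "approx_form k p q r y0 y1 y2 =
     of_int \<Delta> ^ k * dd 0 (of_int a) (of_int b) (fps_const y0 * jet k x 0) (fps_const y1 * jet k x (of_int a))
       (fps_const y2 * jet k x (of_int b)) p q r"

lemma shape_sym: "shape k p q r \<Longrightarrow> shape k q p r" "shape k p q r \<Longrightarrow> shape k r p q"
  by (auto simp: shape_def)

lemma approx_form_eq:
  "approx_form k p q r y0 y1 y2 = (of_int \<Delta> ^ k * coef k 0 a b p q r) * y0
     + (of_int \<Delta> ^ k * coef k a 0 b q p r) * y1 + (of_int \<Delta> ^ k * coef k b 0 a r p q) * y2"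
  by (simp add: approx_form_def dd_def coef_def mult.assoc local_res_const_mult distrib_left mult.commute[of _ y0]
      mult.commute[of _ y1] mult.commute[of _ y2] mult.left_commute[of _ y0] mult.left_commute[of _ y1] mult.left_commute[of _ y2])

text \<open>Here \<Delta> x^3 = 4 (b - a)^2 / (a b d^2) and (16/27) (100/99)^3 < 5/8, where 100/99
  bounds 1 / (1 - x u) for x u at most 1/100.\<close>

lemma approx_form_theta_le:
  assumes k: "k \<ge> 1" and "shape k p q r"
  shows "\<bar>approx_form k p q r 1 (sqrt (1 + x * of_int a)) (sqrt (1 + x * of_int b))\<bar>
    \<le> 27/64 * (5 * of_int b / (8 * of_int a * of_int d ^ 2)) ^ k"
proof -
  define \<alpha> \<beta> \<delta> where "\<alpha> = real_of_int a" and "\<beta> = real_of_int b" and "\<delta> = real_of_int d"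
  have \<alpha>\<beta>: "1 \<le> \<alpha>" "\<alpha> < \<beta>" "\<delta> \<ge> 100" using a ab d by (auto simp: \<alpha>_def \<beta>_def \<delta>_def)
  have Nr: "real_of_int N = \<alpha> * \<beta> * \<delta>" by (simp add: N_def \<alpha>_def \<beta>_def \<delta>_def)
  have x0: "x > 0" using N_pos by simp
  have "x * \<beta> = 1 / (\<alpha> * \<delta>)" using \<alpha>\<beta> by (simp add: Nr)
  also have "\<dots> \<le> 1 / (1 * 100)" using \<alpha>\<beta> by (intro divide_left_mono mult_mono) auto
  finally have xb: "x * \<beta> \<le> 1 / 100" by simp
  have xa: "x * \<alpha> \<le> 1 / 100" using xb \<alpha>\<beta> x0 by (smt (verit) mult_left_mono)
  have Delta: "real_of_int \<Delta> = 4 * \<alpha> ^ 2 * \<beta> ^ 2 * \<delta> * (\<beta> - \<alpha>) ^ 2"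
    by (simp add: \<Delta>_def N_def \<alpha>_def \<beta>_def \<delta>_def power2_eq_square)
  have sum: "p + q + r = Suc (3 * k)" and qr: "q + r \<le> 3 * k" using assms by (auto simp: shape_def)
  let ?\<theta> = "dd 0 (of_int a) (of_int b) (fps_const (sqrt (1 + x * 0)) * jet k x 0) (fps_const (sqrt (1 + x * of_int a)) * jet k x (of_int a))
       (fps_const (sqrt (1 + x * of_int b)) * jet k x (of_int b)) p q r"
  have "\<bar>?\<theta>\<bar> \<le> \<bar>hc k (3 * k)\<bar> * x ^ (3 * k) *
      ((1 / (1 - x * 0)) ^ p * (1 / (1 - x * of_int a)) ^ q * (1 / (1 - x * of_int b)) ^ r)"
    by (rule dd_jet_bound) (use a ab N_pos sum xa xb in \<open>auto simp: \<alpha>_def \<beta>_def\<close>)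
  also have "\<dots> \<le> (27/64 * (4/27) ^ k) * x ^ (3 * k) * (100 / 99) ^ (3 * k)"
  proof (intro mult_mono)
    have "(1 / (1 - x * 0)) ^ p * (1 / (1 - x * of_int a)) ^ q * (1 / (1 - x * of_int b)) ^ r
       \<le> 1 * (100 / 99) ^ q * (100 / 99) ^ r"
    proof -
      have "0 \<le> 1 / (1 - y) \<and> 1 / (1 - y) \<le> 100 / 99" if "y \<le> 1 / 100" for y :: real
        using that by (simp add: field_simps)
      then have "0 \<le> 1 / (1 - x * \<alpha>) \<and> 1 / (1 - x * \<alpha>) \<le> 100 / 99" "0 \<le> 1 / (1 - x * \<beta>) \<and> 1 / (1 - x * \<beta>) \<le> 100 / 99"
        using xa xb by blast+
      moreover have "1 * u ^ q * v ^ r \<le> 1 * (100 / 99) ^ q * (100 / 99) ^ r"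
        if "0 \<le> u \<and> u \<le> 100 / 99" "0 \<le> v \<and> v \<le> 100 / 99" for u v :: real
        using that by (intro mult_mono power_mono) auto
      moreover have "(1 / (1 - x * 0)) ^ p = 1" by simp
      ultimately show ?thesis unfolding \<alpha>_def \<beta>_def by metis
    qed
    also have "\<dots> = (100 / 99) ^ (q + r)" by (simp add: power_add)
    also have "\<dots> \<le> (100 / 99) ^ (3 * k)" using qr by (intro power_increasing) auto
    finally show "(1 / (1 - x * 0)) ^ p * (1 / (1 - x * of_int a)) ^ q * (1 / (1 - x * of_int b)) ^ r \<le> (100 / 99) ^ (3 * k)" .
    show "0 \<le> (1 / (1 - x * 0)) ^ p * (1 / (1 - x * of_int a)) ^ q * (1 / (1 - x * of_int b)) ^ r"
    proof -
      have "0 \<le> 1 - x * \<alpha>" "0 \<le> 1 - x * \<beta>" using xa xb by linarith+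
      then show ?thesis unfolding \<alpha>_def \<beta>_def by (intro mult_nonneg_nonneg zero_le_power divide_nonneg_nonneg) auto
    qed
  qed (use abs_hc_3k_le[OF k] x0 in auto)
  also have "\<dots> = 27/64 * (4/27 * x ^ 3 * (100/99) ^ 3) ^ k"
    unfolding power_mult by (simp only: power_mult_distrib mult_ac)
  finally have \<theta>: "\<bar>?\<theta>\<bar> \<le> 27/64 * (4/27 * x ^ 3 * (100/99) ^ 3) ^ k" .
  have Delta0: "real_of_int \<Delta> \<ge> 0" unfolding Delta using \<alpha>\<beta> by simp
  have "\<bar>approx_form k p q r 1 (sqrt (1 + x * of_int a)) (sqrt (1 + x * of_int b))\<bar> = of_int \<Delta> ^ k * \<bar>?\<theta>\<bar>"
    using Delta0 by (simp add: approx_form_def abs_mult)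
  also have "\<dots> \<le> of_int \<Delta> ^ k * (27/64 * (4/27 * x ^ 3 * (100/99) ^ 3) ^ k)"
    by (rule mult_left_mono[OF \<theta>]) (use Delta0 in simp)
  also have "\<dots> = 27/64 * (of_int \<Delta> * (4/27 * x ^ 3 * (100/99) ^ 3)) ^ k"
    by (simp only: power_mult_distrib mult_ac)
  also have "\<dots> \<le> 27/64 * (5 * of_int b / (8 * of_int a * of_int d ^ 2)) ^ k"
  proof (intro mult_left_mono power_mono)
    have "of_int \<Delta> * (4/27 * x ^ 3 * (100/99) ^ 3) = (16/27 * (100/99) ^ 3) * ((\<beta> - \<alpha>) ^ 2 / (\<alpha> * \<beta> * \<delta> ^ 2))"
      unfolding Delta Nr using \<alpha>\<beta> by (simp add: power2_eq_square power3_eq_cube field_simps)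
    also have "\<dots> \<le> 5/8 * (\<beta> ^ 2 / (\<alpha> * \<beta> * \<delta> ^ 2))"
    proof (intro mult_mono divide_right_mono power_mono)
      show "16 / 27 * (100 / 99) ^ 3 \<le> (5 / 8 :: real)" by (simp add: power3_eq_cube)
    qed (use \<alpha>\<beta> in auto)
    also have "\<dots> = 5 * of_int b / (8 * of_int a * of_int d ^ 2)"
      using \<alpha>\<beta> by (simp add: \<alpha>_def \<beta>_def \<delta>_def power2_eq_square)
    finally show "of_int \<Delta> * (4/27 * x ^ 3 * (100/99) ^ 3) \<le> 5 * of_int b / (8 * of_int a * of_int d ^ 2)" .
  qed (use Delta0 x0 in auto)
  finally show ?thesis .
qed

text \<open>Some admissible form takes a nonzero integer value at (q0, q1, q2). Subtracting q0 times
  its tiny value at the true square roots leaves the approximation errors, weighted by the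
  coefficients.\<close>

lemma approximation_inequality:
  fixes q0 q1 q2 :: int
  assumes k: "k \<ge> 1" and q0: "q0 > 0"
  shows "1 \<le> 27/64 * of_int q0 * (5 * of_int b / (8 * of_int a * of_int d ^ 2)) ^ k
    + (17 * of_int b ^ 3 * of_int d) ^ k
      * (\<bar>of_int q1 - of_int q0 * sqrt (1 + x * of_int a)\<bar> + \<bar>of_int q2 - of_int q0 * sqrt (1 + x * of_int b)\<bar>)"
proof -
  define \<theta>1 \<theta>2 where "\<theta>1 = sqrt (1 + x * of_int a)" and "\<theta>2 = sqrt (1 + x * of_int b)"
  have Delta0: "real_of_int \<Delta> \<noteq> 0" using a ab d N_pos by (simp add: \<Delta>_def)
  have "\<exists>p q r. shape k p q r \<and> approx_form k p q r (of_int q0) (of_int q1) (of_int q2) \<noteq> 0"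
  proof (rule ccontr)
    assume "\<not> ?thesis"
    then have z: "approx_form k p q r (of_int q0) (of_int q1) (of_int q2) = 0" if "shape k p q r" for p q r
      using that by blast
    have "real_of_int q0 = 0 \<and> real_of_int q1 = 0 \<and> real_of_int q2 = 0"
    proof (rule dd_nonvanishing[where \<alpha> = 0 and \<beta> = "real_of_int a" and \<gamma> = "real_of_int b" and x = x and k = k])
      have pos: "x * real_of_int a > 0" "x * real_of_int b > 0" using a ab N_pos by simp_all
      show "1 + x * of_int a \<noteq> 0" "1 + x * of_int b \<noteq> 0" using pos by linarith+
    qed (use z[of "Suc k" k k] z[of k "Suc k" k] z[of k k "Suc k"] a ab N_pos Delta0 in
          \<open>auto simp: approx_form_def shape_def\<close>)
    then show False using q0 by simp
  qed
  then obtain p q r where pqr: "shape k p q r"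
    and nz: "approx_form k p q r (of_int q0) (of_int q1) (of_int q2) \<noteq> 0" by blast
  define A B C where "A = of_int \<Delta> ^ k * coef k 0 a b p q r" and "B = of_int \<Delta> ^ k * coef k a 0 b q p r"
    and "C = of_int \<Delta> ^ k * coef k b 0 a r p q"
  have ints: "A \<in> \<int>" "B \<in> \<int>" "C \<in> \<int>"
    unfolding A_def B_def C_def using coef_int[OF k] pqr shape_sym by blast+
  have le: "\<bar>B\<bar> \<le> (17 * of_int b ^ 3 * of_int d) ^ k" "\<bar>C\<bar> \<le> (17 * of_int b ^ 3 * of_int d) ^ k"
    unfolding B_def C_def using coef_le[OF k] pqr shape_sym by blast+
  have "A * of_int q0 + B * of_int q1 + C * of_int q2 \<in> \<int>" using ints by simp
  moreover have "A * of_int q0 + B * of_int q1 + C * of_int q2 \<noteq> 0"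
    using nz by (simp add: approx_form_eq A_def B_def C_def)
  ultimately have "1 \<le> \<bar>A * of_int q0 + B * of_int q1 + C * of_int q2\<bar>"
    by (rule Ints_nonzero_abs_ge1)
  also have "A * of_int q0 + B * of_int q1 + C * of_int q2 = of_int q0 * (A * 1 + B * \<theta>1 + C * \<theta>2)
      + (B * (of_int q1 - of_int q0 * \<theta>1) + C * (of_int q2 - of_int q0 * \<theta>2))"
    by (simp add: algebra_simps)
  also have "\<bar>\<dots>\<bar> \<le> \<bar>of_int q0 * (A * 1 + B * \<theta>1 + C * \<theta>2)\<bar>
      + (\<bar>B * (of_int q1 - of_int q0 * \<theta>1)\<bar> + \<bar>C * (of_int q2 - of_int q0 * \<theta>2)\<bar>)"
    by linarith
  also have "\<bar>of_int q0 * (A * 1 + B * \<theta>1 + C * \<theta>2)\<bar> \<le> of_int q0 * (27/64 * (5 * of_int b / (8 * of_int a * of_int d ^ 2)) ^ k)"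
    using approx_form_theta_le[OF k pqr] q0
    unfolding approx_form_eq A_def[symmetric] B_def[symmetric] C_def[symmetric] \<theta>1_def[symmetric] \<theta>2_def[symmetric] abs_mult
    by (intro mult_mono) auto
  also have "\<bar>B * (of_int q1 - of_int q0 * \<theta>1)\<bar> + \<bar>C * (of_int q2 - of_int q0 * \<theta>2)\<bar>
     \<le> (17 * of_int b ^ 3 * of_int d) ^ k * (\<bar>of_int q1 - of_int q0 * \<theta>1\<bar> + \<bar>of_int q2 - of_int q0 * \<theta>2\<bar>)"
    unfolding abs_mult distrib_left by (intro add_mono mult_right_mono le) auto
  finally show ?thesis by (simp add: \<theta>1_def \<theta>2_def mult_ac)
qed

end

section \<open>Upper bound for z\<close>

lemma theta_error:
  fixes g h D u w z :: real
  assumes "0 < g" "g < D" "0 < h" "u \<ge> 0" "w > 0" "z > 0"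
    and u: "u ^ 2 = g * D + 1" and w: "w ^ 2 = g * e + 1" and z: "z ^ 2 = D * e + 1"
  shows "\<bar>h * u * w - h * g * z * sqrt (1 + 1 / (g * D))\<bar> \<le> (h * D + h / (2 * g)) / (2 * z)"
proof -
  define R where "R = sqrt (g * D)"
  have R: "R > 0" "R ^ 2 = g * D" using assms by (auto simp: R_def)
  have eq: "1 + 1 / (g * D) = u ^ 2 / R ^ 2" using assms R by (simp add: u field_simps)
  have sq: "sqrt (1 + 1 / (g * D)) = u / R"
    unfolding eq real_sqrt_divide real_sqrt_abs using R(1) assms(4) by simp
  \<comment> \<open>Chosen so that the error is h u (w - v): v^2 = g e + g / D and w^2 = g e + 1
    differ by less than 1, hence w - v is at most 1 / (2 v).\<close>
  define v where "v = g * z / R"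
  have v: "v > 0" using assms R by (simp add: v_def)
  have "v ^ 2 = g ^ 2 * z ^ 2 / R ^ 2" by (simp add: v_def power_mult_distrib power_divide)
  also have "\<dots> = g * e + g / D"
    unfolding z R(2) using assms(1,2) by (simp add: field_simps power2_eq_square)
  finally have "v ^ 2 = g * e + g / D" .
  then have wv: "(w - v) * (w + v) = 1 - g / D" using w by (simp add: power2_eq_square algebra_simps)
  have gD: "0 \<le> 1 - g / D" "1 - g / D \<le> 1" using assms by auto
  have "w + v > 0" using assms v by simp
  then have "w - v = (1 - g / D) / (w + v)" using wv by (simp add: field_simps)
  then have "w - v \<ge> 0" using gD \<open>w + v > 0\<close> by simp
  have "(w - v) * (2 * v) \<le> (w - v) * (w + v)" using \<open>w - v \<ge> 0\<close> by (intro mult_left_mono) auto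
  also have "\<dots> \<le> 1" using wv gD by simp
  finally have wv2: "w - v \<le> 1 / (2 * v)" using v by (simp add: field_simps)
  have "h * u * w - h * g * z * sqrt (1 + 1 / (g * D)) = h * u * (w - v)"
    unfolding sq v_def by (simp add: algebra_simps)
  then have "\<bar>h * u * w - h * g * z * sqrt (1 + 1 / (g * D))\<bar> = h * u * (w - v)"
    using \<open>w - v \<ge> 0\<close> assms by simp
  also have "\<dots> \<le> h * u * (1 / (2 * v))"
    by (rule mult_left_mono[OF wv2]) (use assms in auto)
  also have "\<dots> = h * (u * R) / (2 * g * z)" using R by (simp add: v_def)
  also have "\<dots> \<le> h * (g * D + 1 / 2) / (2 * g * z)"
  proof (intro divide_right_mono mult_left_mono)
    have "0 \<le> (u - R) ^ 2" by simp
    then have "2 * (u * R) \<le> u ^ 2 + R ^ 2" by (simp add: power2_eq_square algebra_simps)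
    then show "u * R \<le> g * D + 1 / 2" unfolding u R(2) by linarith
  qed (use assms in auto)
  also have "\<dots> = (h * D + h / (2 * g)) / (2 * z)" using assms by (simp add: field_simps)
  finally show ?thesis .
qed

context approximants
begin

text \<open>The approximations are a t y / (a b z) and b s x' / (a b z). Under \<open>small\<close>
  the first term of \<open>approximation_inequality\<close> is at most 27/64, so the second one is
  at least 37/64.\<close>

lemma extension_bound_step:
  fixes e s t x' y z :: int
  assumes "b < d" "0 \<le> s" "0 \<le> t" "0 < x'" "0 < y" "0 < z"
    and s: "s ^ 2 = a * d + 1" and t: "t ^ 2 = b * d + 1"
    and x': "x' ^ 2 = a * e + 1" and y: "y ^ 2 = b * e + 1" and z: "z ^ 2 = d * e + 1"
    and k: "k \<ge> 1" and small: "of_int (a * b * z) < (8 * real_of_int a * of_int d ^ 2 / (5 * of_int b)) ^ k"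
  shows "real_of_int z \<le> 2 * of_int b * of_int d * (17 * of_int b ^ 3 * of_int d) ^ k"
proof -
  define A B D Z E where "A = real_of_int a" and "B = real_of_int b" and "D = real_of_int d" and "Z = real_of_int z"
    and "E = real_of_int e"
  have pos: "1 \<le> A" "A + 1 \<le> B" "B < D" "Z > 0" using assms(1,6) a ab by (auto simp: A_def B_def D_def Z_def)
  define p where "p = 17 * B ^ 3 * D"
  have sr: "real_of_int s ^ 2 = A * D + 1" "real_of_int t ^ 2 = B * D + 1" "real_of_int x' ^ 2 = A * E + 1"
    "real_of_int y ^ 2 = B * E + 1" "Z ^ 2 = D * E + 1"
    using s t x' y z by (simp_all add: A_def B_def D_def E_def Z_def flip: of_int_power)
  have xa: "x * A = 1 / (B * D)" "x * B = 1 / (A * D)"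
    using pos by (simp_all add: N_def A_def B_def D_def)
  have e1: "\<bar>of_int (a * t * y) - of_int (a * b * z) * sqrt (1 + x * A)\<bar> \<le> (A * D + A / (2 * B)) / (2 * Z)"
    using theta_error[of B D A "real_of_int t" "real_of_int y" Z E] pos sr assms
    unfolding xa by (simp add: A_def B_def Z_def)
  have e2: "\<bar>of_int (b * s * x') - of_int (a * b * z) * sqrt (1 + x * B)\<bar> \<le> (B * D + B / (2 * A)) / (2 * Z)"
    using theta_error[of A D B "real_of_int s" "real_of_int x'" Z E] pos sr assms
    unfolding xa by (simp add: A_def B_def Z_def mult_ac)
  have "A / (2 * B) \<le> 1 / 2" using pos by (simp add: field_simps)
  moreover have "B / (2 * A) \<le> B / (2 * 1)" using pos by (intro divide_left_mono) auto
  moreover have "(A + 1) * D \<le> B * D" using pos by (intro mult_right_mono) auto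
  moreover have "1 \<le> D" "B \<le> D" using pos by simp_all
  ultimately have "A * D + A / (2 * B) + (B * D + B / (2 * A)) \<le> 2 * (B * D)"
    by (simp add: distrib_right)
  then have "(A * D + A / (2 * B)) / (2 * Z) + (B * D + B / (2 * A)) / (2 * Z) \<le> 2 * (B * D) / (2 * Z)"
    unfolding add_divide_distrib[symmetric] using pos by (intro divide_right_mono) auto
  then have err: "\<bar>of_int (a * t * y) - of_int (a * b * z) * sqrt (1 + x * A)\<bar>
     + \<bar>of_int (b * s * x') - of_int (a * b * z) * sqrt (1 + x * B)\<bar> \<le> B * D / Z"
    using e1 e2 by simp
  have q: "0 < a * b * z" using a ab assms by simp
  have "1 \<le> 27/64 * of_int (a * b * z) * (5 * B / (8 * A * D ^ 2)) ^ k + p ^ k * (B * D / Z)"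
  proof -
    have "p ^ k * (\<bar>of_int (a * t * y) - of_int (a * b * z) * sqrt (1 + x * A)\<bar>
     + \<bar>of_int (b * s * x') - of_int (a * b * z) * sqrt (1 + x * B)\<bar>) \<le> p ^ k * (B * D / Z)"
      by (rule mult_left_mono[OF err]) (use pos in \<open>simp add: p_def\<close>)
    then show ?thesis
      using approximation_inequality[OF k q, of "a * t * y" "b * s * x'"]
      unfolding p_def A_def B_def D_def by linarith
  qed
  moreover have "of_int (a * b * z) * (5 * B / (8 * A * D ^ 2)) ^ k \<le> 1"
  proof -
    have "(5 * B / (8 * A * D ^ 2)) ^ k = 1 / (8 * A * D ^ 2 / (5 * B)) ^ k"
      by (simp add: power_divide)
    moreover have "(8 * A * D ^ 2 / (5 * B)) ^ k > 0" using pos by simp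
    moreover have "c * (1 / P) \<le> 1" if "c < P" "P > 0" for c P :: real
      using that by (simp add: field_simps)
    ultimately show ?thesis using small unfolding A_def B_def D_def by metis
  qed
  ultimately have "37 / 64 \<le> p ^ k * (B * D / Z)" by linarith
  then have "37 / 64 * Z \<le> p ^ k * (B * D)" using pos by (simp add: field_simps)
  moreover have "0 \<le> p ^ k * (B * D)" using pos by (simp add: p_def)
  ultimately have "Z \<le> 2 * (p ^ k * (B * D))" by linarith
  then have "Z \<le> 2 * B * D * p ^ k" by (simp only: mult_ac)
  then show ?thesis by (simp add: p_def B_def D_def Z_def)
qed

text \<open>Take the least k with a b z < \<Lambda>^k. Minimality and the step lemma give (\<Lambda>
  / p)^k \<le> R, and the last hypothesis says p \<le> (\<Lambda> / p)^\<sigma>, so p^k \<le>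
  R^\<sigma>. The integer \<sigma> stands in for log p / log (\<Lambda> / p).\<close>

lemma extension_bound:
  fixes e s t x' y z :: int
  assumes "b < d" "0 \<le> s" "0 \<le> t" "0 < x'" "0 < y" "0 < z"
    and "s ^ 2 = a * d + 1" and "t ^ 2 = b * d + 1"
    and "x' ^ 2 = a * e + 1" and "y ^ 2 = b * e + 1" and "z ^ 2 = d * e + 1"
    and \<sigma>: "17 * b ^ 3 * d * (85 * b ^ 4) ^ \<sigma> \<le> (8 * a * d) ^ \<sigma>"
  shows "z * 5 ^ \<sigma> \<le> 2 * b * d * (16 * a ^ 2 * b * d ^ 3) ^ \<sigma>"
proof -
  define A B D Z where "A = real_of_int a" and "B = real_of_int b" and "D = real_of_int d" and "Z = real_of_int z"
  have pos: "1 \<le> A" "A + 1 \<le> B" "B < D" "1 \<le> Z" using assms(1,6) a ab by (auto simp: A_def B_def D_def Z_def)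
  define \<Lambda> p where "\<Lambda> = 8 * A * D ^ 2 / (5 * B)" and "p = 17 * B ^ 3 * D"
  define R where "R = 16 / 5 * A ^ 2 * B * D ^ 3"
  have p0: "p > 0" "\<Lambda> > 0" using pos by (auto simp: p_def \<Lambda>_def)
  have L1: "\<Lambda> > 1"
  proof -
    have "1 * D \<le> D * D" "1 * (D * D) \<le> A * (D * D)"
      using pos by (intro mult_right_mono; simp)+
    then have "5 * B < 8 * (A * (D * D))" using pos by linarith
    then have "5 * B < 8 * A * D ^ 2" by (simp add: power2_eq_square)
    then show ?thesis using pos by (simp add: \<Lambda>_def)
  qed
  define q where "q = of_int (a * b * z) * (1 :: real)"
  have q: "q = A * B * Z" "q \<ge> 1"
  proof -
    show "q = A * B * Z" by (simp add: q_def A_def B_def Z_def)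
    have "0 < a * b * z" using a ab assms by simp
    then show "q \<ge> 1" by (simp add: q_def flip: of_int_mult)
  qed
  obtain n where "q < \<Lambda> ^ n" using real_arch_pow[OF L1] by blast
  define k where "k = (LEAST n. q < \<Lambda> ^ n)"
  have k1: "q < \<Lambda> ^ k" unfolding k_def by (rule LeastI) fact
  have "k \<noteq> 0" using k1 q(2) by (auto intro!: Nat.gr0I)
  then obtain j where j: "k = Suc j" by (cases k) auto
  have k2: "\<Lambda> ^ j \<le> q" using not_less_Least[of j "\<lambda>n. q < \<Lambda> ^ n"] j k_def by simp
  have Z: "Z \<le> 2 * B * D * p ^ k"
    unfolding B_def D_def p_def Z_def
    by (rule extension_bound_step[OF assms(1-11)]) (use k1 j in \<open>auto simp: q_def \<Lambda>_def A_def B_def D_def\<close>)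
  have "\<Lambda> ^ k \<le> \<Lambda> * (A * B * Z)" using k2 p0 q(1) j by simp
  also have "\<dots> \<le> \<Lambda> * (A * B * (2 * B * D * p ^ k))"
    using Z p0 pos by (intro mult_left_mono) auto
  also have "\<dots> = R * p ^ k" using pos by (simp add: \<Lambda>_def R_def power2_eq_square power3_eq_cube)
  finally have "(\<Lambda> / p) ^ k \<le> R" using p0 by (simp add: power_divide pos_divide_le_eq)
  have "p \<le> (\<Lambda> / p) ^ \<sigma>"
  proof -
    have "real_of_int (17 * b ^ 3 * d * (85 * b ^ 4) ^ \<sigma>) \<le> real_of_int ((8 * a * d) ^ \<sigma>)"
      using \<sigma> by (simp only: of_int_le_iff)
    then have "p * (85 * B ^ 4) ^ \<sigma> \<le> (8 * A * D) ^ \<sigma>" by (simp add: p_def A_def B_def D_def)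
    then have "p \<le> (8 * A * D / (85 * B ^ 4)) ^ \<sigma>"
      using pos by (simp add: power_divide pos_le_divide_eq)
    also have "8 * A * D / (85 * B ^ 4) = \<Lambda> / p"
      using pos by (simp add: \<Lambda>_def p_def field_simps power2_eq_square power3_eq_cube power4_eq_xxxx)
    finally show ?thesis .
  qed
  then have "p ^ k \<le> ((\<Lambda> / p) ^ \<sigma>) ^ k" using p0 by (intro power_mono) auto
  also have "\<dots> = ((\<Lambda> / p) ^ k) ^ \<sigma>" by (simp only: power_mult[symmetric] mult.commute)
  also have "\<dots> \<le> R ^ \<sigma>" using p0 \<open>(\<Lambda> / p) ^ k \<le> R\<close> by (intro power_mono) auto
  finally have "2 * B * D * p ^ k \<le> 2 * B * D * R ^ \<sigma>" using pos by (intro mult_left_mono) auto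
  with Z have "Z * 5 ^ \<sigma> \<le> 2 * B * D * R ^ \<sigma> * 5 ^ \<sigma>" by simp
  also have "\<dots> = 2 * B * D * (R * 5) ^ \<sigma>" by (simp only: power_mult_distrib mult_ac)
  also have "R * 5 = 16 * A ^ 2 * B * D ^ 3" by (simp add: R_def)
  finally have "real_of_int (z * 5 ^ \<sigma>) \<le> real_of_int (2 * b * d * (16 * a ^ 2 * b * d ^ 3) ^ \<sigma>)"
    by (simp add: A_def B_def D_def Z_def)
  then show ?thesis by (simp only: of_int_le_iff)
qed

end

section \<open>Pell sequences\<close>

text \<open>Each step multiplies z sqrt a + x sqrt C by (s + sqrt (a C))^2. As 2 s^2 - 1 = 2 a C +
  1, the residue of z modulo 2 C never changes.\<close>

primrec pell :: "int \<Rightarrow> int \<Rightarrow> int \<Rightarrow> int \<Rightarrow> int \<Rightarrow> nat \<Rightarrow> int \<times> int" where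
  "pell a C s z x 0 = (z, x)"
| "pell a C s z x (Suc m) =
     ((2 * s ^ 2 - 1) * fst (pell a C s z x m) + 2 * s * C * snd (pell a C s z x m),
      (2 * s ^ 2 - 1) * snd (pell a C s z x m) + 2 * s * a * fst (pell a C s z x m))"

lemma add_pos_of_square_less:
  fixes u v :: int
  assumes "0 < u" "v ^ 2 < u ^ 2"
  shows "0 < u + v" "0 < u - v"
proof -
  have "v < u" by (rule power2_less_imp_less) (use assms in auto)
  moreover have "- v < u" by (rule power2_less_imp_less) (use assms in auto)
  ultimately show "0 < u + v" "0 < u - v" by simp_all
qed

locale pell_seq =
  fixes a C s z0 x0 :: int
  assumes a: "0 < a" and aC: "a < C" and s: "s ^ 2 = a * C + 1" and s0: "0 < s"
    and norm0: "C * x0 ^ 2 - a * z0 ^ 2 = C - a" and x0: "0 < x0"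
begin

definition Z :: "nat \<Rightarrow> int" where "Z m = fst (pell a C s z0 x0 m)"
definition X :: "nat \<Rightarrow> int" where "X m = snd (pell a C s z0 x0 m)"
text \<open>The first increment of Z divided by 2 C. Two sequences with the same start that meet at
  index 1 share it, and then \<open>common_F\<close> determines it.\<close>

definition F :: int where "F = s * x0 + a * z0"

lemma Z_0 [simp]: "Z 0 = z0" and X_0 [simp]: "X 0 = x0"
  by (simp_all add: Z_def X_def)

lemma Z_Suc: "Z (Suc m) = Z m + 2 * C * (a * Z m + s * X m)"
  by (simp add: Z_def X_def s algebra_simps)

lemma X_Suc: "X (Suc m) = X m + 2 * a * C * X m + 2 * s * a * Z m"
  by (simp add: Z_def X_def s algebra_simps)

lemma norm: "C * X m ^ 2 - a * Z m ^ 2 = C - a"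
proof (induction m)
  case (Suc m)
  have "C * (x + 2 * a * C * x + 2 * s * a * z) ^ 2 - a * (z + 2 * C * (a * z + s * x)) ^ 2
      = (C * x ^ 2 - a * z ^ 2) * ((1 + 2 * a * C) ^ 2 - 4 * a * C * s ^ 2)" for x z
    by (simp add: power2_eq_square algebra_simps)
  moreover have "(1 + 2 * a * C) ^ 2 - 4 * a * C * s ^ 2 = 1"
    unfolding s by (simp add: power2_eq_square algebra_simps)
  ultimately show ?case unfolding Z_Suc X_Suc using Suc by simp
qed (simp add: norm0)

lemma sX_sq: "(s * X m) ^ 2 - (a * Z m) ^ 2 = X m ^ 2 + a * C - a ^ 2"
proof -
  have "(s * X m) ^ 2 - (a * Z m) ^ 2 = X m ^ 2 + a * (C * X m ^ 2 - a * Z m ^ 2)"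
    unfolding power_mult_distrib s by (simp add: power2_eq_square algebra_simps)
  then show ?thesis unfolding norm by (simp add: power2_eq_square algebra_simps)
qed

lemma a_sq_less: "a ^ 2 < a * C"
  using a aC by (simp add: power2_eq_square)

lemma X_pos: "0 < X m"
proof (induction m)
  case (Suc m)
  have "((2 * s ^ 2 - 1) * X m) ^ 2 - (2 * s * a * Z m) ^ 2
      = X m ^ 2 + 4 * s ^ 2 * a * (C * X m ^ 2 - a * Z m ^ 2) + 4 * s ^ 2 * (s ^ 2 - 1 - a * C) * X m ^ 2"
    by (simp add: power2_eq_square algebra_simps)
  also have "\<dots> = X m ^ 2 + 4 * s ^ 2 * a * (C - a)" unfolding norm using s by simp
  also have "\<dots> > 0" using Suc a aC s0 by (intro add_pos_pos mult_pos_pos) auto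
  finally have "(2 * s * a * Z m) ^ 2 < ((2 * s ^ 2 - 1) * X m) ^ 2" by simp
  moreover have "0 < s ^ 2" using s0 by simp
  then have "0 < (2 * s ^ 2 - 1) * X m" using Suc by (intro mult_pos_pos) linarith+
  ultimately have "0 < (2 * s ^ 2 - 1) * X m + 2 * s * a * Z m"
    by (intro add_pos_of_square_less)
  then show ?case by (simp add: X_def Z_def)
qed (simp add: x0)

lemma sX_gt: "a * Z m < s * X m" "- (a * Z m) < s * X m"
proof -
  have "(a * Z m) ^ 2 < (s * X m) ^ 2"
    using sX_sq[of m] a_sq_less X_pos[of m] zero_less_power[of "X m" 2] by linarith
  moreover have "0 < s * X m" using s0 X_pos by simp
  ultimately show "a * Z m < s * X m" "- (a * Z m) < s * X m"
    using add_pos_of_square_less[of "s * X m" "a * Z m"] by auto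
qed

lemma F_pos: "1 \<le> F"
  using sX_gt(2)[of 0] by (simp add: F_def)

lemma Z_1: "Z (Suc 0) = z0 + 2 * C * F"
  by (simp add: Z_Suc F_def algebra_simps)

lemma Z_Suc_ge: "0 < Z m \<Longrightarrow> (1 + 4 * a * C) * Z m \<le> Z (Suc m)"
proof -
  have "2 * C * (a * Z m + a * Z m) \<le> 2 * C * (a * Z m + s * X m)"
    using sX_gt(1)[of m] a aC by (intro mult_left_mono) auto
  then show ?thesis unfolding Z_Suc by (simp add: algebra_simps)
qed

text \<open>The squares of s X and a Z differ by X^2 + a C - a^2, and Z^2 > C makes this at most 3
  (a Z)^2. This caps the growth factor at 1 + 6 a C.\<close>

lemma sX_le:
  assumes "0 < Z m" "C < Z m ^ 2"
  shows "s * X m \<le> 2 * a * Z m"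
proof -
  have CX: "C * X m ^ 2 = a * Z m ^ 2 + C - a" using norm[of m] by simp
  have "C * (X m ^ 2 + a * C - a ^ 2) = a * Z m ^ 2 + C - a + a * C * C - a ^ 2 * C"
    unfolding right_diff_distrib distrib_left CX by (simp add: algebra_simps)
  also have "\<dots> \<le> a * Z m ^ 2 + C + a * C * C"
  proof -
    have "0 \<le> a ^ 2 * C" using a aC by (intro mult_nonneg_nonneg) auto
    then show ?thesis using a by linarith
  qed
  also have "\<dots> \<le> a * C * Z m ^ 2 + a * C * Z m ^ 2 + a * C * Z m ^ 2"
  proof (intro add_mono)
    have "0 < a * C" "a * 1 \<le> a * C" using a aC by (simp_all only: mult_pos_pos mult_left_mono)
    then have C1: "1 \<le> a * C" "a \<le> a * C" by linarith+
    show "a * Z m ^ 2 \<le> a * C * Z m ^ 2" using C1 by (intro mult_right_mono) auto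
    have "1 * C \<le> a * C * Z m ^ 2" by (rule mult_mono[OF C1(1)]) (use assms a aC in auto)
    then show "C \<le> a * C * Z m ^ 2" by simp
    show "a * C * C \<le> a * C * Z m ^ 2" using assms a aC by (intro mult_left_mono) auto
  qed
  also have "\<dots> \<le> C * (3 * a ^ 2 * Z m ^ 2)"
  proof -
    have "a * (C * Z m ^ 2) \<le> a * a * (C * Z m ^ 2)" using a aC by (intro mult_right_mono) auto
    then show ?thesis by (simp add: power2_eq_square algebra_simps)
  qed
  finally have "X m ^ 2 + a * C - a ^ 2 \<le> 3 * a ^ 2 * Z m ^ 2" using a aC by simp
  then have "(s * X m) ^ 2 \<le> (2 * a * Z m) ^ 2"
    using sX_sq[of m] by (simp add: power_mult_distrib)
  then show ?thesis by (rule power2_le_imp_le) (use assms a in simp)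
qed

lemma Z_Suc_le:
  assumes "0 < Z m" "C < Z m ^ 2"
  shows "Z (Suc m) \<le> (1 + 6 * a * C) * Z m"
proof -
  have "2 * C * (a * Z m + s * X m) \<le> 2 * C * (a * Z m + 2 * a * Z m)"
    using sX_le[OF assms] a aC by (intro mult_left_mono) auto
  then show ?thesis unfolding Z_Suc by (simp add: algebra_simps)
qed

lemma Z_pos_add:
  assumes "0 < Z j"
  shows "0 < Z (j + m) \<and> (1 + 4 * a * C) ^ m * Z j \<le> Z (j + m)"
proof (induction m)
  case (Suc m)
  then have "0 < Z (j + m)" by simp
  have "(1 + 4 * a * C) * ((1 + 4 * a * C) ^ m * Z j) \<le> (1 + 4 * a * C) * Z (j + m)"
    using Suc a aC by (intro mult_left_mono) auto
  also have "\<dots> \<le> Z (j + Suc m)" using Z_Suc_ge[OF \<open>0 < Z (j + m)\<close>] by simp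
  finally have le: "(1 + 4 * a * C) ^ Suc m * Z j \<le> Z (j + Suc m)" by (simp add: mult_ac)
  have "0 < (1 + 4 * a * C) ^ Suc m * Z j" using assms a aC
    by (intro mult_pos_pos zero_less_power) (auto intro: add_pos_pos)
  with le show ?case by linarith
qed (use assms in simp)

lemma Z_add_le:
  assumes "0 < Z j" "C < Z j ^ 2"
  shows "Z (j + m) \<le> (1 + 6 * a * C) ^ m * Z j"
proof (induction m)
  case (Suc m)
  have "1 * Z j \<le> (1 + 4 * a * C) ^ m * Z j"
    using assms a aC by (intro mult_right_mono one_le_power) auto
  then have ge: "Z j \<le> Z (j + m)" using Z_pos_add[OF assms(1), of m] by simp
  then have "Z j ^ 2 \<le> Z (j + m) ^ 2" using assms by (intro power_mono) auto
  then have "C < Z (j + m) ^ 2" using assms by linarith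
  then have "Z (j + Suc m) \<le> (1 + 6 * a * C) * Z (j + m)"
    using Z_Suc_le[of "j + m"] ge assms by simp
  also have "\<dots> \<le> (1 + 6 * a * C) * ((1 + 6 * a * C) ^ m * Z j)"
    using Suc a aC by (intro mult_left_mono) auto
  finally show ?case by (simp add: mult_ac)
qed simp

lemma Z_1_gt: "- C < z0 \<Longrightarrow> C < Z (Suc 0)"
proof -
  assume "- C < z0"
  have "2 * C * 1 \<le> 2 * C * F" using F_pos a aC by (intro mult_left_mono) auto
  with \<open>- C < z0\<close> show ?thesis unfolding Z_1 by simp
qed

lemma Z_ge:
  assumes "- C < z0"
  shows "(1 + 4 * a * C) ^ m * (C + 1) \<le> Z (Suc m)"
proof -
  have "(1 + 4 * a * C) ^ m * (C + 1) \<le> (1 + 4 * a * C) ^ m * Z (Suc 0)"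
    using Z_1_gt[OF assms] a aC by (intro mult_left_mono) auto
  also have "\<dots> \<le> Z (Suc m)" using Z_pos_add[of "Suc 0" m] Z_1_gt[OF assms] a aC by simp
  finally show ?thesis .
qed

lemma Z_cong: "2 * C dvd Z m - z0"
proof (induction m)
  case (Suc m)
  have "Z (Suc m) - z0 = (Z m - z0) + 2 * C * (a * Z m + s * X m)" by (simp add: Z_Suc)
  then show ?case using Suc by (simp only: dvd_add dvd_triv_left)
qed simp

lemma X_cong: "2 * C dvd X m - (x0 + 2 * s * a * z0 * int m)"
proof (induction m)
  case (Suc m)
  have "X (Suc m) - (x0 + 2 * s * a * z0 * int (Suc m))
      = (X m - (x0 + 2 * s * a * z0 * int m)) + 2 * C * (a * X m) + 2 * s * a * (Z m - z0)"
    by (simp add: X_Suc algebra_simps)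
  then show ?case using Suc dvd_mult[OF Z_cong[of m], of "2 * s * a"] by (simp only: dvd_add dvd_triv_left)
qed simp

text \<open>Modulo 4 C^2 a term is a quadratic polynomial in its index. This is the relation through
  which the indices of two sequences with a common value are compared.\<close>

lemma Z_cong_square: "4 * C ^ 2 dvd Z m - (z0 + 2 * C * (a * z0 * int m ^ 2 + s * x0 * int m))"
proof (induction m)
  case (Suc m)
  obtain k where k: "Z m - z0 = 2 * C * k" using Z_cong[of m] by (auto elim: dvdE)
  obtain l where l: "X m - (x0 + 2 * s * a * z0 * int m) = 2 * C * l" using X_cong[of m] by (auto elim: dvdE)
  have "Z (Suc m) - (z0 + 2 * C * (a * z0 * int (Suc m) ^ 2 + s * x0 * int (Suc m)))
     = (Z m - (z0 + 2 * C * (a * z0 * int m ^ 2 + s * x0 * int m)))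
       + 2 * C * (a * (Z m - z0) + s * (X m - (x0 + 2 * s * a * z0 * int m)) + 2 * (s ^ 2 - 1) * a * z0 * int m)"
    by (simp add: Z_Suc algebra_simps power2_eq_square)
  also have "\<dots> = (Z m - (z0 + 2 * C * (a * z0 * int m ^ 2 + s * x0 * int m)))
       + 4 * C ^ 2 * (a * k + s * l + a * a * z0 * int m)"
    unfolding k l s by (simp add: algebra_simps power2_eq_square)
  finally show ?case using Suc by (simp only: dvd_add dvd_triv_left)
qed simp

end

text \<open>The inverse step is done as two multiplications by s - sqrt (a C), each lowering z. The
  first keeps z positive because z > C; the second may make it negative, but leaves it above
  -C.\<close>

lemma pell_descent:
  assumes "0 < a" "a < C" and s: "s ^ 2 = a * C + 1" "0 < s"
    and "0 < x" "C * x ^ 2 - a * z ^ 2 = C - a" "- C < z"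
  shows "\<exists>m z0 x0. pell_seq a C s z0 x0 \<and> pell a C s z0 x0 m = (z, x) \<and> - C < z0 \<and> z0 \<le> C \<and> 2 * C dvd z - z0"
  using assms(5-7)
proof (induction "nat (z + C)" arbitrary: z x rule: less_induct)
  case less
  show ?case
  proof (cases "z \<le> C")
    case True
    have "pell_seq a C s z x" using less assms by unfold_locales auto
    then show ?thesis using less True by (intro exI[of _ 0] exI[of _ z] exI[of _ x]) auto
  next
    case False
    then have z: "C < z" by simp
    define z1 x1 where "z1 = s * z - C * x" and "x1 = s * x - a * z"
    define z' x' where "z' = s * z1 - C * x1" and "x' = s * x1 - a * z1"
    have n: "C * x ^ 2 = a * z ^ 2 + C - a" using less by simp
    have pos: "0 < C" "0 < z" "0 < x" using assms z less by simp_all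
    have aC0: "0 < a * C" using assms pos by simp
    have zz: "C ^ 2 < z ^ 2" using z pos by (intro power_strict_mono) auto
    have Cx2: "(C * x) ^ 2 = a * C * z ^ 2 + C ^ 2 - a * C"
    proof -
      have "(C * x) ^ 2 = C * (C * x ^ 2)" by (simp add: power2_eq_square)
      then show ?thesis unfolding n by (simp add: power2_eq_square algebra_simps)
    qed
    have "(C * x) ^ 2 < (s * z) ^ 2"
      unfolding power_mult_distrib[of s] Cx2 s(1) distrib_right using zz aC0 by linarith
    then have z1: "0 < z1" using pos s add_pos_of_square_less(2)[of "s * z" "C * x"] by (simp add: z1_def)
    have "(s * x) ^ 2 - (a * z) ^ 2 = x ^ 2 + a * (C * x ^ 2 - a * z ^ 2)"
      unfolding power_mult_distrib s(1) by (simp add: power2_eq_square algebra_simps)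
    also have "\<dots> > 0" unfolding less(3) using assms pos by (intro add_pos_pos) auto
    finally have x1: "0 < x1" using pos s add_pos_of_square_less(2)[of "s * x" "a * z"] by (simp add: x1_def)
    have n1: "C * x1 ^ 2 - a * z1 ^ 2 = C - a"
    proof -
      have "C * x1 ^ 2 - a * z1 ^ 2 = (s ^ 2 - a * C) * (C * x ^ 2 - a * z ^ 2)"
        by (simp add: z1_def x1_def power2_eq_square algebra_simps)
      then show ?thesis using s less by simp
    qed
    have n': "C * x' ^ 2 - a * z' ^ 2 = C - a"
    proof -
      have "C * x' ^ 2 - a * z' ^ 2 = (s ^ 2 - a * C) * (C * x1 ^ 2 - a * z1 ^ 2)"
        by (simp add: z'_def x'_def power2_eq_square algebra_simps)
      then show ?thesis using s n1 by simp
    qed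
    have s2: "2 \<le> s"
    proof (rule ccontr)
      assume "\<not> 2 \<le> s"
      then have "s = 1" using s by simp
      then show False using s assms by simp
    qed
    have "(s * x1) ^ 2 - (a * z1) ^ 2 = x1 ^ 2 + a * (C * x1 ^ 2 - a * z1 ^ 2)"
      unfolding power_mult_distrib s(1) by (simp add: power2_eq_square algebra_simps)
    also have "\<dots> > 0" unfolding n1 using assms x1 by (intro add_pos_pos) auto
    finally have x': "0 < x'" using x1 s add_pos_of_square_less(2)[of "s * x1" "a * z1"] by (simp add: x'_def)
    have lt: "s * u - C * v < u" if "0 < u" "0 < v" "C * v ^ 2 - a * u ^ 2 = C - a" for u v
    proof -
      have v: "C * v ^ 2 = a * u ^ 2 + (C - a)" using that by simp
      have "(C * v) ^ 2 = C * (C * v ^ 2)" by (simp add: power2_eq_square)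
      also have "\<dots> = C * (a * u ^ 2 + (C - a))" unfolding v ..
      also have "\<dots> = (s ^ 2 - 1) * u ^ 2 + C * (C - a)" unfolding s(1) by (simp add: algebra_simps)
      finally have eq: "(C * v) ^ 2 = (s ^ 2 - 1) * u ^ 2 + C * (C - a)" .
      have "(s - 1) ^ 2 \<le> s ^ 2 - 1" using s2 by (simp add: power2_eq_square algebra_simps)
      then have "(s - 1) ^ 2 * u ^ 2 \<le> (s ^ 2 - 1) * u ^ 2" by (rule mult_right_mono) simp
      moreover have "0 < C * (C - a)" using assms pos by simp
      ultimately have "((s - 1) * u) ^ 2 < (C * v) ^ 2" unfolding eq power_mult_distrib[of "s - 1"] by linarith
      then have "0 < C * v - (s - 1) * u" using pos that by (intro add_pos_of_square_less) auto
      then show ?thesis by (simp add: algebra_simps)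
    qed
    have "z1 < z" unfolding z1_def using lt[of z x] pos less by simp
    moreover have "z' < z1" unfolding z'_def using lt[of z1 x1] z1 x1 n1 by simp
    ultimately have "z' < z" by simp
    have "- C < z'"
    proof -
      have v: "C * x1 ^ 2 = a * z1 ^ 2 + (C - a)" using n1 by simp
      have "(C * x1) ^ 2 = C * (C * x1 ^ 2)" by (simp add: power2_eq_square)
      then have eq: "(C * x1) ^ 2 = (s * z1) ^ 2 - z1 ^ 2 + C ^ 2 - a * C"
        unfolding v power_mult_distrib s(1) by (simp add: power2_eq_square algebra_simps)
      moreover have "0 < z1 ^ 2" "0 < a * C" using z1 assms pos by auto
      moreover have "(s * z1) ^ 2 + C ^ 2 \<le> (C + s * z1) ^ 2" using s z1 pos by (simp add: power2_eq_square algebra_simps)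
      ultimately have "(C * x1) ^ 2 < (C + s * z1) ^ 2" by linarith
      then have "0 < C + s * z1 - C * x1" using s z1 pos by (intro add_pos_of_square_less(2)) (auto intro: add_pos_pos)
      then show ?thesis by (simp add: z'_def)
    qed
    have dec: "nat (z' + C) < nat (z + C)" using \<open>z' < z\<close> \<open>- C < z'\<close> by simp
    obtain m z0 x0 where m: "pell_seq a C s z0 x0" "pell a C s z0 x0 m = (z', x')" "- C < z0" "z0 \<le> C" "2 * C dvd z' - z0"
      using less(1)[OF dec x' n' \<open>- C < z'\<close>] by blast
    have unit: "s * s = a * C + 1" using s(1) by (simp add: power2_eq_square)
    have inv: "s * (s * u - C * v) + C * (s * v - a * u) = u" "s * (s * v - a * u) + a * (s * u - C * v) = v" for u v
    proof -
      have "s * (s * u - C * v) + C * (s * v - a * u) = (s * s - a * C) * u"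
        "s * (s * v - a * u) + a * (s * u - C * v) = (s * s - a * C) * v" by (simp_all add: algebra_simps)
      then show "s * (s * u - C * v) + C * (s * v - a * u) = u" "s * (s * v - a * u) + a * (s * u - C * v) = v"
        unfolding unit by simp_all
    qed
    have z1_eq: "s * z' + C * x' = z1" "s * x' + a * z' = x1" unfolding z'_def x'_def by (rule inv)+
    have z_eq: "s * z1 + C * x1 = z" "s * x1 + a * z1 = x" unfolding z1_def x1_def by (rule inv)+
    have step_up: "(2 * s ^ 2 - 1) * z' + 2 * s * C * x' = z" "(2 * s ^ 2 - 1) * x' + 2 * s * a * z' = x"
    proof -
      have ss: "2 * s ^ 2 - 1 = s * s + a * C" using unit by (simp add: power2_eq_square)
      have "(2 * s ^ 2 - 1) * z' + 2 * s * C * x' = s * (s * z' + C * x') + C * (s * x' + a * z')"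
        "(2 * s ^ 2 - 1) * x' + 2 * s * a * z' = s * (s * x' + a * z') + a * (s * z' + C * x')"
        unfolding ss by (simp_all add: algebra_simps)
      then show "(2 * s ^ 2 - 1) * z' + 2 * s * C * x' = z" "(2 * s ^ 2 - 1) * x' + 2 * s * a * z' = x"
        unfolding z1_eq z_eq by simp_all
    qed
    have z'_eq: "z' = z + 2 * C * (a * z - s * x)"
    proof -
      have "z' = (s * s) * z + a * C * z - 2 * C * (s * x)"
        unfolding z'_def z1_def x1_def by (simp add: algebra_simps)
      then show ?thesis unfolding unit by (simp add: algebra_simps)
    qed
    have "pell a C s z0 x0 (Suc m) = (z, x)" using m(2) step_up by simp
    moreover have "2 * C dvd z - z0"
    proof -
      have "z - z0 = (z' - z0) - 2 * C * (a * z - s * x)" by (simp add: z'_eq)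
      then show ?thesis using m(5) by (simp only: dvd_diff dvd_triv_left)
    qed
    ultimately show ?thesis using m by blast
  qed
qed

section \<open>Extensions of triples\<close>

definition sq :: "int \<Rightarrow> int \<Rightarrow> bool" where "sq x y \<longleftrightarrow> (\<exists>k. k ^ 2 = x * y + 1)"

lemma sq_commute: "sq x y \<longleftrightarrow> sq y x"
  by (simp add: sq_def mult.commute)

lemma sqE:
  assumes "sq x y" "0 < x" "0 < y"
  obtains k where "0 < k" "k ^ 2 = x * y + 1"
proof -
  obtain l where l: "l ^ 2 = x * y + 1" using assms by (auto simp: sq_def)
  have "0 < x * y" using assms by simp
  then have "l \<noteq> 0" using l by auto
  then show thesis using that[of "\<bar>l\<bar>"] l by simp
qed

lemma not_sq_self: "0 < x \<Longrightarrow> \<not> sq x x"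
proof
  assume x: "0 < x" and "sq x x"
  then obtain k where k: "0 < k" "k ^ 2 = x * x + 1" by (auto elim: sqE)
  have "x < k" by (rule power2_less_imp_less) (use k x in \<open>simp_all add: power2_eq_square\<close>)
  then have "(x + 1) ^ 2 \<le> k ^ 2" using x by (intro power_mono) auto
  then show False using x unfolding k(2) by (simp add: power2_eq_square algebra_simps)
qed

text \<open>\<rho> and E are fixed before a, so they serve every sequence through z. The start found
  by descent lies in the same interval of length 2 C and the same class modulo 2 C as \<rho>, hence
  equals it; the norm equation then makes a E + 1 a square.\<close>

lemma residue_extension:
  fixes C e z :: int
  assumes C: "2 \<le> C" "C < e" and z: "0 < z" "z ^ 2 = C * e + 1"
  obtains \<rho> E where "\<rho> ^ 2 = C * E + 1" "- C < \<rho>" "\<rho> \<le> C" "0 \<le> E" "E < C"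
    "\<And>a s x. \<lbrakk>0 < a; a < C; 0 < s; s ^ 2 = a * C + 1; 0 < x; x ^ 2 = a * e + 1\<rbrakk>
      \<Longrightarrow> \<exists>m x0. pell_seq a C s \<rho> x0 \<and> x0 ^ 2 = a * E + 1 \<and> 1 \<le> m \<and> pell a C s \<rho> x0 m = (z, x)"
proof -
  define w where "w = z mod (2 * C)"
  define \<rho> where "\<rho> = (if w \<le> C then w else w - 2 * C)"
  have w: "0 \<le> w" "w < 2 * C" using C by (simp_all add: w_def)
  then have \<rho>: "- C < \<rho>" "\<rho> \<le> C" using C by (auto simp: \<rho>_def)
  have "2 * C dvd z - w" unfolding w_def by (simp add: minus_mod_eq_mult_div)
  moreover have "z - \<rho> = (z - w) \<or> z - \<rho> = (z - w) + 2 * C" by (auto simp: \<rho>_def)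
  ultimately have dvd: "2 * C dvd z - \<rho>" by (metis dvd_add_times_triv_right_iff dvd_add dvd_refl)
  have "C dvd \<rho> ^ 2 - 1"
  proof -
    have "C dvd (z - \<rho>) * (z + \<rho>)" using dvd by (metis dvd_mult2 dvd_mult_right)
    moreover have "\<rho> ^ 2 - 1 = C * e - (z - \<rho>) * (z + \<rho>)" using z by (simp add: power2_eq_square algebra_simps)
    ultimately show ?thesis by (simp only: dvd_diff dvd_triv_left)
  qed
  then obtain E where "\<rho> ^ 2 - 1 = C * E" by (rule dvdE)
  then have E: "\<rho> ^ 2 = C * E + 1" by simp
  have "\<rho> \<noteq> 0"
  proof
    assume "\<rho> = 0"
    then have "C * (- E) = 1" using E by simp
    then have "C dvd 1" by (metis dvd_triv_left)
    then show False using C by simp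
  qed
  then have "1 \<le> \<rho> ^ 2" by (simp add: int_one_le_iff_zero_less)
  then have "0 \<le> C * E" using E by simp
  then have E0: "0 \<le> E" using C by (simp add: zero_le_mult_iff)
  have "\<rho> ^ 2 \<le> C ^ 2" using \<rho> by (intro abs_le_square_iff[THEN iffD1]) auto
  then have "C * E < C * C" using E by (simp add: power2_eq_square)
  then have EC: "E < C" using C by simp
  have zC: "C < z"
  proof (rule power2_less_imp_less)
    have "C * C < C * e" using C by simp
    then show "C ^ 2 < z ^ 2" using z by (simp add: power2_eq_square)
  qed (use z in simp)
  show thesis
  proof (rule that[OF E \<rho> E0 EC])
    fix a s x :: int
    assume a: "0 < a" "a < C" and s: "0 < s" "s ^ 2 = a * C + 1" and x: "0 < x" "x ^ 2 = a * e + 1"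
    have norm: "C * x ^ 2 - a * z ^ 2 = C - a" unfolding x(2) z(2) by (simp add: algebra_simps)
    obtain m z0 x0 where m: "pell_seq a C s z0 x0" "pell a C s z0 x0 m = (z, x)" "- C < z0" "z0 \<le> C" "2 * C dvd z - z0"
      using pell_descent[OF a s(2,1) x(1) norm] zC C by auto
    have "2 * C dvd (z - \<rho>) - (z - z0)" using dvd m(5) by (rule dvd_diff)
    then have "2 * C dvd z0 - \<rho>" by simp
    moreover have "\<bar>z0 - \<rho>\<bar> < 2 * C" using m \<rho> by auto
    ultimately have z0: "z0 = \<rho>" using dvd_imp_le_int[of "z0 - \<rho>" "2 * C"] C by auto
    have "C * x0 ^ 2 = a * \<rho> ^ 2 + C - a" using pell_seq.norm0[OF m(1)] z0 by simp
    also have "\<dots> = C * (a * E + 1)" unfolding E by (simp add: algebra_simps)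
    finally have "x0 ^ 2 = a * E + 1" using C by simp
    moreover have "m \<noteq> 0" using m z0 zC \<rho> by (metis fst_conv not_less pell.simps(1))
    ultimately show "\<exists>m x0. pell_seq a C s \<rho> x0 \<and> x0 ^ 2 = a * E + 1 \<and> 1 \<le> m \<and> pell a C s \<rho> x0 m = (z, x)"
      using m z0 by (metis One_nat_def Suc_leI gr0I)
  qed
qed

definition quad :: "int \<Rightarrow> int \<Rightarrow> int \<Rightarrow> int \<Rightarrow> bool" where
  "quad a b c d \<longleftrightarrow> 0 < a \<and> a < b \<and> b < c \<and> c < d \<and> sq a b \<and> sq a c \<and> sq b c \<and> sq a d \<and> sq b d \<and> sq c d"

text \<open>If both indices are 1, the two numbers are the roots of
  \<open>i^2 - i (2 F \<rho> + C + E) + F^2 - 1 = 0\<close>, where \<open>F\<close> is the common value of \<open>pell_seq.F\<close>.\<close>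

lemma common_F:
  fixes a b C E F \<rho> s t x0 y0 :: int
  assumes "a \<noteq> b" "\<rho> ^ 2 = C * E + 1" "s ^ 2 = a * C + 1" "t ^ 2 = b * C + 1"
    and "x0 ^ 2 = a * E + 1" "y0 ^ 2 = b * E + 1" and F: "F = s * x0 + a * \<rho>" "F = t * y0 + b * \<rho>"
  shows "F ^ 2 = a * b + 1"
proof -
  have quadratic: "F ^ 2 - 2 * i * \<rho> * F + i ^ 2 - i * (C + E) - 1 = 0"
    if "u ^ 2 = i * C + 1" "v ^ 2 = i * E + 1" "F = u * v + i * \<rho>" for i u v
  proof -
    have "(F - i * \<rho>) ^ 2 = u ^ 2 * v ^ 2" using that(3) by (simp add: power_mult_distrib)
    also have "\<dots> = i ^ 2 * \<rho> ^ 2 + i * (C + E) + 1 - i ^ 2"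
      unfolding that(1,2) assms(2) by (simp add: power2_eq_square algebra_simps)
    finally show ?thesis by (simp add: power2_eq_square algebra_simps)
  qed
  note qa = quadratic[OF assms(3,5) F(1)] and qb = quadratic[OF assms(4,6) F(2)]
  have "(a - b) * (a + b - 2 * \<rho> * F - (C + E))
     = (F ^ 2 - 2 * a * \<rho> * F + a ^ 2 - a * (C + E) - 1) - (F ^ 2 - 2 * b * \<rho> * F + b ^ 2 - b * (C + E) - 1)"
    by (simp add: power2_eq_square algebra_simps)
  then have "2 * \<rho> * F + (C + E) = a + b" using qa qb assms(1) by simp
  moreover have "F ^ 2 = a * (2 * \<rho> * F + (C + E)) - a ^ 2 + 1"
    using qa by (simp add: algebra_simps)
  ultimately show ?thesis by (simp add: power2_eq_square algebra_simps)
qed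

lemma square_root_le:
  fixes u v :: int
  shows "u ^ 2 \<le> v ^ 2 \<Longrightarrow> 0 \<le> v \<Longrightarrow> u \<le> v" "u ^ 2 < v ^ 2 \<Longrightarrow> 0 \<le> v \<Longrightarrow> u < v"
  by (rule power2_le_imp_le; assumption) (rule power2_less_imp_less; assumption)

text \<open>If both sequences reach z at index 1, \<open>common_F\<close> forces F = r, so z =
  \<rho> + 2 c r with \<rho> > -c. An index of at least 2 gives z \<ge> (1 + 4 g c) (c + 1), where g
  is a or b, which is larger because r \<le> b < c.\<close>

lemma quadruple_gap:
  assumes q: "quad a b c d" and r: "0 < r" "r ^ 2 = a * b + 1" and z: "0 < z" "z ^ 2 = c * d + 1"
  shows "c * (2 * r - 1) + 1 \<le> z"
proof -
  have pos: "0 < a" "a < b" "b < c" "c < d" and sqs: "sq a c" "sq b c" "sq a d" "sq b d"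
    using q by (auto simp: quad_def)
  obtain s where s: "0 < s" "s ^ 2 = a * c + 1" using sqs pos by (auto elim: sqE)
  obtain t where t: "0 < t" "t ^ 2 = b * c + 1" using sqs pos by (auto elim: sqE)
  obtain x where x: "0 < x" "x ^ 2 = a * d + 1" using sqs pos by (auto elim: sqE)
  obtain y where y: "0 < y" "y ^ 2 = b * d + 1" using sqs pos by (auto elim: sqE)
  have c2: "2 \<le> c" using pos by simp
  obtain \<rho> E where \<rho>: "\<rho> ^ 2 = c * E + 1" "- c < \<rho>" "\<rho> \<le> c" "0 \<le> E" "E < c" and
    ext: "\<And>a s x. \<lbrakk>0 < a; a < c; 0 < s; s ^ 2 = a * c + 1; 0 < x; x ^ 2 = a * d + 1\<rbrakk>
      \<Longrightarrow> \<exists>m x0. pell_seq a c s \<rho> x0 \<and> x0 ^ 2 = a * E + 1 \<and> 1 \<le> m \<and> pell a c s \<rho> x0 m = (z, x)"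
    by (rule residue_extension[OF c2 pos(4) z]) blast
  obtain m x0 where m: "pell_seq a c s \<rho> x0" "x0 ^ 2 = a * E + 1" "1 \<le> m" "pell a c s \<rho> x0 m = (z, x)"
    using ext[of a s x] pos s x by auto
  obtain n y0 where n: "pell_seq b c t \<rho> y0" "y0 ^ 2 = b * E + 1" "1 \<le> n" "pell b c t \<rho> y0 n = (z, y)"
    using ext[of b t y] pos t y by auto
  interpret A: pell_seq a c s \<rho> x0 by fact
  interpret B: pell_seq b c t \<rho> y0 by fact
  have Zm: "A.Z m = z" and Zn: "B.Z n = z" using m n by (simp_all add: A.Z_def B.Z_def)
  have rb: "r \<le> b"
  proof (rule square_root_le)
    have "a * b + 1 \<le> (b - 1) * b + 1" using pos by (intro add_mono mult_right_mono) auto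
    then show "r ^ 2 \<le> b ^ 2" unfolding r using pos by (simp add: power2_eq_square algebra_simps)
  qed (use pos in simp)
  have big: "c * (2 * r - 1) + 1 \<le> z" if "1 \<le> g" "(1 + 4 * g * c) * (c + 1) \<le> z" for g
  proof -
    have "1 * (c * c) \<le> g * (c * c)" by (rule mult_right_mono) (use that pos in auto)
    moreover have "r * c \<le> c * c" by (rule mult_right_mono) (use rb pos in auto)
    moreover have "0 \<le> g * c" "0 \<le> c * c" using that pos by simp_all
    ultimately have "2 * (r * c) - c + 1 \<le> 1 + c + 4 * (g * (c * c)) + 4 * (g * c)"
      using pos by linarith
    also have "2 * (r * c) - c + 1 = c * (2 * r - 1) + 1" by (simp add: algebra_simps)
    also have "1 + c + 4 * (g * (c * c)) + 4 * (g * c) = (1 + 4 * g * c) * (c + 1)" by (simp add: algebra_simps)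
    finally show ?thesis using that(2) by simp
  qed
  consider "m = 1" "n = 1" | m' where "m = Suc (Suc m')" | n' where "n = Suc (Suc n')"
    using m(3) n(3) by (metis One_nat_def Suc_le_D le_SucE le_zero_eq not_less_eq_eq old.nat.exhaust)
  then show ?thesis
  proof cases
    case 1
    have za: "z = \<rho> + 2 * c * A.F" "z = \<rho> + 2 * c * B.F"
      using Zm Zn A.Z_1 B.Z_1 1 by auto
    then have "A.F = B.F" using c2 by simp
    then have "A.F ^ 2 = a * b + 1"
      using common_F[OF _ \<rho>(1) s(2) t(2) m(2) n(2), of A.F] pos by (simp add: A.F_def B.F_def)
    then have "A.F ^ 2 = r ^ 2" using r by simp
    then have "A.F = r" by (rule power2_eq_imp_eq) (use A.F_pos r in auto)
    then have "z = \<rho> + 2 * c * r" using za by simp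
    then show ?thesis using \<rho>(2) by (simp add: algebra_simps)
  next
    case (2 m')
    have "(1 + 4 * a * c) ^ 1 * (c + 1) \<le> (1 + 4 * a * c) ^ Suc m' * (c + 1)"
      using pos by (intro mult_right_mono power_increasing) auto
    also have "\<dots> \<le> z" using A.Z_ge[OF \<rho>(2), of "Suc m'"] Zm 2 by simp
    finally have "(1 + 4 * a * c) * (c + 1) \<le> z" by simp
    then show ?thesis by (rule big[rotated]) (use pos in simp)
  next
    case (3 n')
    have "(1 + 4 * b * c) ^ 1 * (c + 1) \<le> (1 + 4 * b * c) ^ Suc n' * (c + 1)"
      using pos by (intro mult_right_mono power_increasing) auto
    also have "\<dots> \<le> z" using B.Z_ge[OF \<rho>(2), of "Suc n'"] Zn 3 by simp
    finally have "(1 + 4 * b * c) * (c + 1) \<le> z" by simp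
    then show ?thesis by (rule big[rotated]) (use pos in simp)
  qed
qed

lemma not_square_between:
  fixes k n j :: int
  shows "j ^ 2 < n \<Longrightarrow> n < (j + 1) ^ 2 \<Longrightarrow> 0 \<le> j \<Longrightarrow> k ^ 2 \<noteq> n"
proof
  assume h: "j ^ 2 < n" "n < (j + 1) ^ 2" "0 \<le> j" "k ^ 2 = n"
  then have "j ^ 2 < \<bar>k\<bar> ^ 2" "\<bar>k\<bar> ^ 2 < (j + 1) ^ 2" by simp_all
  then have "j < \<bar>k\<bar>" "\<bar>k\<bar> < j + 1"
    using square_root_le(2)[of j "\<bar>k\<bar>"] square_root_le(2)[of "\<bar>k\<bar>" "j + 1"] h(3) by simp_all
  then show False by simp
qed

text \<open>Squaring the gap bound gives d \<ge> c (2 r - 1)^2 + 2 (2 r - 1), which suffices for r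
  \<ge> 4. For r = 2 and r = 3 the small values of c are inspected. The value 120 is attained by {1,
  3, 8, 120}.\<close>

lemma quadruple_lower_bound:
  assumes q: "quad a b c d"
  shows "36 * b + 1 \<le> d \<and> 120 \<le> d"
proof -
  have pos: "0 < a" "a < b" "b < c" "c < d" and sqs: "sq a b" "sq a c" "sq b c" "sq a d" "sq b d" "sq c d"
    using q by (auto simp: quad_def)
  obtain r where r: "0 < r" "r ^ 2 = a * b + 1" using sqs pos by (auto elim: sqE)
  obtain z where z: "0 < z" "z ^ 2 = c * d + 1" using sqs pos by (auto elim: sqE)
  have le: "c * (2 * r - 1) + 1 \<le> z" by (rule quadruple_gap[OF q r z])
  have "(c * (2 * r - 1) + 1) ^ 2 \<le> z ^ 2" using le pos r by (intro power_mono) auto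
  then have "c * (c * (2 * r - 1) ^ 2 + 2 * (2 * r - 1)) \<le> c * d"
    unfolding z by (simp add: power2_eq_square algebra_simps)
  then have d: "c * (2 * r - 1) ^ 2 + 2 * (2 * r - 1) \<le> d" using pos by simp
  have b: "r \<le> b"
  proof (rule square_root_le)
    have "a * b + 1 \<le> (b - 1) * b + 1" using pos by (intro add_mono mult_right_mono) auto
    then show "r ^ 2 \<le> b ^ 2" unfolding r using pos by (simp add: power2_eq_square algebra_simps)
  qed (use pos in simp)
  have r1: "r \<noteq> 1" using r pos by auto
  show ?thesis
  proof (cases "4 \<le> r")
    case True
    then have "7 ^ 2 \<le> (2 * r - 1) ^ 2" by (intro power_mono) auto
    then have "c * 49 \<le> c * (2 * r - 1) ^ 2" using pos by (intro mult_left_mono) auto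
    then have "49 * c < d" using d True by simp
    then show ?thesis using pos b True by simp
  next
    case False
    then have "r = 2 \<or> r = 3" using r r1 by auto
    then show ?thesis
    proof
      assume r2: "r = 2"
      then have ab: "a * b = 3" using r by simp
      then have "a dvd 3" by (metis dvd_triv_left)
      then have "a \<le> 3" by (simp add: zdvd_imp_le)
      then have "a = 1 \<or> a = 2 \<or> a = 3" using pos by auto
      then have a: "a = 1" "b = 3" using ab pos by auto
      have d9: "c * 9 + 6 \<le> d" using d r2 by simp
      show ?thesis
      proof (cases "13 \<le> c")
        case True
        then show ?thesis using d9 a by auto
      next
        case False
        obtain u where u: "0 < u" "u ^ 2 = c + 1" using sqs(2) a pos by (auto elim: sqE)
        have "c \<in> {4,5,6,7,8,9,10,11,12}" using False a pos by auto
        then have "c = 8"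
          using u not_square_between[of 2 "c + 1" u] not_square_between[of 3 "c + 1" u] by auto
        obtain v where v: "0 < v" "v ^ 2 = d + 1" using sqs(4) a pos by (auto elim: sqE)
        obtain w where w: "0 < w" "w ^ 2 = 3 * d + 1" using sqs(5) a pos by (auto elim: sqE)
        show ?thesis
        proof (rule ccontr)
          assume "\<not> ?thesis"
          then have "d < 120" using a by auto
          \<comment> \<open>The gap leaves 78 \<le> d < 120, where d + 1 is a square only for d = 80
            and d = 99; then 3 d + 1 is 241 or 298.\<close>
          have "8 ^ 2 < v ^ 2" "v ^ 2 < 11 ^ 2" using v d9 \<open>c = 8\<close> \<open>d < 120\<close> by simp_all
          then have "8 < v" "v < 11" using square_root_le(2)[of 8 v] square_root_le(2)[of v 11] v(1) by simp_all
          then have "v = 9 \<or> v = 10" by auto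
          then have "d = 80 \<or> d = 99" using v by auto
          then show False using w not_square_between[of 15 "3 * d + 1" w] not_square_between[of 17 "3 * d + 1" w] by auto
        qed
      qed
    next
      assume r3: "r = 3"
      then have ab: "a * b = 8" using r by simp
      then have "a dvd 8" by (metis dvd_triv_left)
      then have "a \<le> 8" by (simp add: zdvd_imp_le)
      then have "a \<in> {1,2,3,4,5,6,7,8}" using pos by auto
      then have a: "a = 1 \<and> b = 8 \<or> a = 2 \<and> b = 4" using ab pos by auto
      have d25: "c * 25 + 10 \<le> d" using d r3 by simp
      obtain u where u: "0 < u" "u ^ 2 = a * c + 1" using sqs(2) pos by (auto elim: sqE)
      show ?thesis
      proof (cases "12 \<le> c")
        case True
        then show ?thesis using a d25 by auto
      next
        case False
        from a show ?thesis
        proof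
          assume a: "a = 1 \<and> b = 8"
          then have "c \<in> {9,10,11}" using False pos by auto
          then show ?thesis using u a not_square_between[of 3 "c + 1" u] by auto
        next
          assume a: "a = 2 \<and> b = 4"
          then have "c \<in> {5,6,7,8,9,10,11}" using False pos by auto
          then show ?thesis using u a not_square_between[of 3 "2 * c + 1" u] not_square_between[of 4 "2 * c + 1" u] by auto
        qed
      qed
    qed
  qed
qed

text \<open>e and e' are the two regular extensions of the triple. As c e + 1 is a square, e \<ge>
  0; then e e' = (c - a - b)^2 - 4 r^2 yields c \<ge> a + b + 2 r, and r > a.\<close>

lemma triple_gap:
  assumes "0 < a" "a < b" "b < c" "sq a b" "sq a c" "sq b c"
  shows "4 * a < c"
proof -
  obtain r where r: "0 < r" "r ^ 2 = a * b + 1" using assms by (auto elim: sqE)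
  obtain s where s: "0 < s" "s ^ 2 = a * c + 1" using assms by (auto elim: sqE)
  obtain t where t: "0 < t" "t ^ 2 = b * c + 1" using assms by (auto elim: sqE)
  define e where "e = a + b + c + 2 * a * b * c - 2 * r * s * t"
  define e' where "e' = a + b + c + 2 * a * b * c + 2 * r * s * t"
  have ar: "a < r"
  proof (rule square_root_le(2))
    have "a * a < a * b" using assms by simp
    then show "a ^ 2 < r ^ 2" unfolding r by (simp add: power2_eq_square)
  qed (use r in simp)
  have "c * e + 1 = (c * r - s * t) ^ 2"
  proof -
    have "(c * r - s * t) ^ 2 = c ^ 2 * r ^ 2 + s ^ 2 * t ^ 2 - 2 * c * r * s * t"
      by (simp add: power2_eq_square algebra_simps)
    also have "\<dots> = c * e + 1" unfolding r s t e_def by (simp add: power2_eq_square algebra_simps)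
    finally show ?thesis by simp
  qed
  then have "- 1 \<le> c * e" using zero_le_power2[of "c * r - s * t"] by linarith
  have "0 \<le> e"
  proof (rule ccontr)
    assume "\<not> 0 \<le> e"
    then have "c * e \<le> c * (- 1)" using assms by (intro mult_left_mono) auto
    then show False using \<open>- 1 \<le> c * e\<close> assms by linarith
  qed
  moreover have "0 \<le> e'" using assms r s t by (simp add: e'_def)
  ultimately have "0 \<le> e * e'" by simp
  also have "e * e' = (a + b + c + 2 * a * b * c) ^ 2 - 4 * (r ^ 2 * s ^ 2 * t ^ 2)"
    by (simp add: e_def e'_def power2_eq_square algebra_simps)
  also have "\<dots> = (c - a - b) ^ 2 - (2 * r) ^ 2"
    unfolding power_mult_distrib r s t by (simp add: power2_eq_square algebra_simps)
  finally have "\<bar>2 * r\<bar> \<le> \<bar>c - a - b\<bar>" by (simp add: abs_le_square_iff)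
  then show ?thesis using ar assms r by linarith
qed

section \<open>Lower bounds for the Pell indices\<close>

lemma pell_pair_cong:
  assumes "pell_seq a C s \<rho> x0" "pell_seq b C t \<rho> y0"
    and "pell a C s \<rho> x0 m = (z, x)" "pell b C t \<rho> y0 n = (z, y)"
  shows "2 * C dvd (a * \<rho> * int m ^ 2 + s * x0 * int m) - (b * \<rho> * int n ^ 2 + t * y0 * int n)"
proof -
  interpret A: pell_seq a C s \<rho> x0 by fact
  interpret B: pell_seq b C t \<rho> y0 by fact
  let ?A = "a * \<rho> * int m ^ 2 + s * x0 * int m"
  let ?B = "b * \<rho> * int n ^ 2 + t * y0 * int n"
  have "4 * C ^ 2 dvd (z - (\<rho> + 2 * C * ?B)) - (z - (\<rho> + 2 * C * ?A))"
    by (rule dvd_diff) (use A.Z_cong_square[of m] B.Z_cong_square[of n] assms in \<open>simp_all add: A.Z_def B.Z_def\<close>)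
  also have "(z - (\<rho> + 2 * C * ?B)) - (z - (\<rho> + 2 * C * ?A)) = (2 * C) * (?A - ?B)"
    by (simp add: algebra_simps)
  also have "4 * C ^ 2 = (2 * C) * (2 * C)" by (simp add: power2_eq_square)
  finally show ?thesis using A.a A.aC unfolding dvd_mult_cancel_left by auto
qed

text \<open>The case \<open>E = 0\<close>: the congruence becomes an equation once both indices are small, and
  then \<open>k (\<epsilon> (s m + t n) + C) = m^2 - n^2\<close> for \<open>k = b n^2 - a m^2\<close>.\<close>

lemma trivial_start_index:
  fixes m n :: nat
  assumes A: "pell_seq a C s \<epsilon> 1" and B: "pell_seq b C t \<epsilon> 1" and "a \<noteq> b" and \<epsilon>: "\<epsilon> = 1 \<or> \<epsilon> = - 1"
    and "pell a C s \<epsilon> 1 m = (z, x)" "pell b C t \<epsilon> 1 n = (z, y)" and m1: "1 \<le> m"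
    and small: "a * int m ^ 2 + s * int m < C" "b * int n ^ 2 + t * int n < C"
  shows "C \<le> s * int m + t * int n + \<bar>int m ^ 2 - int n ^ 2\<bar>"
proof -
  interpret A: pell_seq a C s \<epsilon> 1 by fact
  interpret B: pell_seq b C t \<epsilon> 1 by fact
  define M where "M = int m"
  define K where "K = int n"
  have nn: "0 < M" "0 \<le> K" using m1 by (auto simp: M_def K_def)
  have "2 * C dvd (a * \<epsilon> * M ^ 2 + s * M) - (b * \<epsilon> * K ^ 2 + t * K)"
    using pell_pair_cong[OF A B assms(5,6)] by (simp add: M_def K_def)
  moreover have "\<bar>(a * \<epsilon> * M ^ 2 + s * M) - (b * \<epsilon> * K ^ 2 + t * K)\<bar> < 2 * C"
  proof -
    have "0 \<le> a * M ^ 2" "0 \<le> s * M" "0 \<le> b * K ^ 2" "0 \<le> t * K"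
      using nn A.a B.a A.s0 B.s0 by auto
    then show ?thesis using small \<epsilon> unfolding M_def[symmetric] K_def[symmetric] by auto
  qed
  ultimately have eq: "a * \<epsilon> * M ^ 2 + s * M = b * \<epsilon> * K ^ 2 + t * K"
    using dvd_imp_le_int[of "(a * \<epsilon> * M ^ 2 + s * M) - (b * \<epsilon> * K ^ 2 + t * K)" "2 * C"] A.a A.aC by fastforce
  define k where "k = b * K ^ 2 - a * M ^ 2"
  have ek: "\<epsilon> * k = s * M - t * K" using eq by (simp add: k_def algebra_simps)
  have ee: "\<epsilon> * \<epsilon> = 1" using \<epsilon> by auto
  have "(s * M - t * K) * (s * M + t * K) = s ^ 2 * M ^ 2 - t ^ 2 * K ^ 2"
    by (simp add: power2_eq_square algebra_simps)
  also have "\<dots> = M ^ 2 - K ^ 2 - C * k" unfolding A.s B.s k_def by (simp add: algebra_simps)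
  finally have key: "k * (\<epsilon> * (s * M + t * K) + C) = M ^ 2 - K ^ 2"
    unfolding ek[symmetric] by (simp add: algebra_simps)
  show ?thesis
  proof (cases "k = 0")
    case True
    then have "M ^ 2 = K ^ 2" using key by simp
    then have "M = K" by (rule power2_eq_imp_eq) (use nn in auto)
    moreover have "s * M = t * K" using ek True by simp
    ultimately have "s = t" using nn by simp
    then have "a * C = b * C" using A.s B.s by auto
    then show ?thesis using \<open>a \<noteq> b\<close> A.a A.aC by simp
  next
    case False
    then have "1 * \<bar>\<epsilon> * (s * M + t * K) + C\<bar> \<le> \<bar>k\<bar> * \<bar>\<epsilon> * (s * M + t * K) + C\<bar>"
      by (intro mult_right_mono) auto
    then have "\<bar>\<epsilon> * (s * M + t * K) + C\<bar> \<le> \<bar>M ^ 2 - K ^ 2\<bar>" using key by (simp flip: abs_mult)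
    moreover have "0 \<le> s * M + t * K" using nn A.s0 B.s0 by simp
    ultimately show ?thesis using \<epsilon> unfolding M_def[symmetric] K_def[symmetric] by auto
  qed
qed

lemma trivial_start_index_small:
  fixes m n L :: nat
  assumes A: "pell_seq a C s \<epsilon> 1" and B: "pell_seq b C t \<epsilon> 1" and "a < b" and \<epsilon>: "\<epsilon> = 1 \<or> \<epsilon> = - 1"
    and "pell a C s \<epsilon> 1 m = (z, x)" "pell b C t \<epsilon> 1 n = (z, y)" and m1: "1 \<le> m"
    and mn: "m \<le> L" "n \<le> L"
  shows "C \<le> 2 * t * int L + int L ^ 2"
proof (rule ccontr)
  assume "\<not> ?thesis"
  then have C: "2 * (t * int L) + int L ^ 2 < C" by simp
  interpret A: pell_seq a C s \<epsilon> 1 by fact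
  interpret B: pell_seq b C t \<epsilon> 1 by fact
  have st: "s \<le> t"
  proof (rule square_root_le)
    show "s ^ 2 \<le> t ^ 2" unfolding A.s B.s using \<open>a < b\<close> A.a A.aC by (simp add: mult_right_mono)
  qed (use B.s0 in simp)
  have tL: "0 \<le> t * int L" using B.s0 by simp
  \<comment> \<open>Squares 2 t L < C and inserts t^2 = b C + 1. Then b L^2 + t L stays below C, as
    \<open>trivial_start_index\<close> requires.\<close>
  have bL: "4 * (b * int L ^ 2) \<le> C"
  proof -
    have "(2 * (t * int L)) ^ 2 \<le> C ^ 2" using C tL zero_le_power2[of "int L"] by (intro power_mono) linarith+
    then have "4 * (b * int L ^ 2) * C + 4 * int L ^ 2 \<le> C * C"
      unfolding power_mult_distrib B.s by (simp add: power2_eq_square algebra_simps)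
    then have "4 * (b * int L ^ 2) * C \<le> C * C" using zero_le_power2[of "int L"] by linarith
    then show ?thesis using A.a A.aC by simp
  qed
  have le: "s * int m \<le> t * int L" "t * int n \<le> t * int L"
    using st mn A.s0 B.s0 by (auto intro: mult_mono)
  have sq_le: "int m ^ 2 \<le> int L ^ 2" "int n ^ 2 \<le> int L ^ 2" using mn by (auto intro: power_mono)
  have "a * int m ^ 2 \<le> b * int L ^ 2" using sq_le \<open>a < b\<close> A.a by (intro mult_mono) auto
  moreover have "b * int n ^ 2 \<le> b * int L ^ 2" using sq_le B.a by (intro mult_left_mono) auto
  ultimately have "C \<le> s * int m + t * int n + \<bar>int m ^ 2 - int n ^ 2\<bar>"
    using \<open>a < b\<close> bL le C tL A.a A.aC zero_le_power2[of "int L"]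
    by (intro trivial_start_index[OF A B _ \<epsilon> assms(5,6) m1]) linarith+
  moreover have "\<bar>int m ^ 2 - int n ^ 2\<bar> \<le> int L ^ 2" using sq_le zero_le_power2[of "int m"] zero_le_power2[of "int n"] by linarith
  ultimately show False using le C by linarith
qed

text \<open>With indices at most 3, equal indices give C \<le> 6 t, contrary to C > 36 b. For
  unequal ones the difference of the squares is outweighed by the missing multiples of t, because t
  \<ge> 8.\<close>

lemma trivial_start_index_four:
  fixes m n :: nat
  assumes A: "pell_seq a C s \<epsilon> 1" and B: "pell_seq b C t \<epsilon> 1" and "a < b" and \<epsilon>: "\<epsilon> = 1 \<or> \<epsilon> = - 1"
    and "pell a C s \<epsilon> 1 m = (z, x)" "pell b C t \<epsilon> 1 n = (z, y)" and m1: "1 \<le> m"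
    and C: "36 * b + 1 \<le> C" "120 \<le> C"
  shows "4 \<le> m \<or> 4 \<le> n"
proof (rule ccontr)
  assume "\<not> ?thesis"
  then have mn: "m \<le> 3" "n \<le> 3" by auto
  interpret A: pell_seq a C s \<epsilon> 1 by fact
  interpret B: pell_seq b C t \<epsilon> 1 by fact
  have st: "s \<le> t"
  proof (rule square_root_le)
    show "s ^ 2 \<le> t ^ 2" unfolding A.s B.s using \<open>a < b\<close> A.a A.aC by (simp add: mult_right_mono)
  qed (use B.s0 in simp)
  have t6: "6 * t < C"
  proof (rule square_root_le(2))
    have "(36 * b + 1) * C \<le> C * C" using C by (intro mult_right_mono) auto
    then show "(6 * t) ^ 2 < C ^ 2" unfolding power_mult_distrib B.s using C by (simp add: power2_eq_square algebra_simps)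
  qed (use C in simp)
  have t8: "8 \<le> t"
  proof (rule square_root_le)
    have "1 * 120 \<le> b * C" using B.a C by (intro mult_mono) auto
    then show "8 ^ 2 \<le> t ^ 2" unfolding B.s by simp
  qed (use B.s0 in simp)
  have cases: "int m = 1 \<or> int m = 2 \<or> int m = 3" "int n = 0 \<or> int n = 1 \<or> int n = 2 \<or> int n = 3" using mn m1 by auto
  have "a * int m ^ 2 \<le> b * 9" "b * int n ^ 2 \<le> b * 9" using cases \<open>a < b\<close> A.a by auto
  then have "C \<le> s * int m + t * int n + \<bar>int m ^ 2 - int n ^ 2\<bar>"
    using cases t6 st C \<open>a < b\<close> A.s0 B.s0 by (intro trivial_start_index[OF A B _ \<epsilon> assms(5,6) m1]) auto
  then show False using cases t6 t8 st A.s0 B.s0 by auto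
qed

text \<open>The case \<open>E \<ge> 1\<close>. Comparing growth rates gives \<open>m < 2 n\<close>, because \<open>(4 a C)^2\<close> exceeds \<open>6 c C\<close>;
  with \<open>c > 4 a\<close> this contradicts the equation \<open>a \<rho> m^2 + s x\<^sub>0 m = c \<rho> n^2 + t y\<^sub>0 n\<close>.\<close>

lemma nontrivial_start_index:
  fixes m n :: nat
  assumes A: "pell_seq a C s \<rho> x0" and B: "pell_seq c C t \<rho> y0" and ac: "4 * a \<le> c"
    and E: "1 \<le> E" "E < C" and \<rho>: "\<rho> ^ 2 = C * E + 1" "- C < \<rho>"
    and "pell a C s \<rho> x0 m = (z, x)" "pell c C t \<rho> y0 n = (z, y)" and m1: "1 \<le> m" "1 \<le> n"
    and not11: "\<not> (m = 1 \<and> n = 1 \<and> \<rho> < 0)"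
  shows "2 * C \<le> 4 * c * \<bar>\<rho>\<bar> * int n ^ 2"
proof (rule ccontr)
  assume "\<not> ?thesis"
  then have big: "4 * c * \<bar>\<rho>\<bar> * int n ^ 2 < 2 * C" by simp
  interpret A: pell_seq a C s \<rho> x0 by fact
  interpret B: pell_seq c C t \<rho> y0 by fact
  have Zm: "A.Z m = z" and Zn: "B.Z n = z" using assms by (simp_all add: A.Z_def B.Z_def)
  have C1: "1 < C" using A.a A.aC by simp
  have \<rho>C: "C < \<rho> ^ 2" using E \<rho>(1) C1 mult_left_mono[of 1 E C] by simp
  define G where "G = 1 + 4 * a * C"
  define H where "H = 1 + 6 * c * C"
  have growth: "H < G ^ 2"
  proof -
    have "c * C \<le> C * C" using B.aC C1 by (intro mult_right_mono) auto
    moreover have "1 * (C * C) \<le> a ^ 2 * (C * C)" using A.a by (intro mult_right_mono) (auto simp: int_one_le_iff_zero_less)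
    moreover have "0 < c * C" "0 < a * C" using B.a A.a C1 by simp_all
    moreover have "G ^ 2 = 1 + 8 * (a * C) + 16 * (a ^ 2 * (C * C))"
      by (simp add: G_def power2_eq_square algebra_simps)
    ultimately show ?thesis unfolding H_def by linarith
  qed
  have base: "1 \<le> G" "1 \<le> H" using A.a B.a C1 by (simp_all add: G_def H_def)
  \<comment> \<open>For negative \<rho> the first increment is small: the conjugate t y0 - c \<rho>
    of F is at least 2 c |\<rho>|, and the product of the two is below 2 c C.\<close>
  have Fc: "\<rho> < 0 \<Longrightarrow> B.F * \<bar>\<rho>\<bar> < C"
  proof -
    assume neg: "\<rho> < 0"
    have "B.F * (t * y0 - c * \<rho>) = (t * y0) ^ 2 - (c * \<rho>) ^ 2"
      by (simp add: B.F_def power2_eq_square algebra_simps)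
    also have "\<dots> = y0 ^ 2 + c * C - c ^ 2" using B.sX_sq[of 0] by simp
    also have "\<dots> = c * (C + E) + 1 - c ^ 2"
    proof -
      have "C * y0 ^ 2 = C * (c * E + 1)" using B.norm0 \<rho>(1) by (simp add: algebra_simps)
      then have "y0 ^ 2 = c * E + 1" using C1 by simp
      then show ?thesis by (simp add: algebra_simps)
    qed
    also have "\<dots> < c * (2 * C)"
    proof -
      have "c * (C + E) \<le> c * (2 * C - 1)" using E B.a by (intro mult_left_mono) auto
      moreover have "c * (2 * C - 1) = c * (2 * C) - c" by (simp add: algebra_simps)
      moreover have "1 * c \<le> c ^ 2" unfolding power2_eq_square using B.a by (intro mult_right_mono) auto
      ultimately show ?thesis using B.a by linarith
    qed
    finally have "B.F * (t * y0 - c * \<rho>) < 2 * c * C" by simp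
    moreover have "B.F * (2 * c * \<bar>\<rho>\<bar>) \<le> B.F * (t * y0 - c * \<rho>)"
    proof (rule mult_left_mono)
      have "2 * c * \<bar>\<rho>\<bar> = - (c * \<rho>) - c * \<rho>" using neg by (simp add: abs_of_neg)
      then show "2 * c * \<bar>\<rho>\<bar> \<le> t * y0 - c * \<rho>" using B.sX_gt(2)[of 0] unfolding B.Z_0 B.X_0 by linarith
    qed (use B.F_pos in simp)
    ultimately have "(2 * c) * (B.F * \<bar>\<rho>\<bar>) < (2 * c) * C" by (simp add: mult_ac)
    then show ?thesis using B.a by simp
  qed
  have m2n: "m < 2 * n"
  proof (rule ccontr)
    assume "\<not> m < 2 * n"
    then obtain i where i: "m = 2 * n + i" using le_Suc_ex not_less by blast
    show False
    proof (cases "0 < \<rho>")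
      case True
      have "G ^ m * \<rho> \<le> z" using A.Z_pos_add[of 0 m] True Zm by (simp add: G_def)
      moreover have "z \<le> H ^ n * \<rho>" using B.Z_add_le[of 0 n] True Zn \<rho>C by (simp add: H_def)
      ultimately have "G ^ m * \<rho> \<le> H ^ n * \<rho>" by linarith
      then have "G ^ m \<le> H ^ n" using True by simp
      moreover have "H ^ n < (G ^ 2) ^ n"
        using growth base m1 by (intro power_strict_mono) auto
      moreover have "(G ^ 2) ^ n \<le> G ^ m"
        unfolding power_mult[symmetric] i using base by (intro power_increasing) auto
      ultimately show False by linarith
    next
      case False
      then have neg: "\<rho> < 0" using \<rho>C C1 by (cases "\<rho> = 0") auto
      obtain j where j: "n = Suc j" using m1 by (cases n) auto
      have "G ^ (m - 1) * (C + 1) \<le> z" using A.Z_ge[OF \<rho>(2), of "m - 1"] m1 Zm by (simp add: G_def)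
      moreover have "G ^ (2 * j + 1) * (C + 1) \<le> G ^ (m - 1) * (C + 1)"
        using base C1 i j by (intro mult_right_mono power_increasing) auto
      \<comment> \<open>From a negative start, growth estimates apply only after the first step.
        That step costs less than one factor G, which is available because m - 1 \<ge> 2 j +
        1.\<close>
      moreover have w1: "C < B.Z 1" "B.Z 1 < G * (C + 1)"
      proof -
        show "C < B.Z 1" using B.Z_1_gt[OF \<rho>(2)] by simp
        have "B.F ^ 2 * \<rho> ^ 2 < C ^ 2"
          using power_strict_mono[OF Fc[OF neg], of 2] B.F_pos by (simp add: power_mult_distrib)
        moreover have "B.F ^ 2 * C \<le> B.F ^ 2 * \<rho> ^ 2" using \<rho>C by (intro mult_left_mono) auto
        ultimately have "B.F ^ 2 * C < C * C" by (simp add: power2_eq_square)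
        then have "B.F ^ 2 < C" using C1 by simp
        moreover have "B.F * 1 \<le> B.F ^ 2" using B.F_pos by (simp add: power2_eq_square)
        ultimately have "2 * C * B.F \<le> 2 * C * C" using C1 by (intro mult_left_mono) auto
        moreover have "1 * (4 * C * C) \<le> a * (4 * C * C)" using A.a C1 by (intro mult_right_mono) auto
        moreover have "G * (C + 1) = 1 + C + a * (4 * C * C) + 4 * (a * C)" by (simp add: G_def algebra_simps)
        moreover have "0 < a * C" "0 < C * C" using A.a C1 by simp_all
        ultimately show "B.Z 1 < G * (C + 1)" using B.Z_1 neg C1 unfolding One_nat_def by linarith
      qed
      moreover have "z \<le> H ^ j * B.Z 1"
      proof -
        have "C * 1 < B.Z 1 * B.Z 1" using w1 C1 by (intro mult_strict_mono) auto
        then show ?thesis using B.Z_add_le[of 1 j] w1 C1 Zn j by (simp add: power2_eq_square H_def)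
      qed
      moreover have "H ^ j * B.Z 1 \<le> (G ^ 2) ^ j * B.Z 1"
        using growth base w1 C1 by (intro mult_right_mono power_mono) auto
      moreover have "(G ^ 2) ^ j * B.Z 1 < (G ^ 2) ^ j * (G * (C + 1))"
        using w1 base by (intro mult_strict_left_mono) auto
      moreover have "(G ^ 2) ^ j * (G * (C + 1)) = G ^ (2 * j + 1) * (C + 1)"
        by (simp add: power_mult[symmetric])
      ultimately show False by linarith
    qed
  qed
  define M where "M = int m"
  define K where "K = int n"
  define \<sigma> where "\<sigma> = \<bar>\<rho>\<bar>"
  have MK: "1 \<le> M" "1 \<le> K" "M \<le> 2 * K - 1" using m1 m2n by (auto simp: M_def K_def)
  have \<sigma>0: "0 < \<sigma>" using \<rho>C C1 by (cases "\<rho> = 0") (auto simp: \<sigma>_def)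
  have a\<sigma>: "0 < a * \<sigma>" using A.a \<sigma>0 by simp
  have MM: "M * M \<le> (2 * K - 1) * M" "(2 * K - 1) * M \<le> (2 * K - 1) * (2 * K - 1)"
    using MK by (intro mult_right_mono mult_left_mono; simp)+
  \<comment> \<open>This is (M + 1)^2 - 1 \<le> (2 K)^2 - 1.\<close>
  have MM': "M * M + 2 * M \<le> 4 * (K * K) - 1" using MM MK by (simp add: algebra_simps)
  have c4: "4 * (a * \<sigma>) * (K * K) \<le> c * \<sigma> * (K * K)"
  proof -
    have "4 * a * (\<sigma> * (K * K)) \<le> c * (\<sigma> * (K * K))" using ac \<sigma>0 MK by (intro mult_right_mono) auto
    then show ?thesis by (simp add: mult_ac)
  qed
  have sx: "0 < s * x0" "0 < t * y0" using A.s0 B.s0 A.x0 B.x0 by simp_all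
  have sx_le: "s * x0 \<le> 2 * (a * \<sigma>)" "t * y0 \<le> 2 * (c * \<sigma>)"
  proof -
    have norm: "C * u ^ 2 = C * (i * E + 1)" if "C * u ^ 2 - i * \<rho> ^ 2 = C - i" for u i
      using that \<rho>(1) by (simp add: algebra_simps)
    have le: "v * u \<le> 2 * (i * \<sigma>)" if "1 \<le> i" "v ^ 2 = i * C + 1" "u ^ 2 = i * E + 1" for i u v
    proof (rule square_root_le)
      have "C * 1 + E * 1 \<le> C * E + 1" using mult_nonneg_nonneg[of "C - 1" "E - 1"] C1 E by (simp add: algebra_simps)
      then have "i * (C + E) \<le> i * (C * E + 1)" using that by (intro mult_left_mono) auto
      also have "\<dots> \<le> i ^ 2 * (C * E + 1)"
        using that C1 E by (intro mult_right_mono) (auto simp: power2_eq_square)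
      finally have h: "i * (C + E) \<le> i ^ 2 * (C * E + 1)" .
      have "1 \<le> i ^ 2" using that by (simp add: one_le_power)
      then have i1: "1 * (C * E + 1) \<le> i ^ 2 * (C * E + 1)" using C1 E by (intro mult_right_mono) auto
      have "0 < C * E" using C1 E by simp
      have "(v * u) ^ 2 = i ^ 2 * (C * E + 1) - i ^ 2 + i * (C + E) + 1"
        unfolding power_mult_distrib that(2,3) by (simp add: power2_eq_square algebra_simps)
      have "(2 * (i * \<sigma>)) ^ 2 = 4 * (i ^ 2 * (C * E + 1))"
        by (simp add: power_mult_distrib \<sigma>_def \<rho>(1))
      show "(v * u) ^ 2 \<le> (2 * (i * \<sigma>)) ^ 2"
      proof -
        have "T - I + P + 1 \<le> 4 * T" if "P \<le> T" "1 \<le> T" "1 \<le> I" for T P I :: int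
          using that by linarith
        moreover have "1 \<le> i ^ 2 * (C * E + 1)" by (rule order_trans[OF _ i1]) (use \<open>0 < C * E\<close> in simp)
        ultimately show ?thesis
          unfolding \<open>(v * u) ^ 2 = _\<close> \<open>(2 * (i * \<sigma>)) ^ 2 = _\<close> using h \<open>1 \<le> i ^ 2\<close> by blast
      qed
    qed (use that \<sigma>0 in simp)
    have "x0 ^ 2 = a * E + 1" "y0 ^ 2 = c * E + 1" using norm[OF A.norm0] norm[OF B.norm0] C1 by simp_all
    then show "s * x0 \<le> 2 * (a * \<sigma>)" "t * y0 \<le> 2 * (c * \<sigma>)"
      using le[of a s x0] le[of c t y0] A.s B.s A.a B.a by simp_all
  qed
  let ?A = "a * \<rho> * M ^ 2 + s * x0 * M"
  let ?B = "c * \<rho> * K ^ 2 + t * y0 * K"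
  have boundA: "\<bar>?A\<bar> \<le> c * \<sigma> * (K * K)"
  proof -
    have "s * x0 * M \<le> 2 * (a * \<sigma>) * M" using sx_le MK by (intro mult_right_mono) auto
    moreover have "(a * \<sigma>) * (M * M + 2 * M) \<le> (a * \<sigma>) * (4 * (K * K) - 1)" using MM' a\<sigma> by (intro mult_left_mono) auto
    moreover have "\<bar>a * \<rho> * M ^ 2\<bar> = (a * \<sigma>) * (M * M)" using A.a by (simp add: \<sigma>_def abs_mult power2_eq_square)
    moreover have "0 \<le> s * x0 * M" using sx MK by simp
    moreover have "\<bar>?A\<bar> \<le> \<bar>a * \<rho> * M ^ 2\<bar> + \<bar>s * x0 * M\<bar>" by (rule abs_triangle_ineq)
    ultimately show ?thesis using c4 a\<sigma> by (simp add: algebra_simps)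
  qed
  have boundB: "\<bar>?B\<bar> \<le> 3 * (c * \<sigma> * (K * K))"
  proof -
    have "t * y0 * K \<le> 2 * (c * \<sigma>) * K" using sx_le MK by (intro mult_right_mono) auto
    also have "\<dots> \<le> 2 * (c * \<sigma>) * (K * K)" using MK B.a \<sigma>0 by (intro mult_left_mono) auto
    finally have "t * y0 * K \<le> 2 * (c * \<sigma>) * (K * K)" .
    moreover have "\<bar>c * \<rho> * K ^ 2\<bar> = c * \<sigma> * (K * K)" using B.a by (simp add: \<sigma>_def abs_mult power2_eq_square)
    moreover have "0 \<le> t * y0 * K" using sx MK by simp
    moreover have "\<bar>?B\<bar> \<le> \<bar>c * \<rho> * K ^ 2\<bar> + \<bar>t * y0 * K\<bar>" by (rule abs_triangle_ineq)
    ultimately show ?thesis by linarith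
  qed
  \<comment> \<open>The two bounds add up to 4 c \<sigma> K^2, exactly what the assumption
    \<open>big\<close> keeps below the modulus; the congruence becomes an equation.\<close>
  have "\<bar>?A - ?B\<bar> < 2 * C" using boundA boundB big by (simp add: \<sigma>_def K_def power2_eq_square mult_ac)
  moreover have "2 * C dvd ?A - ?B"
    using pell_pair_cong[OF A B assms(8,9)] by (simp add: M_def K_def)
  ultimately have eq: "?A = ?B" using dvd_imp_le_int[of "?A - ?B" "2 * C"] C1 by fastforce
  show False
  proof (cases "0 < \<rho>")
    case True
    then have "\<sigma> = \<rho>" by (simp add: \<sigma>_def)
    have "s * x0 * M \<le> 2 * (a * \<sigma>) * M" using sx_le MK by (intro mult_right_mono) auto
    moreover have "(a * \<sigma>) * (M * M + 2 * M) \<le> (a * \<sigma>) * (4 * (K * K) - 1)" using MM' a\<sigma> by (intro mult_left_mono) auto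
    moreover have "0 < t * y0 * K" using sx MK by simp
    ultimately show False using eq c4 a\<sigma> \<open>\<sigma> = \<rho>\<close> by (simp add: power2_eq_square algebra_simps)
  next
    case False
    then have neg: "\<rho> < 0" using \<sigma>0 by (auto simp: \<sigma>_def)
    then have \<sigma>: "\<rho> = - \<sigma>" by (simp add: \<sigma>_def)
    have K2: "2 \<le> K"
    proof (rule ccontr)
      assume "\<not> 2 \<le> K"
      then have "n = 1" "m = 1" using MK m2n m1 by (auto simp: K_def)
      then show False using not11 neg by simp
    qed
    \<comment> \<open>For negative \<rho> the linear terms nearly cancel the quadratic ones, so only
      the small remainders F are kept apart. The main terms then leave a \<sigma> (2 K - 2), too
      much for \<open>B.F\<close> < \<sigma> once K \<ge> 2.\<close>
    have F: "s * x0 = A.F + a * \<sigma>" "t * y0 = B.F + c * \<sigma>"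
      unfolding A.F_def B.F_def using \<sigma> by simp_all
    have "- (a * \<sigma>) * M ^ 2 + s * x0 * M = - (c * \<sigma>) * K ^ 2 + t * y0 * K" using eq \<sigma> by simp
    then have "(a * \<sigma>) * (M * M - M) = c * \<sigma> * (K * K - K) - B.F * K + A.F * M"
      unfolding F by (simp add: power2_eq_square algebra_simps)
    moreover have "0 \<le> A.F * M" using A.F_pos MK by simp
    moreover have "4 * (a * \<sigma>) * (K * K - K) \<le> c * \<sigma> * (K * K - K)"
    proof -
      have "0 \<le> \<sigma> * (K * K - K)" using \<sigma>0 MK by (intro mult_nonneg_nonneg) auto
      then have "4 * a * (\<sigma> * (K * K - K)) \<le> c * (\<sigma> * (K * K - K))" using ac by (intro mult_right_mono) auto
      then show ?thesis by (simp add: mult_ac)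
    qed
    moreover have "(a * \<sigma>) * (M * M - M) \<le> (a * \<sigma>) * ((2 * K - 1) * (2 * K - 2))"
    proof (rule mult_left_mono)
      have "M * (M - 1) \<le> (2 * K - 1) * (2 * K - 2)" using MK by (intro mult_mono) auto
      then show "M * M - M \<le> (2 * K - 1) * (2 * K - 2)" by (simp add: algebra_simps)
    qed (use a\<sigma> in simp)
    ultimately have "(a * \<sigma>) * (2 * K - 2) \<le> B.F * K" by (simp add: algebra_simps)
    moreover have "B.F * K < \<sigma> * K"
    proof -
      have "B.F * \<sigma> < \<sigma> * \<sigma>" using Fc[OF neg] \<rho>C by (simp add: \<sigma>_def power2_eq_square)
      then have "B.F < \<sigma>" using \<sigma>0 by simp
      then show ?thesis using MK by simp
    qed
    moreover have "1 * \<sigma> * (2 * K - 2) \<le> a * \<sigma> * (2 * K - 2)" using A.a \<sigma>0 MK by (intro mult_right_mono) auto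
    ultimately have "\<sigma> * (2 * K - 2) < \<sigma> * K" by linarith
    then show False using \<sigma>0 K2 by simp
  qed
qed

section \<open>Quintuples\<close>

definition quint :: "int \<Rightarrow> int \<Rightarrow> int \<Rightarrow> int \<Rightarrow> int \<Rightarrow> bool" where
  "quint a b c d e \<longleftrightarrow> 0 < a \<and> a < b \<and> b < c \<and> c < d \<and> d < e \<and> sq a b \<and> sq a c \<and> sq a d \<and> sq a e
     \<and> sq b c \<and> sq b d \<and> sq b e \<and> sq c d \<and> sq c e \<and> sq d e"

lemma quint_quad: "quint a b c d e \<Longrightarrow> quad a b c d" "quint a b c d e \<Longrightarrow> quad b c d e"
  by (auto simp: quint_def quad_def)

text \<open>E differs from a, b and c because i^2 + 1 is never a square for i > 0. The element p4
  bounds both c and E, so a growth bound for the new quintuple controls them against d.\<close>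

lemma quint_insert:
  assumes "quint a b c d e" "1 \<le> E" "E < d" "sq a E" "sq b E" "sq c E" "sq d E"
  shows "\<exists>p1 p2 p3 p4. quint p1 p2 p3 p4 d \<and> c \<le> p4 \<and> E \<le> p4"
proof -
  have "E \<noteq> a" "E \<noteq> b" "E \<noteq> c" using assms not_sq_self by (auto simp: quint_def)
  then consider "E < a" | "a < E" "E < b" | "b < E" "E < c" | "c < E" by linarith
  then show ?thesis
  proof cases
    case 1
    then have "quint E a b c d \<and> c \<le> c \<and> E \<le> c" using assms by (auto simp: quint_def sq_commute)
    then show ?thesis by blast
  next
    case 2
    then have "quint a E b c d \<and> c \<le> c \<and> E \<le> c" using assms by (auto simp: quint_def sq_commute)
    then show ?thesis by blast
  next
    case 3
    then have "quint a b E c d \<and> c \<le> c \<and> E \<le> c" using assms by (auto simp: quint_def sq_commute)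
    then show ?thesis by blast
  next
    case 4
    then have "quint a b c E d \<and> c \<le> E \<and> E \<le> E" using assms by (auto simp: quint_def sq_commute)
    then show ?thesis by blast
  qed
qed

text \<open>The pair a, c is used because c > 4 a. An index n \<le> 24 would give d \<le> 1152 c
  |\<rho>|; squaring with \<rho>^2 = d E + 1 gives d \<le> 2654208 W^3, less than 120^4 W^3 \<le>
  W^7 \<le> d.\<close>

lemma nontrivial_extension_large:
  assumes q: "quint a b c d e" and z: "0 < z" "z ^ 2 = d * e + 1"
    and \<rho>: "\<rho> ^ 2 = d * E + 1" "- d < \<rho>" and E: "1 \<le> E" "E < d"
    and W: "c \<le> W" "E \<le> W" "W ^ 7 \<le> d" "120 \<le> W"
    and ext: "\<And>i s x. \<lbrakk>0 < i; i < d; 0 < s; s ^ 2 = i * d + 1; 0 < x; x ^ 2 = i * e + 1\<rbrakk>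
      \<Longrightarrow> \<exists>m x0. pell_seq i d s \<rho> x0 \<and> x0 ^ 2 = i * E + 1 \<and> 1 \<le> m \<and> pell i d s \<rho> x0 m = (z, x)"
  shows "d ^ 25 \<le> z"
proof -
  have pos: "0 < a" "a < b" "b < c" "c < d" "d < e" and sqs: "sq a b" "sq a c" "sq b c" "sq a d" "sq c d" "sq a e" "sq c e"
    using q by (auto simp: quint_def)
  obtain s where s: "0 < s" "s ^ 2 = a * d + 1" using sqs pos by (auto elim: sqE)
  obtain t where t: "0 < t" "t ^ 2 = c * d + 1" using sqs pos by (auto elim: sqE)
  obtain x where x: "0 < x" "x ^ 2 = a * e + 1" using sqs pos by (auto elim: sqE)
  obtain y where y: "0 < y" "y ^ 2 = c * e + 1" using sqs pos by (auto elim: sqE)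
  obtain m x0 where m: "pell_seq a d s \<rho> x0" "x0 ^ 2 = a * E + 1" "1 \<le> m" "pell a d s \<rho> x0 m = (z, x)"
    using ext[of a s x] pos s x by auto
  obtain n y0 where n: "pell_seq c d t \<rho> y0" "y0 ^ 2 = c * E + 1" "1 \<le> n" "pell c d t \<rho> y0 n = (z, y)"
    using ext[of c t y] pos t y by auto
  interpret A: pell_seq a d s \<rho> x0 by fact
  interpret B: pell_seq c d t \<rho> y0 by fact
  have Zm: "A.Z m = z" and Zn: "B.Z n = z" using m n by (simp_all add: A.Z_def B.Z_def)
  \<comment> \<open>In this case z < 2 d F with F^2 = a c + 1 < b c + 1, too small for the gap of
    the quadruple b, c, d, e.\<close>
  have not11: "\<not> (m = 1 \<and> n = 1 \<and> \<rho> < 0)"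
  proof
    assume h: "m = 1 \<and> n = 1 \<and> \<rho> < 0"
    have za: "z = \<rho> + 2 * d * A.F" "z = \<rho> + 2 * d * B.F" using Zm Zn A.Z_1 B.Z_1 h by auto
    then have "A.F = B.F" using pos by simp
    then have F: "A.F ^ 2 = a * c + 1"
      using common_F[OF _ \<rho>(1) s(2) t(2) m(2) n(2), of A.F] pos by (simp add: A.F_def B.F_def)
    obtain r where r: "0 < r" "r ^ 2 = b * c + 1" using sqs pos by (auto elim: sqE)
    have "A.F < r"
    proof (rule square_root_le(2))
      have "a * c < b * c" using pos by (intro mult_strict_right_mono) auto
      then show "A.F ^ 2 < r ^ 2" unfolding F r by simp
    qed (use r in simp)
    then have "d * (2 * A.F + 1) \<le> d * (2 * r - 1)" using pos by (intro mult_left_mono) auto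
    moreover have "d * (2 * r - 1) + 1 \<le> z" by (rule quadruple_gap[OF quint_quad(2)[OF q] r z])
    ultimately show False using za h pos by (simp add: algebra_simps)
  qed
  have ac: "4 * a \<le> c" using triple_gap[of a b c] pos sqs by simp
  have large: "2 * d \<le> 4 * c * \<bar>\<rho>\<bar> * int n ^ 2"
    by (rule nontrivial_start_index[OF m(1) n(1) ac E \<rho> m(4) n(4) m(3) n(3) not11])
  have "25 \<le> n"
  proof (rule ccontr)
    assume "\<not> 25 \<le> n"
    then have "int n ^ 2 \<le> 24 ^ 2" by (intro power_mono) auto
    then have "4 * c * \<bar>\<rho>\<bar> * int n ^ 2 \<le> 4 * c * \<bar>\<rho>\<bar> * 24 ^ 2" using pos by (intro mult_left_mono) auto
    then have "d \<le> 1152 * (c * \<bar>\<rho>\<bar>)" using large by simp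
    then have "d ^ 2 \<le> (1152 * (c * \<bar>\<rho>\<bar>)) ^ 2" using pos by (intro power_mono) auto
    also have "\<dots> = 1327104 * (c ^ 2 * (d * E + 1))" by (simp add: power_mult_distrib \<rho>(1))
    also have "\<dots> \<le> 1327104 * (W ^ 2 * (2 * (d * W)))"
    proof (intro mult_left_mono mult_mono power_mono)
      have "d * E \<le> d * W" "1 * 1 \<le> d * W" using pos W by (intro mult_left_mono mult_mono; simp)+
      then show "d * E + 1 \<le> 2 * (d * W)" by simp
    qed (use pos W E in auto)
    also have "\<dots> = d * (2654208 * W ^ 3)" by (simp add: power2_eq_square power3_eq_cube)
    finally have "d \<le> 2654208 * W ^ 3" using pos by (simp add: power2_eq_square)
    moreover have "120 ^ 4 * W ^ 3 \<le> W ^ 4 * W ^ 3" using W by (intro mult_right_mono power_mono) auto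
    moreover have "W ^ 4 * W ^ 3 = W ^ 7" by (simp flip: power_add)
    moreover have "0 < W ^ 3" using W by simp
    ultimately show False using W(3) by simp
  qed
  then obtain k where k: "n = Suc (24 + k)" using le_Suc_ex by (metis Suc_eq_plus1 add.commute add_Suc numeral_plus_one semiring_norm(5) add_One)
  have "1 * d \<le> c * d" using pos by (intro mult_right_mono) auto
  then have "d \<le> 1 + 4 * c * d" using pos by linarith
  then have "d ^ 24 * d \<le> (1 + 4 * c * d) ^ 24 * (d + 1)" using pos by (intro mult_mono power_mono) auto
  also have "\<dots> \<le> (1 + 4 * c * d) ^ (24 + k) * (d + 1)" using pos by (intro mult_right_mono power_increasing) auto
  also have "\<dots> \<le> z" using B.Z_ge[OF \<rho>(2), of "24 + k"] Zn k by simp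
  finally show ?thesis by (simp flip: power_Suc2)
qed

text \<open>A nonzero \<open>E\<close> yields a smaller quintuple containing \<open>d\<close> as its largest element.\<close>

lemma quint_cases:
  assumes q: "quint a b c d e"
  obtains (trivial) \<epsilon> z where "\<epsilon> = 1 \<or> \<epsilon> = - 1" "0 < z" "z ^ 2 = d * e + 1"
      "\<And>i s x. \<lbrakk>0 < i; i < d; 0 < s; s ^ 2 = i * d + 1; 0 < x; x ^ 2 = i * e + 1\<rbrakk>
        \<Longrightarrow> \<exists>m. pell_seq i d s \<epsilon> 1 \<and> 1 \<le> m \<and> pell i d s \<epsilon> 1 m = (z, x)"
  | (nontrivial) \<rho> E z p1 p2 p3 p4 where "0 < z" "z ^ 2 = d * e + 1" "\<rho> ^ 2 = d * E + 1" "- d < \<rho>" "1 \<le> E" "E < d"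
      "quint p1 p2 p3 p4 d" "c \<le> p4" "E \<le> p4"
      "\<And>i s x. \<lbrakk>0 < i; i < d; 0 < s; s ^ 2 = i * d + 1; 0 < x; x ^ 2 = i * e + 1\<rbrakk>
        \<Longrightarrow> \<exists>m x0. pell_seq i d s \<rho> x0 \<and> x0 ^ 2 = i * E + 1 \<and> 1 \<le> m \<and> pell i d s \<rho> x0 m = (z, x)"
proof -
  have pos: "0 < a" "a < b" "b < c" "c < d" "d < e" and sqs: "sq a d" "sq b d" "sq c d" "sq a e" "sq b e" "sq c e" "sq d e"
    using q by (auto simp: quint_def)
  obtain z where z: "0 < z" "z ^ 2 = d * e + 1" using sqs pos by (auto elim: sqE)
  have d2: "2 \<le> d" using pos by simp
  obtain \<rho> E where \<rho>: "\<rho> ^ 2 = d * E + 1" "- d < \<rho>" "\<rho> \<le> d" "0 \<le> E" "E < d"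
    and ext: "\<And>i s x. \<lbrakk>0 < i; i < d; 0 < s; s ^ 2 = i * d + 1; 0 < x; x ^ 2 = i * e + 1\<rbrakk>
        \<Longrightarrow> \<exists>m x0. pell_seq i d s \<rho> x0 \<and> x0 ^ 2 = i * E + 1 \<and> 1 \<le> m \<and> pell i d s \<rho> x0 m = (z, x)"
    by (rule residue_extension[OF d2 pos(5) z]) blast
  show thesis
  proof (cases "E = 0")
    case True
    show thesis
    proof (rule trivial[OF _ z])
      have "(\<rho> - 1) * (\<rho> + 1) = 0" using \<rho>(1) True by (simp add: power2_eq_square algebra_simps)
      then show "\<rho> = 1 \<or> \<rho> = - 1" by auto
    next
      fix i s x :: int
      assume h: "0 < i" "i < d" "0 < s" "s ^ 2 = i * d + 1" "0 < x" "x ^ 2 = i * e + 1"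
      obtain m x0 where m: "pell_seq i d s \<rho> x0" "x0 ^ 2 = i * E + 1" "1 \<le> m" "pell i d s \<rho> x0 m = (z, x)"
        using ext[OF h] by blast
      have "x0 ^ 2 = 1 ^ 2" using m(2) True by simp
      then have "x0 = 1" by (rule power2_eq_imp_eq) (use pell_seq.x0[OF m(1)] in auto)
      then show "\<exists>m. pell_seq i d s \<rho> 1 \<and> 1 \<le> m \<and> pell i d s \<rho> 1 m = (z, x)" using m by blast
    qed
  next
    case False
    then have E1: "1 \<le> E" using \<rho> by simp
    have sqE': "sq i E" if i: "0 < i" "i < d" "sq i d" "sq i e" for i
    proof -
      obtain s where s: "0 < s" "s ^ 2 = i * d + 1" using i pos by (auto elim: sqE)
      obtain x where x: "0 < x" "x ^ 2 = i * e + 1" using i pos by (auto elim: sqE)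
      show ?thesis using ext[OF i(1,2) s x] by (auto simp: sq_def)
    qed
    have "sq d E" using \<rho>(1) by (auto simp: sq_def)
    then obtain p1 p2 p3 p4 where "quint p1 p2 p3 p4 d" "c \<le> p4" "E \<le> p4"
      using quint_insert[OF q E1 \<rho>(5)] sqE'[of a] sqE'[of b] sqE'[of c] pos sqs by auto
    then show thesis using nontrivial[OF z \<rho>(1,2) E1 \<rho>(5) _ _ _ ext] by blast
  qed
qed

text \<open>By z^2 = d e + 1 it is enough that z \<ge> d^4. If E = 0, some index is at least 4; if E
  > 0, the induction hypothesis for the quintuple ending in d supplies the bound W^7 \<le> d that
  makes the index large.\<close>

lemma quint_growth: "quint a b c d e \<Longrightarrow> d ^ 7 \<le> e"
proof (induction "nat e" arbitrary: a b c d e rule: less_induct)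
  case less
  note q = less.prems
  have pos: "0 < a" "a < b" "b < c" "c < d" "d < e" and sqs: "sq a d" "sq b d" "sq a e" "sq b e"
    using q by (auto simp: quint_def)
  have dl: "36 * b + 1 \<le> d" "120 \<le> d" using quadruple_lower_bound[OF quint_quad(1)[OF q]] by auto
  have "d ^ 7 \<le> e" if z: "0 < z" "z ^ 2 = d * e + 1" "d ^ 4 \<le> z" for z
  proof -
    have "(d ^ 4) ^ 2 \<le> z ^ 2" using z pos by (intro power_mono) auto
    moreover have "(d ^ 4) ^ 2 = d * d ^ 7" by (simp flip: power_mult power_Suc)
    ultimately have "d * d ^ 7 < d * (e + 1)" unfolding z(2) using pos by (simp add: algebra_simps)
    then have "d ^ 7 < e + 1" using pos by simp
    then show ?thesis by simp
  qed
  note suff = this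
  show ?case
  proof (rule quint_cases[OF q])
    fix \<epsilon> z
    assume \<epsilon>: "\<epsilon> = 1 \<or> \<epsilon> = - 1" and z: "0 < z" "z ^ 2 = d * e + 1"
      and ext: "\<And>i s x. \<lbrakk>0 < i; i < d; 0 < s; s ^ 2 = i * d + 1; 0 < x; x ^ 2 = i * e + 1\<rbrakk>
        \<Longrightarrow> \<exists>m. pell_seq i d s \<epsilon> 1 \<and> 1 \<le> m \<and> pell i d s \<epsilon> 1 m = (z, x)"
    obtain s where s: "0 < s" "s ^ 2 = a * d + 1" using sqs pos by (auto elim: sqE)
    obtain t where t: "0 < t" "t ^ 2 = b * d + 1" using sqs pos by (auto elim: sqE)
    obtain x where x: "0 < x" "x ^ 2 = a * e + 1" using sqs pos by (auto elim: sqE)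
    obtain y where y: "0 < y" "y ^ 2 = b * e + 1" using sqs pos by (auto elim: sqE)
    obtain m where m: "pell_seq a d s \<epsilon> 1" "1 \<le> m" "pell a d s \<epsilon> 1 m = (z, x)"
      using ext[of a s x] pos s x by auto
    obtain n where n: "pell_seq b d t \<epsilon> 1" "1 \<le> n" "pell b d t \<epsilon> 1 n = (z, y)"
      using ext[of b t y] pos t y by auto
    have \<epsilon>d: "- d < \<epsilon>" using \<epsilon> pos by auto
    have large: "d ^ 4 \<le> z" if P: "pell_seq i d u \<epsilon> 1" "pell i d u \<epsilon> 1 l = (z, w)" "4 \<le> l" for i u l w
    proof -
      interpret P: pell_seq i d u \<epsilon> 1 by fact
      obtain k where k: "l = Suc (3 + k)" using P(3) le_Suc_ex[of 4 l] by auto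
      have "1 * d \<le> i * d" using P.a pos by (intro mult_right_mono) auto
      then have "d \<le> 1 + 4 * i * d" using pos by linarith
      then have "d ^ 3 * d \<le> (1 + 4 * i * d) ^ 3 * (d + 1)" using pos by (intro mult_mono power_mono) auto
      also have "\<dots> \<le> (1 + 4 * i * d) ^ (3 + k) * (d + 1)" using P.a pos by (intro mult_right_mono power_increasing) auto
      also have "\<dots> \<le> z" using P.Z_ge[OF \<epsilon>d, of "3 + k"] P(2) k by (simp add: P.Z_def)
      finally show ?thesis by (simp flip: power_Suc2)
    qed
    have "4 \<le> m \<or> 4 \<le> n"
      by (rule trivial_start_index_four[OF m(1) n(1) pos(2) \<epsilon> m(3) n(3) m(2) dl])
    then show "d ^ 7 \<le> e" using suff[OF z] large[OF m(1,3)] large[OF n(1,3)] by blast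
  next
    fix \<rho> E z p1 p2 p3 p4
    assume z: "0 < z" "z ^ 2 = d * e + 1" and \<rho>: "\<rho> ^ 2 = d * E + 1" "- d < \<rho>" and E: "1 \<le> E" "E < d"
      and q': "quint p1 p2 p3 p4 d" "c \<le> p4" "E \<le> p4"
      and ext: "\<And>i s x. \<lbrakk>0 < i; i < d; 0 < s; s ^ 2 = i * d + 1; 0 < x; x ^ 2 = i * e + 1\<rbrakk>
        \<Longrightarrow> \<exists>m x0. pell_seq i d s \<rho> x0 \<and> x0 ^ 2 = i * E + 1 \<and> 1 \<le> m \<and> pell i d s \<rho> x0 m = (z, x)"
    have "p4 ^ 7 \<le> d" using less.hyps[OF _ q'(1)] pos by simp
    moreover have "120 \<le> p4" using quadruple_lower_bound[OF quint_quad(1)[OF q'(1)]] by simp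
    ultimately have "d ^ 25 \<le> z"
      using nontrivial_extension_large[OF q z \<rho> E q'(2,3) _ _ ext] by blast
    moreover have "d ^ 4 \<le> d ^ 25" using pos by (intro power_increasing) auto
    ultimately show "d ^ 7 \<le> e" using suff[OF z] by simp
  qed
qed

section \<open>Numerical conditions excluding E = 0\<close>

lemma pell_solution_list:
  fixes a b r s t H :: int and S :: "(int \<times> int) set"
  assumes a: "0 < a" "a < b" and r: "r ^ 2 = a * b + 1" "0 < r"
    and base: "\<And>s t. 1 \<le> s \<Longrightarrow> s \<le> b \<Longrightarrow> 1 \<le> t \<Longrightarrow> t \<le> b \<Longrightarrow> b * s ^ 2 - a * t ^ 2 = b - a \<Longrightarrow> (s, t) \<in> S"
    and step: "\<And>s t. (s, t) \<in> S \<Longrightarrow> r * s + a * t \<le> H \<Longrightarrow> (r * s + a * t, r * t + b * s) \<in> S"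
    and st: "1 \<le> s" "1 \<le> t" "b * s ^ 2 - a * t ^ 2 = b - a" "s \<le> H"
  shows "(s, t) \<in> S"
  using st
proof (induction "nat s" arbitrary: s t rule: less_induct)
  case less
  note st = less.prems
  have bs: "b * s ^ 2 = a * t ^ 2 + (b - a)" using st by simp
  have rab: "r ^ 2 - a * b = 1" using r by simp
  show ?case
  proof (cases "t \<le> b")
    case True
    have "s \<le> b"
    proof (rule square_root_le)
      have "t ^ 2 \<le> b ^ 2" using True st by (intro power_mono) auto
      then have "a * t ^ 2 \<le> a * b ^ 2" using a by (intro mult_left_mono) auto
      moreover have "b * (a * b + 1) = a * b ^ 2 + b" by (simp add: power2_eq_square algebra_simps)
      ultimately have "b * s ^ 2 \<le> b * (a * b + 1)" using bs a by linarith
      then have "s ^ 2 \<le> a * b + 1" using a by simp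
      moreover have "a * b + 1 \<le> (b - 1) * b + 1" using a by (intro add_mono mult_right_mono) auto
      moreover have "(b - 1) * b + 1 \<le> b ^ 2" using a by (simp add: power2_eq_square algebra_simps)
      ultimately show "s ^ 2 \<le> b ^ 2" by linarith
    qed (use a in simp)
    then show ?thesis using base st True by blast
  next
    case False
    \<comment> \<open>Multiplication by the inverse unit r - sqrt (a b). Both components stay
      positive: for t' this uses t > b, which gives t^2 > b (b - a).\<close>
    define s' t' where "s' = r * s - a * t" and "t' = r * t - b * s"
    have "(r * s) ^ 2 - (a * t) ^ 2 = s ^ 2 + a * (b * s ^ 2 - a * t ^ 2)"
      unfolding power_mult_distrib r by (simp add: power2_eq_square algebra_simps)
    then have "(a * t) ^ 2 < (r * s) ^ 2" unfolding st(3) using a st zero_less_power[of s 2] mult_pos_pos[of a "b - a"] by linarith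
    then have s': "1 \<le> s'" using add_pos_of_square_less(2)[of "r * s" "a * t"] r st by (simp add: s'_def)
    have "(r * t) ^ 2 - (b * s) ^ 2 = t ^ 2 - b * (b * s ^ 2 - a * t ^ 2)"
      unfolding power_mult_distrib r by (simp add: power2_eq_square algebra_simps)
    moreover have "b * (b - a) < t ^ 2"
    proof -
      have "b * (b - a) \<le> b * b" using a by (intro mult_left_mono) auto
      also have "b * b < t * t" using False a by (intro mult_strict_mono) auto
      finally show ?thesis by (simp add: power2_eq_square)
    qed
    ultimately have "(b * s) ^ 2 < (r * t) ^ 2" unfolding st(3) by simp
    then have t': "1 \<le> t'" using add_pos_of_square_less(2)[of "r * t" "b * s"] r st by (simp add: t'_def)
    have eq': "b * s' ^ 2 - a * t' ^ 2 = b - a"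
    proof -
      have "b * s' ^ 2 - a * t' ^ 2 = (r ^ 2 - a * b) * (b * s ^ 2 - a * t ^ 2)"
        by (simp add: s'_def t'_def power2_eq_square algebra_simps)
      then show ?thesis unfolding rab st(3) by simp
    qed
    have inv: "r * s' + a * t' = s" "r * t' + b * s' = t"
    proof -
      have "r * s' + a * t' = (r ^ 2 - a * b) * s" "r * t' + b * s' = (r ^ 2 - a * b) * t"
        by (simp_all add: s'_def t'_def power2_eq_square algebra_simps)
      then show "r * s' + a * t' = s" "r * t' + b * s' = t" unfolding rab by simp_all
    qed
    have "1 * s' \<le> r * s'" using r s' by (intro mult_right_mono) simp_all
    moreover have "0 < a * t'" using a t' by (intro mult_pos_pos) simp_all
    ultimately have "s' < s" using inv by linarith
    then have "(s', t') \<in> S" using less.hyps[of s' t'] s' t' eq' st by simp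
    then show ?thesis using step[of s' t'] inv st by simp
  qed
qed

text \<open>The condition on \<open>L\<close> makes the upper bound for \<open>z\<close> at most \<open>(4 a d)^L d\<close>, which a term of index
  greater than \<open>L\<close> exceeds.\<close>

lemma trivial_start_index_le:
  fixes a b d e \<epsilon> s t x y z :: int and \<sigma> L m n :: nat
  assumes pos: "0 < a" "a < b" "b < d" "100 \<le> d" and \<epsilon>: "\<epsilon> = 1 \<or> \<epsilon> = - 1"
    and s: "0 < s" "s ^ 2 = a * d + 1" and t: "0 < t" "t ^ 2 = b * d + 1"
    and x: "0 < x" "x ^ 2 = a * e + 1" and y: "0 < y" "y ^ 2 = b * e + 1" and z: "0 < z" "z ^ 2 = d * e + 1"
    and m: "pell_seq a d s \<epsilon> 1" "pell a d s \<epsilon> 1 m = (z, x)"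
    and n: "pell_seq b d t \<epsilon> 1" "pell b d t \<epsilon> 1 n = (z, y)"
    and \<sigma>: "17 * b ^ 3 * d * (85 * b ^ 4) ^ \<sigma> \<le> (8 * a * d) ^ \<sigma>"
    and L: "2 * b * (16 * a ^ 2 * b) ^ \<sigma> \<le> 5 ^ \<sigma> * (4 * a) ^ L * d ^ (L - 3 * \<sigma>)" "3 * \<sigma> \<le> L"
  shows "m \<le> L \<and> n \<le> L"
proof -
  interpret approximants a b d by unfold_locales (use pos in auto)
  have ub: "z * 5 ^ \<sigma> \<le> 2 * b * d * (16 * a ^ 2 * b * d ^ 3) ^ \<sigma>"
    by (rule extension_bound[where s = s and t = t and x' = x and y = y and e = e]) (use assms in auto)
  have \<epsilon>d: "- d < \<epsilon>" using \<epsilon> pos by auto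
  have "z < (4 * a * d) ^ L * (d + 1)"
  proof (rule ccontr)
    assume "\<not> ?thesis"
    then have "(4 * a * d) ^ L * (d + 1) * 5 ^ \<sigma> \<le> z * 5 ^ \<sigma>" by (intro mult_right_mono) auto
    also have "\<dots> \<le> 2 * b * d * (16 * a ^ 2 * b * d ^ 3) ^ \<sigma>" by (rule ub)
    also have "\<dots> = (2 * b * (16 * a ^ 2 * b) ^ \<sigma>) * (d * d ^ (3 * \<sigma>))"
      by (simp add: power_mult_distrib power_mult)
    also have "\<dots> \<le> (5 ^ \<sigma> * (4 * a) ^ L * d ^ (L - 3 * \<sigma>)) * (d * d ^ (3 * \<sigma>))"
      using L(1) pos by (intro mult_right_mono) auto
    also have "\<dots> = 5 ^ \<sigma> * (4 * a) ^ L * d * (d ^ (L - 3 * \<sigma>) * d ^ (3 * \<sigma>))" by (simp only: mult_ac)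
    also have "d ^ (L - 3 * \<sigma>) * d ^ (3 * \<sigma>) = d ^ L" using L(2) by (simp flip: power_add)
    also have "5 ^ \<sigma> * (4 * a) ^ L * d * d ^ L = (4 * a * d) ^ L * d * 5 ^ \<sigma>"
      by (simp only: power_mult_distrib mult_ac)
    finally have "(4 * a * d) ^ L * (d + 1) * 5 ^ \<sigma> \<le> (4 * a * d) ^ L * d * 5 ^ \<sigma>" .
    then show False using pos by simp
  qed
  note zlt = this
  have le: "l \<le> L" if P: "pell_seq i d u \<epsilon> 1" "pell i d u \<epsilon> 1 l = (z, w)" "a \<le> i" for i u l w
  proof (rule ccontr)
    assume "\<not> l \<le> L"
    then obtain k where k: "l = Suc (L + k)" using less_imp_Suc_add not_le by blast
    interpret P: pell_seq i d u \<epsilon> 1 by fact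
    have "a * d \<le> i * d" using P(3) pos by (intro mult_right_mono) auto
    moreover have "0 < i * d" using pos P.a by simp
    ultimately have ai: "4 * a * d \<le> 1 + 4 * i * d" "1 \<le> 1 + 4 * i * d" by linarith+
    then have "(4 * a * d) ^ L * (d + 1) \<le> (1 + 4 * i * d) ^ L * (d + 1)"
      using pos by (intro mult_right_mono power_mono) auto
    also have "\<dots> \<le> (1 + 4 * i * d) ^ (L + k) * (d + 1)"
      using pos ai by (intro mult_right_mono power_increasing) auto
    also have "\<dots> \<le> z" using P.Z_ge[OF \<epsilon>d, of "L + k"] P(2) k by (simp add: P.Z_def)
    finally show False using zlt by simp
  qed
  show ?thesis using le[OF m] le[OF n] pos by simp
qed

text \<open>One power of d cancels, after which d occurs only on the right; so the inequality at a
  lower bound D suffices.\<close>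

lemma sigma_condition_mono:
  fixes a b D d :: int
  assumes "0 < a" "0 < b" "0 < D" "D \<le> d" "17 * b ^ 3 * (85 * b ^ 4) ^ Suc j \<le> (8 * a) ^ Suc j * D ^ j"
  shows "17 * b ^ 3 * d * (85 * b ^ 4) ^ Suc j \<le> (8 * a * d) ^ Suc j"
proof -
  have "17 * b ^ 3 * d * (85 * b ^ 4) ^ Suc j = (17 * b ^ 3 * (85 * b ^ 4) ^ Suc j) * d" by (simp only: mult_ac)
  also have "\<dots> \<le> ((8 * a) ^ Suc j * d ^ j) * d"
  proof (rule mult_right_mono)
    have "(8 * a) ^ Suc j * D ^ j \<le> (8 * a) ^ Suc j * d ^ j"
      using assms by (intro mult_left_mono power_mono) auto
    then show "17 * b ^ 3 * (85 * b ^ 4) ^ Suc j \<le> (8 * a) ^ Suc j * d ^ j" using assms(5) by simp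
  qed (use assms in simp)
  also have "\<dots> = (8 * a * d) ^ Suc j" unfolding power_mult_distrib[of _ d] by (simp only: power_Suc mult_ac)
  finally show ?thesis .
qed

lemma index_condition_mono:
  fixes a b D d :: int
  assumes "0 < a" "0 < D" "D \<le> d" "2 * b * (16 * a ^ 2 * b) ^ \<sigma> \<le> 5 ^ \<sigma> * (4 * a) ^ L * D ^ M"
  shows "2 * b * (16 * a ^ 2 * b) ^ \<sigma> \<le> 5 ^ \<sigma> * (4 * a) ^ L * d ^ M"
proof -
  have "5 ^ \<sigma> * (4 * a) ^ L * D ^ M \<le> 5 ^ \<sigma> * (4 * a) ^ L * d ^ M"
    using assms by (intro mult_left_mono power_mono) auto
  then show ?thesis using assms(4) by linarith
qed

text \<open>The case E = 0 stated for a, b, d and e alone, so that it can be refuted by inequalities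
  between a, b and d.\<close>

definition regular_start :: "int \<Rightarrow> int \<Rightarrow> int \<Rightarrow> int \<Rightarrow> bool" where
  "regular_start a b d e \<longleftrightarrow> 0 < a \<and> a < b \<and> b < d \<and> 100 \<le> d \<and> (\<exists>\<epsilon> s t x y z m n. (\<epsilon> = 1 \<or> \<epsilon> = - 1)
     \<and> 0 < s \<and> s ^ 2 = a * d + 1 \<and> 0 < t \<and> t ^ 2 = b * d + 1 \<and> 0 < x \<and> x ^ 2 = a * e + 1
     \<and> 0 < y \<and> y ^ 2 = b * e + 1 \<and> 0 < z \<and> z ^ 2 = d * e + 1 \<and> 1 \<le> m \<and> 1 \<le> n
     \<and> pell_seq a d s \<epsilon> 1 \<and> pell a d s \<epsilon> 1 m = (z, x) \<and> pell_seq b d t \<epsilon> 1 \<and> pell b d t \<epsilon> 1 n = (z, y))"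

text \<open>Both indices are at most L, hence d - L^2 \<le> 2 t L. Squaring with t^2 = b d + 1 keeps
  d below 4 L^2 b + 2 L^2 + 1. The number \<sigma> is \<open>Suc j\<close>, which makes it
  positive.\<close>

lemma no_regular_start:
  fixes a b d e D :: int and j L :: nat
  assumes "D \<le> d" "0 < D"
    and "17 * b ^ 3 * (85 * b ^ 4) ^ Suc j \<le> (8 * a) ^ Suc j * D ^ j"
    and "2 * b * (16 * a ^ 2 * b) ^ Suc j \<le> 5 ^ Suc j * (4 * a) ^ L * D ^ (L - 3 * Suc j)" "3 * Suc j \<le> L" "2 \<le> L"
    and D: "4 * int L ^ 2 * b + 2 * int L ^ 2 + 1 \<le> D"
  shows "\<not> regular_start a b d e"
proof
  assume "regular_start a b d e"
  then obtain \<epsilon> s t x y z m n where h: "0 < a" "a < b" "b < d" "100 \<le> d" "\<epsilon> = 1 \<or> \<epsilon> = - 1"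
     "0 < s" "s ^ 2 = a * d + 1" "0 < t" "t ^ 2 = b * d + 1" "0 < x" "x ^ 2 = a * e + 1"
     "0 < y" "y ^ 2 = b * e + 1" "0 < z" "z ^ 2 = d * e + 1"
     "pell_seq a d s \<epsilon> 1" "pell a d s \<epsilon> 1 m = (z, x)" "pell_seq b d t \<epsilon> 1" "pell b d t \<epsilon> 1 n = (z, y)" "1 \<le> m" "1 \<le> n"
    unfolding regular_start_def by blast
  have b0: "0 < b" using h by simp
  have "m \<le> L \<and> n \<le> L"
    by (rule trivial_start_index_le[OF h(1-19) sigma_condition_mono[OF h(1) b0 assms(2,1,3)]
          index_condition_mono[OF h(1) assms(2,1,4)] assms(5)])
  then have le: "d \<le> 2 * t * int L + int L ^ 2"
    using trivial_start_index_small[OF h(16,18,2,5,17,19,20)] by blast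
  define l where "l = int L"
  have l: "2 \<le> l" using assms by (simp add: l_def)
  have D': "4 * l ^ 2 * b + 2 * l ^ 2 + 1 \<le> d" using D assms(1) by (simp add: l_def)
  have l2: "4 \<le> l ^ 2" using power_mono[OF l, of 2] by simp
  have "0 \<le> 4 * l ^ 2 * b" using h by simp
  then have "l ^ 2 \<le> d" using D' l2 by linarith
  moreover have "d - l ^ 2 \<le> 2 * t * l" using le by (simp add: l_def)
  ultimately have "(d - l ^ 2) ^ 2 \<le> (2 * t * l) ^ 2" by (intro power_mono) auto
  also have "\<dots> = 4 * (b * d + 1) * l ^ 2" unfolding power_mult_distrib h(9) by simp
  finally have "d * d + l ^ 2 * l ^ 2 \<le> d * (4 * l ^ 2 * b + 2 * l ^ 2) + 4 * l ^ 2"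
    by (simp add: power2_eq_square algebra_simps)
  moreover have "d * (4 * l ^ 2 * b + 2 * l ^ 2 + 1) \<le> d * d" using D' h by (intro mult_left_mono) auto
  moreover have "4 * l ^ 2 \<le> l ^ 2 * l ^ 2" using l2 by (intro mult_right_mono) auto
  ultimately show False using h by (simp add: algebra_simps)
qed

lemma no_regular_start_large:
  assumes b: "20 \<le> b" "0 < a" "a < b" and d: "b ^ 5 < d"
  shows "\<not> regular_start a b d e"
\<comment> \<open>Here \<sigma> = 44. At D = b^5 the power of b is 3 + 4 * 44 = 179 on the left and
  5 * 43 = 215 on the right, so 17 * 85^44 \<le> 8^44 * 20^36 suffices. The exponent L - 3 \<sigma>
  is 46, and 4 L^2 = 126736 lies below 20^4.\<close>
proof (rule no_regular_start[where D = "b ^ 5" and j = 43 and L = 178])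
  have "17 * 85 ^ Suc 43 \<le> (8 :: int) ^ Suc 43 * 20 ^ 36" by simp
  also have "(8 :: int) ^ Suc 43 * 20 ^ 36 \<le> (8 * a) ^ Suc 43 * b ^ 36"
    by (rule mult_mono; (rule power_mono)?) (use b in auto)
  finally have "(17 * 85 ^ Suc 43) * b ^ 179 \<le> ((8 * a) ^ Suc 43 * b ^ 36) * b ^ 179"
    by (rule mult_right_mono) (use b in simp)
  moreover have "17 * b ^ 3 * (85 * b ^ 4) ^ n = (17 * 85 ^ n) * b ^ (3 + 4 * n)" for n
    by (simp add: power_mult_distrib power_add power_mult)
  moreover have "3 + 4 * Suc 43 = (179 :: nat)" by simp
  moreover have "(b ^ 5) ^ 43 = b ^ 36 * b ^ 179" by (simp flip: power_mult power_add)
  ultimately show "17 * b ^ 3 * (85 * b ^ 4) ^ Suc 43 \<le> (8 * a) ^ Suc 43 * (b ^ 5) ^ 43"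
    by (simp only: mult.assoc)
  have b5: "16 * a ^ 2 * b \<le> b ^ 5" "2 * b \<le> b ^ 5"
  proof -
    have "20 * 20 \<le> b * b" by (rule mult_mono) (use b in auto)
    then have "16 \<le> b * b" by simp
    moreover have "a ^ 2 \<le> b ^ 2" by (rule power_mono) (use b in auto)
    ultimately have "16 * a ^ 2 * b \<le> (b * b) * b ^ 2 * b" by (intro mult_mono) (use b in auto)
    then show "16 * a ^ 2 * b \<le> b ^ 5" by (simp add: eval_nat_numeral mult_ac)
    have "2 ^ 4 \<le> b ^ 4" by (rule power_mono) (use b in auto)
    then have "2 * b \<le> b ^ 4 * b" by (intro mult_right_mono) (use b in auto)
    then show "2 * b \<le> b ^ 5" by (simp add: eval_nat_numeral mult_ac)
  qed
  have main: "2 * b * (16 * a ^ 2 * b) ^ n \<le> 5 ^ n * (4 * a) ^ l * (b ^ 5) ^ Suc (Suc n)" for n l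
  proof -
    have B: "1 \<le> b ^ 5" using b5 b by linarith
    have "2 * b * (16 * a ^ 2 * b) ^ n \<le> b ^ 5 * (b ^ 5) ^ n"
      by (rule mult_mono[OF b5(2) power_mono[OF b5(1)]]) (use b in auto)
    also have "\<dots> = (b ^ 5) ^ Suc n" by simp
    also have "\<dots> \<le> (b ^ 5) ^ Suc (Suc n)" by (rule power_increasing[OF _ B]) simp
    also have "\<dots> = 1 * (b ^ 5) ^ Suc (Suc n)" by simp
    also have "\<dots> \<le> (5 ^ n * (4 * a) ^ l) * (b ^ 5) ^ Suc (Suc n)"
    proof (rule mult_right_mono)
      have "1 * 1 \<le> 5 ^ n * (4 * a) ^ l" by (rule mult_mono[OF one_le_power one_le_power]) (use b in auto)
      then show "1 \<le> 5 ^ n * (4 * a) ^ l" by simp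
    qed (rule zero_le_power, use b in simp)
    finally show ?thesis .
  qed
  have "178 - 3 * Suc 43 = Suc (Suc (Suc 43))" by simp
  then show "2 * b * (16 * a ^ 2 * b) ^ Suc 43 \<le> 5 ^ Suc 43 * (4 * a) ^ 178 * (b ^ 5) ^ (178 - 3 * Suc 43)"
    using main[of "Suc 43" 178] by (simp only:)
  have "20 ^ 4 * b \<le> b ^ 4 * b" by (intro mult_right_mono power_mono) (use b in auto)
  then have "160000 * b \<le> b ^ 5" by (simp add: eval_nat_numeral mult_ac)
  then show "4 * int 178 ^ 2 * b + 2 * int 178 ^ 2 + 1 \<le> b ^ 5" using b by simp
  show "b ^ 5 \<le> d" "0 < b ^ 5" using b d by simp_all
qed simp_all

section \<open>Pairs with second element below 20\<close>

text \<open>Used as a rewrite rule to unroll quantifiers over explicit intervals, so that finite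
  searches run in the simplifier.\<close>

lemma ball_int_interval:
  "(\<forall>x\<in>{i..j :: int}. P x) \<longleftrightarrow> (if i \<le> j then P i \<and> (\<forall>x\<in>{i + 1..j}. P x) else True)"
proof -
  have "{i..j} = insert i {i + 1..j}" if "i \<le> j" using that by auto
  then show ?thesis by auto
qed

text \<open>Every solution of \<open>b s^2 - a t^2 = b - a\<close> with \<open>t > b\<close> arises from a smaller one by multiplication
  with \<open>r + sqrt (a b)\<close>, so closure of \<open>S\<close> under this step up to \<open>H\<close> is enough.\<close>

definition solutions_complete :: "int \<Rightarrow> int \<Rightarrow> int \<Rightarrow> int \<Rightarrow> int \<Rightarrow> (int \<times> int) list \<Rightarrow> bool" where
  "solutions_complete a b r H D S \<longleftrightarrow> 0 < a \<and> a < b \<and> 0 < r \<and> 0 \<le> H \<and> r * r = a * b + 1 \<and> a * D < (H + 1) * (H + 1)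
     \<and> (\<forall>s\<in>{1..b}. \<forall>t\<in>{1..b}. b * (s * s) - a * (t * t) = b - a \<longrightarrow> (s, t) \<in> set S)
     \<and> (\<forall>p\<in>set S. r * fst p + a * snd p \<le> H \<longrightarrow> (r * fst p + a * snd p, r * snd p + b * fst p) \<in> set S)"

lemma solutions_completeD:
  assumes S: "solutions_complete a b r H D S" and d: "d < D"
    and s: "0 < s" "s ^ 2 = a * d + 1" and t: "0 < t" "t ^ 2 = b * d + 1"
  shows "(s, t) \<in> set S"
proof (rule pell_solution_list[where a = a and b = b and r = r and H = H])
  have h: "0 < a" "a < b" "0 < r" "0 \<le> H" "r * r = a * b + 1" "a * D < (H + 1) * (H + 1)"
    using S by (simp_all add: solutions_complete_def)
  show "0 < a" "a < b" "0 < r" "r ^ 2 = a * b + 1" using h by (simp_all add: power2_eq_square)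
  show "b * s ^ 2 - a * t ^ 2 = b - a" unfolding s t by (simp add: algebra_simps)
  have "s < H + 1"
  proof (rule square_root_le(2))
    have "a * (d + 1) \<le> a * D" using h d by (intro mult_left_mono) auto
    then show "s ^ 2 < (H + 1) ^ 2" unfolding s using h by (simp add: power2_eq_square algebra_simps)
  qed (use h in simp)
  then show "s \<le> H" by simp
qed (use S s t in \<open>auto simp: solutions_complete_def power2_eq_square\<close>)

text \<open>A pair (s, t) stands for d = (s^2 - 1) / a. In these lists all such d are at most b^5,
  except d = 1680 from s = 41 here.\<close>

lemma solutions_1_3: "solutions_complete 1 3 2 85 7372 [(1, 1), (3, 5), (11, 19), (41, 71)]"
  by (simp add: solutions_complete_def ball_int_interval)

lemma solutions_2_4: "solutions_complete 2 4 3 144 10369 [(1, 1), (5, 7), (29, 41)]"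
  by (simp add: solutions_complete_def ball_int_interval)

lemma solutions_3_5: "solutions_complete 3 5 4 219 16039 [(1, 1), (7, 9), (55, 71)]"
  by (simp add: solutions_complete_def ball_int_interval)

lemma solutions_4_6: "solutions_complete 4 6 5 305 23401 [(1, 1), (9, 11), (89, 109)]"
  by (simp add: solutions_complete_def ball_int_interval)

lemma solutions_5_7: "solutions_complete 5 7 6 404 32671 [(1, 1), (11, 13), (131, 155)]"
  by (simp add: solutions_complete_def ball_int_interval)

lemma solutions_1_8: "solutions_complete 1 8 3 350 123080 [(1, 1), (2, 5), (4, 11), (11, 31), (23, 65), (64, 181), (134, 379)]"
  by (simp add: solutions_complete_def ball_int_interval)

lemma solutions_3_8: "solutions_complete 3 8 5 427 60918 [(1, 1), (2, 3), (8, 13), (19, 31), (79, 129), (188, 307)]"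
  by (simp add: solutions_complete_def ball_int_interval)

lemma solutions_6_8: "solutions_complete 6 8 7 512 43709 [(1, 1), (13, 15), (181, 209)]"
  by (simp add: solutions_complete_def ball_int_interval)

lemma solutions_2_12: "solutions_complete 2 12 5 750 281251 [(1, 1), (3, 7), (7, 17), (29, 71), (69, 169), (287, 703), (683, 1673)]"
  by (simp add: solutions_complete_def ball_int_interval)

lemma solutions_1_15: "solutions_complete 1 15 4 991 983852 [(1, 1), (3, 11), (5, 19), (23, 89), (39, 151), (181, 701), (307, 1189)]"
  by (simp add: solutions_complete_def ball_int_interval)

text \<open>The search runs over the root r < 20 and the divisors a < r of r^2 - 1, with b as the
  cofactor.\<close>

lemma small_pairs:
  assumes "0 < a" "a < b" "b < (20 :: int)" "sq a b"
  shows "(a, b) \<in> {(1, 3), (2, 4), (3, 5), (4, 6), (5, 7), (1, 8), (3, 8), (6, 8), (7, 9), (8, 10), (9, 11), (2, 12), (4, 12), (10, 12), (11, 13), (12, 14), (1, 15), (8, 15), (13, 15), (3, 16), (5, 16), (14, 16), (15, 17), (16, 18), (17, 19)}"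
proof -
  obtain r where r: "0 < r" "r ^ 2 = a * b + 1" using assms by (auto elim: sqE)
  have "r < 20"
  proof (rule square_root_le(2))
    have "a * b \<le> 19 * 19" using assms by (intro mult_mono) auto
    then show "r ^ 2 < 20 ^ 2" unfolding r by simp
  qed simp
  have "a < r"
  proof (rule square_root_le(2))
    have "a * a \<le> a * b" using assms by simp
    then show "a ^ 2 < r ^ 2" unfolding r by (simp add: power2_eq_square)
  qed (use r in simp)
  have "\<forall>r\<in>{1..19 :: int}. \<forall>a\<in>{1..r - 1}. (r * r - 1) mod a = 0 \<longrightarrow> (r * r - 1) div a < 20
      \<longrightarrow> (a, (r * r - 1) div a) \<in> {(1, 3), (2, 4), (3, 5), (4, 6), (5, 7), (1, 8), (3, 8), (6, 8), (7, 9), (8, 10), (9, 11), (2, 12), (4, 12), (10, 12), (11, 13), (12, 14), (1, 15), (8, 15), (13, 15), (3, 16), (5, 16), (14, 16), (15, 17), (16, 18), (17, 19)}"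
    by (simp add: ball_int_interval)
  moreover have "r * r - 1 = a * b" using r by (simp add: power2_eq_square)
  then have "(r * r - 1) mod a = 0" "(r * r - 1) div a = b" using assms by simp_all
  moreover have "r \<in> {1..19}" "a \<in> {1..r - 1}" using assms r \<open>r < 20\<close> \<open>a < r\<close> by simp_all
  ultimately show ?thesis using assms(3) by metis
qed

text \<open>In all cases L = 3 \<sigma>, so the index condition is free of d and reads 2 b (b / (20
  a))^\<sigma> \<le> 1; with a = 1 this requires b < 20. For ten pairs the conditions are met only
  at a D above b^5 + 1, and the solution lists cover the gap; for the others D = b^5 + 1.\<close>

lemma no_regular_start_small:
  assumes "b < 20" "sq a b" "b ^ 5 < d" "(a, b, d) \<noteq> (1, 3, 1680)"
  shows "\<not> regular_start a b d e"
proof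
  assume R: "regular_start a b d e"
  then have pos: "0 < a" "a < b" and "sq a d \<and> sq b d"
    by (auto simp: regular_start_def sq_def)
  obtain s t where s: "0 < s" "s ^ 2 = a * d + 1" and t: "0 < t" "t ^ 2 = b * d + 1"
    using R by (auto simp: regular_start_def)
  have no: "D \<le> d \<Longrightarrow> 0 < D \<Longrightarrow> 17 * b ^ 3 * (85 * b ^ 4) ^ Suc j \<le> (8 * a) ^ Suc j * D ^ j
     \<Longrightarrow> 2 * b * (16 * a ^ 2 * b) ^ Suc j \<le> 5 ^ Suc j * (4 * a) ^ L * D ^ (L - 3 * Suc j) \<Longrightarrow> 3 * Suc j \<le> L \<Longrightarrow> 2 \<le> L
     \<Longrightarrow> 4 * int L ^ 2 * b + 2 * int L ^ 2 + 1 \<le> D \<Longrightarrow> False" for D j L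
    using no_regular_start R by blast
  have bound: "D \<le> d" if "solutions_complete a b r H D S" "\<forall>p\<in>set S. fst p ^ 2 \<noteq> a * d + 1" for D r H S
  proof (rule ccontr)
    assume "\<not> D \<le> d"
    then have "(s, t) \<in> set S" using solutions_completeD[OF that(1) _ s t] by simp
    then show False using that(2) s by force
  qed
  from small_pairs[OF pos assms(1,2)]
  consider "a = 1" "b = 3" | "a = 2" "b = 4" | "a = 3" "b = 5" | "a = 4" "b = 6" | "a = 5" "b = 7" | "a = 1" "b = 8" | "a = 3" "b = 8" | "a = 6" "b = 8" | "a = 7" "b = 9" | "a = 8" "b = 10" | "a = 9" "b = 11" | "a = 2" "b = 12" | "a = 4" "b = 12" | "a = 10" "b = 12" | "a = 11" "b = 13" | "a = 12" "b = 14" | "a = 1" "b = 15" | "a = 8" "b = 15" | "a = 13" "b = 15" | "a = 3" "b = 16" | "a = 5" "b = 16" | "a = 14" "b = 16" | "a = 15" "b = 17" | "a = 16" "b = 18" | "a = 17" "b = 19"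
    by force
  then show False
  proof cases
    case 1
    note ab = this
    have "7372 \<le> d" using assms(3,4) solutions_1_3 unfolding ab by (intro bound[unfolded ab]) auto
    then show ?thesis using no[of 7372 6 21] by (simp add: ab)
  next
    case 2
    note ab = this
    have "10369 \<le> d" using assms(3,4) solutions_2_4 unfolding ab by (intro bound[unfolded ab]) auto
    then show ?thesis using no[of 10369 7 24] by (simp add: ab)
  next
    case 3
    note ab = this
    have "16039 \<le> d" using assms(3,4) solutions_3_5 unfolding ab by (intro bound[unfolded ab]) auto
    then show ?thesis using no[of 16039 8 27] by (simp add: ab)
  next
    case 4
    note ab = this
    have "23401 \<le> d" using assms(3,4) solutions_4_6 unfolding ab by (intro bound[unfolded ab]) auto
    then show ?thesis using no[of 23401 9 30] by (simp add: ab)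
  next
    case 5
    note ab = this
    have "32671 \<le> d" using assms(3,4) solutions_5_7 unfolding ab by (intro bound[unfolded ab]) auto
    then show ?thesis using no[of 32671 10 33] by (simp add: ab)
  next
    case 6
    note ab = this
    have "123080 \<le> d" using assms(3,4) solutions_1_8 unfolding ab by (intro bound[unfolded ab]) auto
    then show ?thesis using no[of 123080 19 60] by (simp add: ab)
  next
    case 7
    note ab = this
    have "60918 \<le> d" using assms(3,4) solutions_3_8 unfolding ab by (intro bound[unfolded ab]) auto
    then show ?thesis using no[of 60918 13 42] by (simp add: ab)
  next
    case 8
    note ab = this
    have "43709 \<le> d" using assms(3,4) solutions_6_8 unfolding ab by (intro bound[unfolded ab]) auto
    then show ?thesis using no[of 43709 10 33] by (simp add: ab)
  next
    case 9
    then show ?thesis using no[of 59050 11 36] assms(3) by simp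
  next
    case 10
    then show ?thesis using no[of 100001 10 33] assms(3) by simp
  next
    case 11
    then show ?thesis using no[of 161052 9 30] assms(3) by simp
  next
    case 12
    note ab = this
    have "281251 \<le> d" using assms(3,4) solutions_2_12 unfolding ab by (intro bound[unfolded ab]) auto
    then show ?thesis using no[of 281251 24 75] by (simp add: ab)
  next
    case 13
    then show ?thesis using no[of 248833 15 48] assms(3) by simp
  next
    case 14
    then show ?thesis using no[of 248833 9 30] assms(3) by simp
  next
    case 15
    then show ?thesis using no[of 371294 8 27] assms(3) by simp
  next
    case 16
    then show ?thesis using no[of 537825 8 27] assms(3) by simp
  next
    case 17
    note ab = this
    have "983852 \<le> d" using assms(3,4) solutions_1_15 unfolding ab by (intro bound[unfolded ab]) auto
    then show ?thesis using no[of 983852 40 123] by (simp add: ab)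
  next
    case 18
    then show ?thesis using no[of 759376 10 33] assms(3) by simp
  next
    case 19
    then show ?thesis using no[of 759376 8 27] assms(3) by simp
  next
    case 20
    then show ?thesis using no[of 1048577 16 51] assms(3) by simp
  next
    case 21
    then show ?thesis using no[of 1048577 12 39] assms(3) by simp
  next
    case 22
    then show ?thesis using no[of 1048577 8 27] assms(3) by simp
  next
    case 23
    then show ?thesis using no[of 1419858 8 27] assms(3) by simp
  next
    case 24
    then show ?thesis using no[of 1889569 7 24] assms(3) by simp
  next
    case 25
    then show ?thesis using no[of 2476100 7 24] assms(3) by simp
  qed
qed

section \<open>The triple {1, 3, 1680}\<close>

primrec orbit :: "int \<Rightarrow> int \<Rightarrow> int \<Rightarrow> int \<Rightarrow> int \<Rightarrow> int \<Rightarrow> nat \<Rightarrow> int list" where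
  "orbit M u v w z x 0 = []"
| "orbit M u v w z x (Suc n) =
     ((u * z + v * x) mod M) # orbit M u v w ((u * z + v * x) mod M) ((u * x + w * z) mod M) n"

lemma orbit_numeral:
  "orbit M u v w z x (numeral k) =
     ((u * z + v * x) mod M) # orbit M u v w ((u * z + v * x) mod M) ((u * x + w * z) mod M) (pred_numeral k)"
  by (simp only: numeral_eq_Suc orbit.simps)

lemma pell_Suc_front:
  "pell a C s z x (Suc m) = pell a C s ((2 * s ^ 2 - 1) * z + 2 * s * C * x) ((2 * s ^ 2 - 1) * x + 2 * s * a * z) m"
  by (induction m) simp_all

text \<open>The orbit starts with index 1: at index 0 both sequences have the value \<epsilon>, so
  including it would make the orbits meet.\<close>

lemma pell_mod_in_orbit:
  assumes "z mod M = z1 mod M" "x mod M = x1 mod M" "1 \<le> m" "m \<le> n"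
  shows "fst (pell a C s z x m) mod M \<in> set (orbit M (2 * s ^ 2 - 1) (2 * s * C) (2 * s * a) z1 x1 n)"
  using assms
proof (induction n arbitrary: z x z1 x1 m)
  case (Suc n)
  let ?z = "(2 * s ^ 2 - 1) * z + 2 * s * C * x" and ?x = "(2 * s ^ 2 - 1) * x + 2 * s * a * z"
  have step: "?z mod M = ((2 * s ^ 2 - 1) * z1 + 2 * s * C * x1) mod M" "?x mod M = ((2 * s ^ 2 - 1) * x1 + 2 * s * a * z1) mod M"
    by (rule mod_add_cong; rule mod_mult_cong; (rule refl | rule Suc.prems))+
  obtain k where m: "m = Suc k" using Suc.prems by (cases m) auto
  show ?case
  proof (cases k)
    case 0
    then show ?thesis using m step by simp
  next
    case (Suc k')
    then show ?thesis
      using Suc.IH[of ?z "((2 * s ^ 2 - 1) * z1 + 2 * s * C * x1) mod M" ?x "((2 * s ^ 2 - 1) * x1 + 2 * s * a * z1) mod M" k]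
        step m Suc.prems unfolding m pell_Suc_front by simp
  qed
qed simp

text \<open>For the triple \<open>{1, 3, 1680}\<close> the congruences modulo \<open>2 d\<close> admit small solutions; instead the two
  sequences have no common value modulo 559 in the relevant range.\<close>

lemma orbits_disjoint:
  "set (orbit 559 3361 137760 82 1 1 63) \<inter> set (orbit 559 10081 238560 426 1 1 63) = {}"
  "set (orbit 559 3361 137760 82 (- 1) 1 63) \<inter> set (orbit 559 10081 238560 426 (- 1) 1 63) = {}"
  by (simp_all add: orbit_numeral)

lemma no_regular_start_1_3_1680: "\<not> regular_start 1 3 1680 e"
proof
  assume "regular_start 1 3 1680 e"
  then obtain \<epsilon> s t x y z m n where h: "\<epsilon> = 1 \<or> \<epsilon> = - 1"
     "0 < s" "s ^ 2 = 1 * 1680 + 1" "0 < t" "t ^ 2 = 3 * 1680 + 1" "0 < x" "x ^ 2 = 1 * e + 1"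
     "0 < y" "y ^ 2 = 3 * e + 1" "0 < z" "z ^ 2 = 1680 * e + 1"
     "pell_seq 1 1680 s \<epsilon> 1" "pell 1 1680 s \<epsilon> 1 m = (z, x)" "pell_seq 3 1680 t \<epsilon> 1" "pell 3 1680 t \<epsilon> 1 n = (z, y)" "1 \<le> m" "1 \<le> n"
    unfolding regular_start_def by blast
  \<comment> \<open>Again L = 3 \<sigma>, with \<sigma> = 21. At this L the bound 2 t L + L^2
    exceeds 1680, so \<open>trivial_start_index_small\<close> gives no contradiction.\<close>
  have "m \<le> 63 \<and> n \<le> 63"
    by (rule trivial_start_index_le[OF _ _ _ _ h(1-15), where \<sigma> = 21]) simp_all
  have st: "s = 41" "t = 71"
    by (rule power2_eq_imp_eq; use h in simp)+
  \<comment> \<open>The orbit parameters are 2 s^2 - 1, 2 s d and 2 s a for s = 41, a = 1, and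
    correspondingly for t = 71, b = 3.\<close>
  have "z mod 559 \<in> set (orbit 559 3361 137760 82 \<epsilon> 1 63)"
    using pell_mod_in_orbit[of \<epsilon> 559 \<epsilon> 1 1 m 63 1 1680 41] h \<open>m \<le> 63 \<and> n \<le> 63\<close> st by simp
  moreover have "z mod 559 \<in> set (orbit 559 10081 238560 426 \<epsilon> 1 63)"
    using pell_mod_in_orbit[of \<epsilon> 559 \<epsilon> 1 1 n 63 3 1680 71] h \<open>m \<le> 63 \<and> n \<le> 63\<close> st by simp
  ultimately show False using orbits_disjoint h(1) by blast
qed

section \<open>Combining the cases E = 0 and E > 0\<close>

lemma quint_trivial_start:
  assumes q: "quint a b c d e" and \<epsilon>: "\<epsilon> = 1 \<or> \<epsilon> = - 1" and z: "0 < z" "z ^ 2 = d * e + 1"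
    and ext: "\<And>i s x. \<lbrakk>0 < i; i < d; 0 < s; s ^ 2 = i * d + 1; 0 < x; x ^ 2 = i * e + 1\<rbrakk>
        \<Longrightarrow> \<exists>m. pell_seq i d s \<epsilon> 1 \<and> 1 \<le> m \<and> pell i d s \<epsilon> 1 m = (z, x)"
  shows "regular_start a b d e"
proof -
  have pos: "0 < a" "a < b" "b < c" "c < d" "d < e" and sqs: "sq a d" "sq b d" "sq a e" "sq b e"
    using q by (auto simp: quint_def)
  have "100 \<le> d" using quadruple_lower_bound[OF quint_quad(1)[OF q]] by simp
  obtain s where s: "0 < s" "s ^ 2 = a * d + 1" using sqs pos by (auto elim: sqE)
  obtain t where t: "0 < t" "t ^ 2 = b * d + 1" using sqs pos by (auto elim: sqE)
  obtain x where x: "0 < x" "x ^ 2 = a * e + 1" using sqs pos by (auto elim: sqE)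
  obtain y where y: "0 < y" "y ^ 2 = b * e + 1" using sqs pos by (auto elim: sqE)
  obtain m where m: "pell_seq a d s \<epsilon> 1" "1 \<le> m" "pell a d s \<epsilon> 1 m = (z, x)"
    using ext[of a s x] pos s x by auto
  obtain n where n: "pell_seq b d t \<epsilon> 1" "1 \<le> n" "pell b d t \<epsilon> 1 n = (z, y)"
    using ext[of b t y] pos t y by auto
  have "b < d" using pos by simp
  with \<open>100 \<le> d\<close> show ?thesis unfolding regular_start_def using pos(1,2) \<epsilon> s t x y z m n by blast
qed

text \<open>The analytic bound with \<sigma> = 5. From d \<ge> W^7 with W at least b and 120, both
  16 a^2 b and 2 b are at most d, so z is at most d^2 (d^4)^5 = d^22, short of the d^25 that E > 0
  demands.\<close>

lemma extension_not_large:
  assumes q: "quint a b c d e" and W: "b \<le> W" "W ^ 7 \<le> d" "120 \<le> W"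
    and z: "0 < z" "z ^ 2 = d * e + 1"
  shows "z < d ^ 25"
proof -
  have pos: "0 < a" "a < b" "b < c" "c < d" "d < e" and sqs: "sq a d" "sq b d" "sq a e" "sq b e"
    using q by (auto simp: quint_def)
  have d100: "100 \<le> d" using quadruple_lower_bound[OF quint_quad(1)[OF q]] by simp
  obtain s where s: "0 < s" "s ^ 2 = a * d + 1" using sqs pos by (auto elim: sqE)
  obtain t where t: "0 < t" "t ^ 2 = b * d + 1" using sqs pos by (auto elim: sqE)
  obtain x where x: "0 < x" "x ^ 2 = a * e + 1" using sqs pos by (auto elim: sqE)
  obtain y where y: "0 < y" "y ^ 2 = b * e + 1" using sqs pos by (auto elim: sqE)
  interpret approximants a b d by unfold_locales (use pos d100 in auto)
  have \<sigma>: "17 * b ^ 3 * d * (85 * b ^ 4) ^ 5 \<le> (8 * a * d) ^ 5"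
  proof -
    \<comment> \<open>The exponent is 3 + 4 * 5 = 23; together with five factors 120 this fits into
      W^28 = (W^7)^4.\<close>
    have "b ^ 23 \<le> W ^ 23" using W pos by (intro power_mono) auto
    moreover have "120 ^ 5 \<le> W ^ 5" using W by (intro power_mono) auto
    ultimately have "b ^ 23 * 120 ^ 5 \<le> W ^ 23 * W ^ 5" using W by (intro mult_mono) auto
    also have "\<dots> = (W ^ 7) ^ 4" by (simp flip: power_add power_mult)
    also have "\<dots> \<le> d ^ 4" using W by (intro power_mono) auto
    finally have "b ^ 23 * 120 ^ 5 \<le> d ^ 4" .
    then have "120 ^ 5 * (b ^ 23 * d) \<le> d ^ 4 * d"
      using mult_right_mono[of "b ^ 23 * 120 ^ 5" "d ^ 4" d] pos by (simp add: mult_ac)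
    moreover have "0 \<le> b ^ 23 * d" using pos by simp
    ultimately have "17 * 85 ^ 5 * (b ^ 23 * d) \<le> 8 ^ 5 * (d ^ 4 * d)" by simp
    also have "\<dots> = (8 * 1 * d) ^ 5" by (simp add: power_mult_distrib eval_nat_numeral)
    also have "\<dots> \<le> (8 * a * d) ^ 5" using pos by (intro power_mono mult_right_mono) auto
    finally show ?thesis by (simp add: power_mult_distrib mult_ac flip: power_mult power_add)
  qed
  have "z * 5 ^ 5 \<le> 2 * b * d * (16 * a ^ 2 * b * d ^ 3) ^ 5"
    by (rule extension_bound[where s = s and t = t and x' = x and y = y and e = e]) (use pos s t x y z \<sigma> in auto)
  also have "\<dots> \<le> d * d * (d * d ^ 3) ^ 5"
  proof (intro mult_mono power_mono)
    have "120 ^ 4 * W ^ 3 \<le> W ^ 4 * W ^ 3" using W by (intro mult_right_mono power_mono) auto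
    also have "\<dots> = W ^ 7" by (simp flip: power_add)
    finally have "207360000 * W ^ 3 \<le> W ^ 7" by simp
    moreover have "0 \<le> W ^ 3" by (rule zero_le_power) (use W in simp)
    ultimately have W3: "16 * W ^ 3 \<le> d" using W by linarith
    have "a ^ 2 * b \<le> W ^ 2 * W" using W pos by (intro mult_mono power_mono) auto
    then show "16 * a ^ 2 * b \<le> d" using W3 by (simp add: power2_eq_square power3_eq_cube)
    have "1 * W \<le> W ^ 2 * W" using W by (intro mult_right_mono one_le_power) auto
    then have "W \<le> W ^ 3" by (simp add: power2_eq_square power3_eq_cube)
    then show "2 * b \<le> d" using W W3 by linarith
  qed (use pos in auto)
  also have "\<dots> = d ^ 22" by (simp add: eval_nat_numeral)
  also have "\<dots> < d ^ 25" using d100 by (intro power_strict_increasing) auto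
  finally show ?thesis using z by simp
qed

text \<open>The assumption d > b^5 enters through E = 0. For E > 0 the growth bound supplies p4^7
  \<le> d with b \<le> p4, and the estimates d^25 \<le> z and z < d^25 collide.\<close>

lemma no_quint:
  assumes q: "quint a b c d e"
  shows "d \<le> b ^ 5"
proof (rule ccontr)
  assume "\<not> d \<le> b ^ 5"
  then have d: "b ^ 5 < d" by simp
  have pos: "0 < a" "a < b" "b < c" "c < d" "d < e" and ab: "sq a b"
    using q by (auto simp: quint_def)
  show False
  proof (rule quint_cases[OF q])
    fix \<epsilon> z
    assume "\<epsilon> = 1 \<or> \<epsilon> = - 1" "0 < z" "z ^ 2 = d * e + 1"
      "\<And>i s x. \<lbrakk>0 < i; i < d; 0 < s; s ^ 2 = i * d + 1; 0 < x; x ^ 2 = i * e + 1\<rbrakk>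
        \<Longrightarrow> \<exists>m. pell_seq i d s \<epsilon> 1 \<and> 1 \<le> m \<and> pell i d s \<epsilon> 1 m = (z, x)"
    then have R: "regular_start a b d e" by (rule quint_trivial_start[OF q])
    show False
    proof (cases "20 \<le> b")
      case True
      then show ?thesis using no_regular_start_large[OF True pos(1,2) d] R by blast
    next
      case False
      then show ?thesis
        using no_regular_start_small[of b a d e] no_regular_start_1_3_1680[of e] ab d R by fastforce
    qed
  next
    fix \<rho> E z p1 p2 p3 p4
    assume z: "0 < z" "z ^ 2 = d * e + 1" and \<rho>: "\<rho> ^ 2 = d * E + 1" "- d < \<rho>" and E: "1 \<le> E" "E < d"
      and q': "quint p1 p2 p3 p4 d" "c \<le> p4" "E \<le> p4"
      and ext: "\<And>i s x. \<lbrakk>0 < i; i < d; 0 < s; s ^ 2 = i * d + 1; 0 < x; x ^ 2 = i * e + 1\<rbrakk>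
        \<Longrightarrow> \<exists>m x0. pell_seq i d s \<rho> x0 \<and> x0 ^ 2 = i * E + 1 \<and> 1 \<le> m \<and> pell i d s \<rho> x0 m = (z, x)"
    have W: "p4 ^ 7 \<le> d" "120 \<le> p4"
      using quint_growth[OF q'(1)] quadruple_lower_bound[OF quint_quad(1)[OF q'(1)]] by auto
    then have "d ^ 25 \<le> z"
      using nontrivial_extension_large[OF q z \<rho> E q'(2,3) _ _ ext] by blast
    moreover have "b \<le> p4" using pos q' by simp
    ultimately show False using extension_not_large[OF q _ W z] by simp
  qed
qed

theorem theorem2:
  fixes a b c d e :: nat
  shows "\<not> (diophantine_quintuple a b c d e \<and> d > b ^ 5)"
proof
  assume h: "diophantine_quintuple a b c d e \<and> d > b ^ 5"
  have sq: "sq (int x) (int y)" if xy: "is_square (x * y + 1)" for x y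
  proof -
    obtain k where "x * y + 1 = k ^ 2" using xy unfolding is_square_def by blast
    then have "int k ^ 2 = int x * int y + 1" by (metis of_nat_1 of_nat_add of_nat_mult of_nat_power)
    then show ?thesis by (auto simp: sq_def)
  qed
  have sq': "sq (int x) (int y)" if "x \<in> {a, b, c, d, e}" "y \<in> {a, b, c, d, e}" "x < y" for x y
    by (rule sq) (use h that in \<open>unfold diophantine_quintuple_def, blast\<close>)
  have lt: "0 < a" "a < b" "b < c" "c < d" "d < e"
    using h unfolding diophantine_quintuple_def by blast+
  then have "quint (int a) (int b) (int c) (int d) (int e)"
    unfolding quint_def by (intro conjI sq') simp_all
  then have "int d \<le> int b ^ 5" by (rule no_quint)
  then have "d \<le> b ^ 5" by (simp flip: of_nat_power)
  then show False using h by simp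
qed

end
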